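(* Let $M=\{1,2,3\}$, $S_d:=\{v\in\mathbb{R}^d_{\ge0}:\sum_iv_i\le1\}$ with Lebesgue measure, $\psi_n:=\int_0^1(1-t^2)^n\,dt=2^n\,n!/(2n+1)!!$, and $(n)_3:=n(n-1)(n-2)$. For all $n\ge1$, $$2^n\operatorname{Vol}(\mathcal{H}_{3,n})=-\frac{8}{(n+1)(2n+1)(2n+3)}+\frac{15\,\psi_n}{2(n+1)(2n+3)}+\frac{8\,(n)_3\,J_n}{(2n+1)(2n+2)(2n+3)}+\frac{24\,(n)_3\,K_n+12\,n(n-1)\,K'_n}{n(2n+1)(2n+2)(2n+3)}$$ and $$2^n\bigl(\operatorname{Vol}(\mathcal{P}_{3,n}\cap \mathcal{D}_{3,n})-\operatorname{Vol}(\mathcal{H}_{3,n})\bigr)=\frac{4\,(n)_3\,G_n}{(2n+1)(2n+2)(2n+3)}\,,$$ where the terms with the factor $(n)_3$ are absent for $n\le2$ and $$J_n:=\int_{S_3}\prod_{l\in M}\Bigl(1-\sum_{i\in M,\, i\ne l}v_i\Bigr)(1-|v|^2)^{n-3}\,dv,$$ $$K_n:=\int_{S_2}(1-v_1)(1-v_2)(1-v_1-v_2)(1-|v|^2)^{n-3}\,dv,$$ $$K'_n:=\int_{S_2}(1-v_1-v_2)(1-|v|^2)^{n-2}\,dv,$$ $$G_n:=\int_{S_3}w_1w_2w_3\,\phi(w)^{n-3}\,dw,$$ with $\phi(w):=1-\frac34(1-W)^2-(1-W)W-|w|^2$ and $W:=w_1+w_2+w_3$.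
   Context: For integers $m\ge2$, $n\ge1$, let $\mathcal{P}_{m,n}$ be the set of $(x,y)\in\mathbb{R}^{m\times n}\times\mathbb{R}^m$ with $0\le x_{ij}\le y_i$ for all $1\le i\le m$, $1\le j\le n$, and $y_i\le 1$ for all $i$. Let $\mathcal{D}_{m,n}=\{(x,y)\in\mathbb{R}^{m\times n}\times\mathbb{R}^m:\ \sum_{i=1}^m x_{ij}=1\ \text{for all } 1\le j\le n\}$, an affine subspace of dimension $d=(m-1)n+m$. The integer hull is $\mathcal{H}_{m,n}:=\operatorname{conv}\{(x,y)\in \mathcal{P}_{m,n}\cap \mathcal{D}_{m,n}:\ y\in\{0,1\}^m\}$. For $K\subset\mathcal{D}_{m,n}$, $\operatorname{Vol}(K)$ denotes the $d$-dimensional Lebesgue measure of the image of $K$ under the coordinate projection $\mathcal{D}_{m,n}\to\mathbb{R}^d$ that deletes the variables $x_{mj}$, $1\le j\le n$ (an affine bijection). $|\cdot|$ is the Euclidean norm on vectors, and $(2n+1)!!=1\cdot3\cdot5\cdots(2n+1)$. *)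

theory Defs
  imports "HOL-Analysis.Analysis"
begin

text \<open>
  A point of \<open>\<real>\<^bsup>m\<times>n\<^esup> \<times> \<real>\<^bsup>m\<^esup>\<close> is a pair \<open>(x, y)\<close> with \<open>m = CARD('m)\<close> and \<open>n = CARD('n)\<close>;
  \<open>x $ i $ j\<close> is the entry in row \<open>i\<close> and column \<open>j\<close>.
\<close>

definition lin_relax :: "((real ^ 'n ^ 'm) \<times> (real ^ 'm)) set" where
  "lin_relax = {(x, y). (\<forall>i j. 0 \<le> x $ i $ j \<and> x $ i $ j \<le> y $ i) \<and> (\<forall>i. y $ i \<le> 1)}"

definition assign_space :: "((real ^ 'n ^ 'm) \<times> (real ^ 'm)) set" where
  "assign_space = {(x, y). \<forall>j. (\<Sum>i\<in>UNIV. x $ i $ j) = 1}"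

definition int_hull :: "((real ^ 'n ^ 'm) \<times> (real ^ 'm)) set" where
  "int_hull = convex hull {(x, y). (x, y) \<in> lin_relax \<inter> assign_space \<and> (\<forall>i. y $ i \<in> {0, 1})}"

text \<open>
  The case \<open>m = 3\<close> of the coordinate projection that deletes the last row of \<open>x\<close>. The index type
  \<open>3\<close> has the elements \<open>1\<close>, \<open>2\<close> and \<open>3 = 0\<close>. The image lies in a space of dimension \<open>2n + 3\<close>.
\<close>

definition delete_row3 :: "(real ^ 'n ^ 3) \<times> (real ^ 3) \<Rightarrow> (real ^ 'n ^ 2) \<times> (real ^ 3)" where
  "delete_row3 = (\<lambda>(x, y). (vector [x $ 1, x $ 2], y))"

definition Vol3 :: "((real ^ 'n ^ 3) \<times> (real ^ 3)) set \<Rightarrow> real" where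
  "Vol3 K = measure lebesgue (delete_row3 ` K)"

definition corner_simplex :: "(real ^ 'd) set" where
  "corner_simplex = {v. (\<forall>i. 0 \<le> v $ i) \<and> (\<Sum>i\<in>UNIV. v $ i) \<le> 1}"

definition odd_double_fact :: "nat \<Rightarrow> nat" where
  \<comment> \<open>\<open>(2n + 1)!! = 1 \<cdot> 3 \<cdot> 5 \<cdots> (2n + 1)\<close>\<close>
  "odd_double_fact n = (\<Prod>k\<le>n. (2 * k + 1))"

definition psi :: "nat \<Rightarrow> real" where
  "psi n = (LINT t:{0..1::real}|lebesgue. (1 - t\<^sup>2) ^ n)"

definition falling3 :: "nat \<Rightarrow> real" where
  "falling3 n = real n * (real n - 1) * (real n - 2)"

text \<open>
  The exponents \<open>n - 3\<close> and \<open>n - 2\<close> below are truncated at \<open>0\<close> for small \<open>n\<close>. This is harmless: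
  the integrals are only used with a factor \<open>falling3 n\<close> (zero for \<open>n \<le> 2\<close>) or, for \<open>K'_int\<close>,
  \<open>n (n - 1)\<close> (zero for \<open>n \<le> 1\<close>).
\<close>

definition J_int :: "nat \<Rightarrow> real" where
  "J_int n = (LINT v:(corner_simplex :: (real ^ 3) set)|lebesgue.
     (\<Prod>l\<in>UNIV. 1 - (\<Sum>i\<in>UNIV - {l}. v $ i)) * (1 - (norm v)\<^sup>2) ^ (n - 3))"

definition K_int :: "nat \<Rightarrow> real" where
  "K_int n = (LINT v:(corner_simplex :: (real ^ 2) set)|lebesgue.
     (1 - v $ 1) * (1 - v $ 2) * (1 - v $ 1 - v $ 2) * (1 - (norm v)\<^sup>2) ^ (n - 3))"

definition K'_int :: "nat \<Rightarrow> real" where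
  "K'_int n = (LINT v:(corner_simplex :: (real ^ 2) set)|lebesgue.
     (1 - v $ 1 - v $ 2) * (1 - (norm v)\<^sup>2) ^ (n - 2))"

definition phi :: "real ^ 3 \<Rightarrow> real" where
  "phi w = (let W = w $ 1 + w $ 2 + w $ 3
            in 1 - 3 / 4 * (1 - W)\<^sup>2 - (1 - W) * W - (norm w)\<^sup>2)"

definition G_int :: "nat \<Rightarrow> real" where
  "G_int n = (LINT w:(corner_simplex :: (real ^ 3) set)|lebesgue.
     w $ 1 * w $ 2 * w $ 3 * phi w ^ (n - 3))"

end

theory Submission
  imports Defs
begin

text \<open>
  For fixed \<open>y\<close>, the columns of \<open>x\<close> range independently over the polygon \<open>0 \<le> x\<^sub>i \<le> y\<^sub>i\<close>, \<open>\<Sum> x\<^sub>i = 1\<close>. The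
  integer hull is cut out of the relaxation by the inequalities \<open>x\<^sub>1\<^sub>j + x\<^sub>2\<^sub>k + x\<^sub>3\<^sub>l + \<Sum> y\<^sub>i \<ge> 2\<close>, that is, by
  \<open>\<Sum> m\<^sub>i + \<Sum> y\<^sub>i \<ge> 2\<close> for the row minima \<open>m\<close>. The columns with \<open>m \<le> x \<le> y\<close> fill a volume \<open>2\<^bsup>-n\<^esup> A(m,y)\<^sup>n\<close>,
  so for \<open>n \<ge> 2\<close> the minima have as density minus the mixed third derivative of this function. In the
  variables \<open>t = 1 - \<Sum> m\<^sub>i\<close> and \<open>u\<^sub>i = 1 - y\<^sub>i - m\<^sub>j - m\<^sub>k\<close> the density depends on each \<open>u\<^sub>i\<close> only through its
  positive part and its sign, and is homogeneous of degree \<open>2n - 3\<close>. After scaling \<open>u = t v\<close> the cut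
  becomes \<open>\<Sum> v\<^sub>i \<le> 1\<close>; splitting by the signs of the \<open>v\<^sub>i\<close> leaves Dirichlet integrals over \<open>m\<close>, with
  factors that are combinations of \<open>J\<^sub>n\<close>, \<open>K\<^sub>n\<close>, \<open>K'\<^sub>n\<close> and \<open>\<psi>\<^sub>n\<close>. On the complement \<open>\<Sum> v\<^sub>i > 1\<close> only
  \<open>v \<ge> 0\<close> contributes, and \<open>w\<^sub>i = 1 - v\<^sub>j - v\<^sub>k\<close> turns this part into \<open>G\<^sub>n\<close>. For \<open>n = 1\<close> the minima have no
  density, and the two bodies coincide.
\<close>

section \<open>Inclusion-exclusion for polygons in the plane of barycentric coordinates\<close>

text \<open>That all minima are at least \<open>m\<close> is a condition on each column separately,
  so its measure is the \<open>n\<close>-th power of one polygon area. This is why the law of the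
  minima is identified on upper orthants. Written by inclusion-exclusion with \<open>pp\<close>,
  \<open>area2\<close> is continuously differentiable in each lower bound and \<open>edge\<close> is
  piecewise linear; three applications of the fundamental theorem, each with finitely many kinks,
  therefore integrate the density back to \<open>area2 ^ n\<close>. The minima of a single column
  sum to 1, so their law is singular.

  The obstacle to splitting by signs is the cut \<open>x + y + z \<le> 1\<close>, which involves the
  sizes of negative coordinates. If some coordinate is negative, however, the density vanishes as
  soon as the positive parts sum to more than 1. The cut may thus be imposed on the positive parts,
  and the gap lives on the positive octant, where the bounds \<open>y \<le> 1\<close> are automatic.

  The purely rational term of the hull formula has two sources: \<open>C2\<close> contributes -30
  and the all-negative octant 14 over a common denominator.\<close>

definition pp :: "real \<Rightarrow> real" where
  "pp x = max 0 x"

lemma pp_nonneg [simp]: "0 \<le> pp x"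
  by (simp add: pp_def)

lemma pp_eq [simp]: "0 \<le> x \<Longrightarrow> pp x = x" "x \<le> 0 \<Longrightarrow> pp x = 0"
  by (auto simp: pp_def)

lemma continuous_on_pp [continuous_intros]:
  "continuous_on A f \<Longrightarrow> continuous_on A (\<lambda>x. pp (f x))"
  unfolding pp_def by (intro continuous_intros)

lemma measurable_pp [measurable]: "pp \<in> borel_measurable borel"
  unfolding pp_def by measurable

lemma has_derivative_pp_diff:
  assumes "x \<noteq> c"
  shows "((\<lambda>x. pp (c - x)) has_real_derivative - of_bool (x < c)) (at x)"
proof (cases "x < c")
  case True
  have "((\<lambda>x. c - x) has_real_derivative - of_bool (x < c)) (at x)"
    using True by (auto intro!: derivative_eq_intros)
  then show ?thesis
    by (rule has_field_derivative_transform_within_open[where S = "{..<c}"])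
      (use True in \<open>auto simp: pp_def\<close>)
next
  case False
  have "((\<lambda>x. 0) has_real_derivative 0) (at x)"
    by simp
  then have "((\<lambda>x. pp (c - x)) has_real_derivative 0) (at x)"
    by (rule has_field_derivative_transform_within_open[where S = "{c<..}"])
      (use False assms in \<open>auto simp: pp_def\<close>)
  with False show ?thesis
    by simp
qed

text \<open>Squaring removes the kink: at \<open>x = c\<close> the difference quotient is bounded by
  the absolute value of \<open>h\<close>. Hence \<open>area2\<close> is differentiable everywhere,
  while \<open>edge\<close> is so only off its kinks.\<close>

lemma has_derivative_pp_diff_power2:
  "((\<lambda>x. (pp (c - x))\<^sup>2) has_real_derivative - 2 * pp (c - x)) (at x)"
proof (cases "x = c")
  case False
  then show ?thesis
    by (intro DERIV_cong[OF DERIV_power[OF has_derivative_pp_diff]]) (auto simp: pp_def)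
next
  case True
  have "((\<lambda>h. ((pp (c - (c + h)))\<^sup>2 - (pp (c - c))\<^sup>2) / h) \<longlongrightarrow> 0) (at 0)"
  proof (rule Lim_null_comparison)
    show "\<forall>\<^sub>F h in at 0. norm (((pp (c - (c + h)))\<^sup>2 - (pp (c - c))\<^sup>2) / h) \<le> \<bar>h\<bar>"
      by (intro always_eventually allI)
        (auto simp: pp_def abs_if power2_eq_square max_def)
    show "((\<lambda>h. \<bar>h\<bar>) \<longlongrightarrow> 0) (at (0::real))"
      using tendsto_rabs[OF tendsto_ident_at[of "0::real" UNIV]] by simp
  qed
  with True show ?thesis
    by (simp add: DERIV_def)
qed

text \<open>The form in which every integration over a lower bound is done. \<open>F\<close>
  vanishes at the upper end because the polygon degenerates there; \<open>S\<close> collects the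
  kinks of the edge lengths.\<close>

lemma nn_integral_FTC_decreasing:
  fixes F f :: "real \<Rightarrow> real"
  assumes "finite S" "a \<le> b"
    and deriv: "\<And>x. a < x \<Longrightarrow> x < b \<Longrightarrow> x \<notin> S \<Longrightarrow> (F has_real_derivative - f x) (at x)"
    and cont: "continuous_on {a..b} F"
    and nonneg: "\<And>x. a \<le> x \<Longrightarrow> x \<le> b \<Longrightarrow> 0 \<le> f x"
    and F0: "F b = 0"
  shows "(\<integral>\<^sup>+x. ennreal (f x) * indicator {a..b} x \<partial>lborel) = ennreal (F a)"
    and "0 \<le> F a"
proof -
  have "((\<lambda>x. - f x) has_integral (F b - F a)) {a..b}"
    by (rule fundamental_theorem_of_calculus_interior_strong[OF assms(1,2) _ cont])
      (auto intro!: deriv simp: has_real_derivative_iff_has_vector_derivative[symmetric])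
  then have int: "(f has_integral F a) {a..b}"
    using has_integral_neg[of "\<lambda>x. - f x" "F b - F a" "{a..b}"] F0 by simp
  have "(\<integral>\<^sup>+x. ennreal (f x) * indicator {a..b} x \<partial>lborel)
      = (\<integral>\<^sup>+x. ennreal (indicator {a..b} x * f x) \<partial>lborel)"
    by (intro nn_integral_cong) (auto simp: indicator_def)
  also have "\<dots> = ennreal (F a)"
    by (rule nn_integral_has_integral_lebesgue[OF _ int]) (use nonneg in auto)
  finally show "(\<integral>\<^sup>+x. ennreal (f x) * indicator {a..b} x \<partial>lborel) = ennreal (F a)" .
  show "0 \<le> F a"
    using has_integral_nonneg[OF int] nonneg by auto
qed

text \<open>
  The points \<open>x\<close> with \<open>x\<^sub>1 + x\<^sub>2 + x\<^sub>3 = 1\<close>, \<open>a \<le> x\<^sub>1 \<le> a'\<close>, \<open>b \<le> x\<^sub>2 \<le> b'\<close> and \<open>c \<le> x\<^sub>3 \<le> c'\<close> form a polygon.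
  In the coordinates \<open>(x\<^sub>1, x\<^sub>2)\<close>, twice its area is \<open>area2\<close>, and \<open>edge\<close> is the length of its side \<open>x\<^sub>1 = a\<close>.
\<close>

definition edge :: "real \<Rightarrow> real \<Rightarrow> real \<Rightarrow> real \<Rightarrow> real \<Rightarrow> real" where
  "edge a b c b' c' = pp (1 - a - b - c) - pp (1 - a - b' - c) - pp (1 - a - b - c') + pp (1 - a - b' - c')"

definition area2 :: "real \<Rightarrow> real \<Rightarrow> real \<Rightarrow> real \<Rightarrow> real \<Rightarrow> real \<Rightarrow> real" where
  "area2 a b c a' b' c' =
     (pp (1 - a - b - c))\<^sup>2 - (pp (1 - a' - b - c))\<^sup>2 - (pp (1 - a - b' - c))\<^sup>2 - (pp (1 - a - b - c'))\<^sup>2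
     + (pp (1 - a' - b' - c))\<^sup>2 + (pp (1 - a' - b - c'))\<^sup>2 + (pp (1 - a - b' - c'))\<^sup>2 - (pp (1 - a' - b' - c'))\<^sup>2"

lemma edge_swap: "edge a b c b' c' = edge a c b c' b'"
  by (simp add: edge_def algebra_simps)

lemma area2_rotate: "area2 a b c a' b' c' = area2 c a b c' a' b'"
  by (simp add: area2_def algebra_simps)

lemma edge_nonneg: "b \<le> b' \<Longrightarrow> c \<le> c' \<Longrightarrow> 0 \<le> edge a b c b' c'"
  by (simp add: edge_def pp_def max_def)

lemma edge_degenerate [simp]: "edge a b' c b' c' = 0" "edge a b c' b' c' = 0"
  by (simp_all add: edge_def)

lemma area2_degenerate [simp]:
  "area2 a' b c a' b' c' = 0" "area2 a b' c a' b' c' = 0" "area2 a b c' a' b' c' = 0"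
  by (simp_all add: area2_def)

text \<open>The side on \<open>x\<^sub>1 = a\<close> is a segment of length
  \<open>1 - a - b - c\<close>, shortened at its two ends by the upper bounds; the outer
  \<open>pp\<close> covers the case of overlapping cuts, which the fourth term of
  \<open>edge\<close> corrects.\<close>

lemma edge_eq:
  assumes "b \<le> b'" "c \<le> c'"
  shows "edge a b c b' c' = pp ((1 - a - b - c) - pp (1 - a - b' - c) - pp (1 - a - b - c'))"
  using assms by (simp add: edge_def pp_def max_def)

lemma continuous_on_edge [continuous_intros]:
  assumes "continuous_on A f1" "continuous_on A f2" "continuous_on A f3"
    "continuous_on A f4" "continuous_on A f5"
  shows "continuous_on A (\<lambda>x. edge (f1 x) (f2 x) (f3 x) (f4 x) (f5 x))"
  unfolding edge_def by (intro continuous_intros assms)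

lemma continuous_on_area2 [continuous_intros]:
  assumes "continuous_on A f1" "continuous_on A f2" "continuous_on A f3"
    "continuous_on A f4" "continuous_on A f5" "continuous_on A f6"
  shows "continuous_on A (\<lambda>x. area2 (f1 x) (f2 x) (f3 x) (f4 x) (f5 x) (f6 x))"
  unfolding area2_def by (intro continuous_intros assms)

text \<open>Raising the bound \<open>a\<close> sweeps away the side \<open>x\<^sub>1 = a\<close>;
  the factor 2 is there because \<open>area2\<close> is twice the area.\<close>

lemma has_derivative_area2:
  "((\<lambda>a. area2 a b c a' b' c') has_real_derivative - 2 * edge a b c b' c') (at a)"
proof -
  have eq: "(\<lambda>a. area2 a b c a' b' c') = (\<lambda>a. (pp ((1 - b - c) - a))\<^sup>2 - (pp (1 - a' - b - c))\<^sup>2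
     - (pp ((1 - b' - c) - a))\<^sup>2 - (pp ((1 - b - c') - a))\<^sup>2
     + (pp (1 - a' - b' - c))\<^sup>2 + (pp (1 - a' - b - c'))\<^sup>2 + (pp ((1 - b' - c') - a))\<^sup>2 - (pp (1 - a' - b' - c'))\<^sup>2)"
    by (simp add: area2_def algebra_simps)
  show ?thesis
    unfolding eq
    by (rule DERIV_cong, (rule derivative_intros has_derivative_pp_diff_power2)+)
      (simp add: edge_def algebra_simps)
qed

lemma has_derivative_edge:
  assumes "b \<noteq> 1 - a - c" "b \<noteq> 1 - a - c'"
  shows "((\<lambda>b. edge a b c b' c') has_real_derivative
     of_bool (b < 1 - a - c') - of_bool (b < 1 - a - c)) (at b)"
proof -
  have eq: "(\<lambda>b. edge a b c b' c') = (\<lambda>b. pp ((1 - a - c) - b) - pp (1 - a - b' - c)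
      - pp ((1 - a - c') - b) + pp (1 - a - b' - c'))"
    by (simp add: edge_def algebra_simps)
  show ?thesis
    unfolding eq
    by (rule DERIV_cong, (rule derivative_intros has_derivative_pp_diff assms)+) simp
qed

text \<open>The polygon is sliced parallel to the side \<open>x\<^sub>1 = a\<close>. Nonnegativity
  comes from the same antiderivative, since the slices have nonnegative length.\<close>

lemma area2_nonneg:
  assumes "a \<le> a'" "b \<le> b'" "c \<le> c'"
  shows "0 \<le> area2 a b c a' b' c'"
    and "(\<integral>\<^sup>+x. ennreal (2 * edge x b c b' c') * indicator {a..a'} x \<partial>lborel) = ennreal (area2 a b c a' b' c')"
proof -
  have D: "((\<lambda>a. area2 a b c a' b' c') has_real_derivative - (2 * edge x b c b' c')) (at x)" for x
    using has_derivative_area2[of b c a' b' c' x] by simp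
  have C: "continuous_on {a..a'} (\<lambda>x. area2 x b c a' b' c')"
    by (intro continuous_intros)
  note F = nn_integral_FTC_decreasing[of "{}" a a' "\<lambda>a. area2 a b c a' b' c'" "\<lambda>x. 2 * edge x b c b' c'"]
  show "0 \<le> area2 a b c a' b' c'"
    by (rule F(2)) (use assms D C edge_nonneg in auto)
  show "(\<integral>\<^sup>+x. ennreal (2 * edge x b c b' c') * indicator {a..a'} x \<partial>lborel) = ennreal (area2 a b c a' b' c')"
    by (rule F(1)) (use assms D C edge_nonneg in auto)
qed

text \<open>
  Minus the mixed third derivative of \<open>area2\<^sup>n\<close> in \<open>a\<close>, \<open>b\<close>, \<open>c\<close>. The terms with \<open>of_bool\<close> are the derivatives
  of the edge lengths, which are piecewise linear. For \<open>n = 2\<close> the exponent \<open>n - 3\<close> is truncated,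
  but then \<open>falling3 n = 0\<close>.
\<close>

definition min_density :: "nat \<Rightarrow> real \<Rightarrow> real \<Rightarrow> real \<Rightarrow> real \<Rightarrow> real \<Rightarrow> real \<Rightarrow> real" where
  "min_density n a b c a' b' c' =
     4 * real n * (real n - 1) * area2 a b c a' b' c' ^ (n - 2) *
       (of_bool (1 - a' - b - c < 0) * edge a b c b' c' + of_bool (1 - a - b' - c < 0) * edge b a c a' c'
        + of_bool (1 - a - b - c' < 0) * edge c a b a' b')
     + 8 * falling3 n * (edge a b c b' c' * edge b a c a' c' * edge c a b a' b') * area2 a b c a' b' c' ^ (n - 3)"

lemma edge_eq_0: "1 - a - b - c \<le> 0 \<Longrightarrow> b \<le> b' \<Longrightarrow> c \<le> c' \<Longrightarrow> edge a b c b' c' = 0"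
  by (simp add: edge_def)

lemma area2_eq_0:
  "1 - a - b - c \<le> 0 \<Longrightarrow> a \<le> a' \<Longrightarrow> b \<le> b' \<Longrightarrow> c \<le> c' \<Longrightarrow> area2 a b c a' b' c' = 0"
  by (simp add: area2_def)

lemma falling3_nonneg: "0 \<le> falling3 n"
proof -
  consider "n = 0" | "n = 1" | "n \<ge> 2" by linarith
  then show ?thesis
    by cases (auto simp: falling3_def)
qed

lemma min_density_nonneg:
  assumes "a \<le> a'" "b \<le> b'" "c \<le> c'" "1 \<le> n"
  shows "0 \<le> min_density n a b c a' b' c'"
  unfolding min_density_def using assms
  by (intro add_nonneg_nonneg mult_nonneg_nonneg zero_le_power area2_nonneg edge_nonneg falling3_nonneg) auto

lemma has_derivative_area2_3:
  "((\<lambda>c. area2 a b c a' b' c') has_real_derivative - 2 * edge c a b a' b') (at c)"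
  unfolding area2_rotate[of a b _ a' b'] by (rule has_derivative_area2)

lemma has_derivative_area2_2:
  "((\<lambda>b. area2 a b c a' b' c') has_real_derivative - 2 * edge b a c a' c') (at b)"
proof -
  have "area2 a b c a' b' c' = area2 b c a b' c' a'" for b
    by (metis area2_rotate)
  then show ?thesis
    using has_derivative_area2[of c a b' c' a' b] by (simp add: edge_swap)
qed

section \<open>Integrating the density back to a power of the area\<close>

lemma nn_integral_min_density_3:
  assumes le: "a \<le> a'" "b \<le> b'" "c \<le> c'" and n: "2 \<le> n"
  shows "(\<integral>\<^sup>+z. ennreal (min_density n a b z a' b' c') * indicator {c..c'} z \<partial>lborel)
    = ennreal (2 * real n * (of_bool (1 - a - b - c' < 0) * area2 a b c a' b' c' ^ (n - 1)
        + 2 * (real n - 1) * edge a b c b' c' * edge b a c a' c' * area2 a b c a' b' c' ^ (n - 2)))"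
    (is "_ = ennreal (?F c)")
proof (rule nn_integral_FTC_decreasing(1)[where F = ?F and S = "{1 - a - b, 1 - a - b', 1 - b - a'}"])
  show "finite {1 - a - b, 1 - a - b', 1 - b - a'}" by simp
  show "c \<le> c'" by fact
  show "continuous_on {c..c'} ?F"
    by (intro continuous_intros)
  \<comment> \<open>For \<open>n = 2\<close> the power \<open>area2 ^ (n - 2)\<close> is 1, and the
    second summand vanishes through its edge factors instead.\<close>
  show "?F c' = 0"
    using n by simp
  show "0 \<le> min_density n a b z a' b' c'" if "c \<le> z" "z \<le> c'" for z
    using that le n by (intro min_density_nonneg) auto
next
  fix z assume z: "c < z" "z < c'" "z \<notin> {1 - a - b, 1 - a - b', 1 - b - a'}"
  obtain k where k: "n = Suc (Suc k)"
    using n by (metis Suc_le_D numeral_2_eq_2 Suc_le_mono)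
  let ?A = "area2 a b z a' b' c'" and ?e1 = "edge a b z b' c'" and ?e2 = "edge b a z a' c'"
    and ?e3 = "edge z a b a' b'"
  define D1 :: real where "D1 = of_bool (z < 1 - a - b') - of_bool (z < 1 - a - b)"
  define D2 :: real where "D2 = of_bool (z < 1 - b - a') - of_bool (z < 1 - b - a)"
  have d1: "((\<lambda>c. edge a b c b' c') has_real_derivative D1) (at z)"
    unfolding edge_swap[of a b _ b'] D1_def using z by (intro has_derivative_edge) auto
  have d2: "((\<lambda>c. edge b a c a' c') has_real_derivative D2) (at z)"
    unfolding edge_swap[of b a _ a'] D2_def using z by (intro has_derivative_edge) auto
  note d3 = has_derivative_area2_3[of a b a' b' c' z]
  \<comment> \<open>For \<open>z\<close> beyond \<open>1 - a - b\<close> the factors in front of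
    \<open>?e2\<close> differ, but there the polygon is empty and \<open>?e2\<close> is 0.\<close>
  have e1: "- D1 * ?e2 = of_bool (1 - a - b' - z < 0) * ?e2"
  proof (cases "1 - a - b - z \<le> 0")
    case True
    then have "?e2 = 0"
      using le z by (intro edge_eq_0) auto
    then show ?thesis by simp
  next
    case False
    then show ?thesis
      using z unfolding D1_def by auto
  qed
  have e2: "- D2 * ?e1 = of_bool (1 - a' - b - z < 0) * ?e1"
  proof (cases "1 - a - b - z \<le> 0")
    case True
    then have "?e1 = 0"
      using le z by (intro edge_eq_0) auto
    then show ?thesis by simp
  next
    case False
    then show ?thesis
      using z unfolding D2_def by auto
  qed
  have "(?F has_real_derivative 2 * real n * (of_bool (1 - a - b - c' < 0) * (real (Suc k) * ?A ^ k * (- 2 * ?e3))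
      + 2 * (real n - 1) * ((D1 * ?e2 + ?e1 * D2) * ?A ^ k + ?e1 * ?e2 * (real k * ?A ^ (k - 1) * (- 2 * ?e3))))) (at z)"
    unfolding k
    by (rule DERIV_cong, (rule derivative_intros d1 d2 d3)+) (simp add: algebra_simps)
  also have "2 * real n * (of_bool (1 - a - b - c' < 0) * (real (Suc k) * ?A ^ k * (- 2 * ?e3))
      + 2 * (real n - 1) * ((D1 * ?e2 + ?e1 * D2) * ?A ^ k + ?e1 * ?e2 * (real k * ?A ^ (k - 1) * (- 2 * ?e3))))
    = - (2 * real n * (of_bool (1 - a - b - c' < 0) * (real (Suc k) * ?A ^ k * (2 * ?e3))
      + 2 * (real n - 1) * ((- D1 * ?e2 + - D2 * ?e1) * ?A ^ k + ?e1 * ?e2 * (real k * ?A ^ (k - 1) * (2 * ?e3)))))"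
    by (simp add: algebra_simps)
  also have "\<dots> = - min_density n a b z a' b' c'"
    unfolding e1 e2 min_density_def k falling3_def by (simp add: numeral_3_eq_3 algebra_simps)
  finally show "(?F has_real_derivative - min_density n a b z a' b' c') (at z)" .
qed

text \<open>The integrand is the mixed derivative of \<open>area2 ^ n\<close> in the first two
  bounds, left by the integration over the third; what remains is minus the derivative in the first
  bound.\<close>

lemma nn_integral_min_density_2:
  assumes le: "a \<le> a'" "b \<le> b'" "c \<le> c'" and n: "2 \<le> n"
  shows "(\<integral>\<^sup>+y. ennreal (2 * real n * (of_bool (1 - a - y - c' < 0) * area2 a y c a' b' c' ^ (n - 1)
        + 2 * (real n - 1) * edge a y c b' c' * edge y a c a' c' * area2 a y c a' b' c' ^ (n - 2)))
      * indicator {b..b'} y \<partial>lborel)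
    = ennreal (2 * real n * (edge a b c b' c' * area2 a b c a' b' c' ^ (n - 1)))"
    (is "integral\<^sup>N _ (\<lambda>y. ennreal (?f y) * _) = ennreal (?F b)")
proof (rule nn_integral_FTC_decreasing(1)[where F = ?F and S = "{1 - a - c, 1 - a - c'}"])
  show "finite {1 - a - c, 1 - a - c'}" by simp
  show "b \<le> b'" by fact
  show "continuous_on {b..b'} ?F"
    by (intro continuous_intros)
  show "?F b' = 0"
    using n by simp
  show "0 \<le> ?f y" if "b \<le> y" "y \<le> b'" for y
    using that le n
    by (intro add_nonneg_nonneg mult_nonneg_nonneg zero_le_power area2_nonneg edge_nonneg) auto
next
  fix y assume y: "b < y" "y < b'" "y \<notin> {1 - a - c, 1 - a - c'}"
  obtain k where k: "n = Suc (Suc k)"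
    using n by (metis Suc_le_D numeral_2_eq_2 Suc_le_mono)
  let ?A = "area2 a y c a' b' c'" and ?e1 = "edge a y c b' c'" and ?e2 = "edge y a c a' c'"
  define D1 :: real where "D1 = of_bool (y < 1 - a - c') - of_bool (y < 1 - a - c)"
  have d1: "((\<lambda>b. edge a b c b' c') has_real_derivative D1) (at y)"
    unfolding D1_def using y by (intro has_derivative_edge) auto
  note d2 = has_derivative_area2_2[of a c a' b' c' y]
  have e1: "- D1 * ?A ^ Suc k = of_bool (1 - a - y - c' < 0) * ?A ^ Suc k"
  proof (cases "1 - a - y - c \<le> 0")
    case True
    then have "?A = 0"
      using le y by (intro area2_eq_0) auto
    then show ?thesis by simp
  next
    case False
    then have "- D1 = of_bool (1 - a - y - c' < 0)"
      using y unfolding D1_def by auto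
    then show ?thesis by simp
  qed
  have "(?F has_real_derivative 2 * real n * (D1 * ?A ^ Suc k + ?e1 * (real (Suc k) * ?A ^ k * (- 2 * ?e2)))) (at y)"
    unfolding k
    by (rule DERIV_cong, (rule derivative_intros d1 d2)+) (simp add: algebra_simps)
  also have "2 * real n * (D1 * ?A ^ Suc k + ?e1 * (real (Suc k) * ?A ^ k * (- 2 * ?e2)))
    = - (2 * real n * (- D1 * ?A ^ Suc k + ?e1 * (real (Suc k) * ?A ^ k * (2 * ?e2))))"
    by (simp add: algebra_simps)
  also have "\<dots> = - ?f y"
    unfolding e1 k by (simp add: algebra_simps)
  finally show "(?F has_real_derivative - ?f y) (at y)" .
qed

lemma nn_integral_min_density_1:
  assumes le: "a \<le> a'" "b \<le> b'" "c \<le> c'" and n: "1 \<le> n"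
  shows "(\<integral>\<^sup>+x. ennreal (2 * real n * (edge x b c b' c' * area2 x b c a' b' c' ^ (n - 1)))
      * indicator {a..a'} x \<partial>lborel)
    = ennreal (area2 a b c a' b' c' ^ n)"
    (is "integral\<^sup>N _ (\<lambda>y. ennreal (?f y) * _) = ennreal (?F a)")
proof (rule nn_integral_FTC_decreasing(1)[where F = ?F and S = "{}"])
  show "finite {}" by simp
  show "a \<le> a'" by fact
  show "continuous_on {a..a'} ?F"
    by (intro continuous_intros)
  show "?F a' = 0"
    using n by simp
  show "0 \<le> ?f x" if "a \<le> x" "x \<le> a'" for x
    using that le n
    by (intro add_nonneg_nonneg mult_nonneg_nonneg zero_le_power area2_nonneg edge_nonneg) auto
  show "(?F has_real_derivative - ?f x) (at x)" for x
    using has_derivative_area2[of b c a' b' c' x]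
    by (rule DERIV_cong[OF DERIV_power]) (simp add: algebra_simps)
qed

lemma nn_integral_min_density:
  assumes le: "a \<le> a'" "b \<le> b'" "c \<le> c'" and n: "2 \<le> n"
  shows "(\<integral>\<^sup>+x. \<integral>\<^sup>+y. \<integral>\<^sup>+z. ennreal (min_density n x y z a' b' c') * indicator {a..a'} x
      * indicator {b..b'} y * indicator {c..c'} z \<partial>lborel \<partial>lborel \<partial>lborel)
    = ennreal (area2 a b c a' b' c' ^ n)" (is "?L = _")
proof -
  have 3: "(\<integral>\<^sup>+z. ennreal (min_density n x y z a' b' c') * indicator {a..a'} x
      * indicator {b..b'} y * indicator {c..c'} z \<partial>lborel)
    = ennreal (2 * real n * (of_bool (1 - x - y - c' < 0) * area2 x y c a' b' c' ^ (n - 1)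
        + 2 * (real n - 1) * edge x y c b' c' * edge y x c a' c' * area2 x y c a' b' c' ^ (n - 2)))
       * indicator {b..b'} y * indicator {a..a'} x" for x y
    using nn_integral_min_density_3[of x a' y b' c c' n] le n
    by (auto simp: indicator_def split: if_splits)
  have 2: "(\<integral>\<^sup>+y. ennreal (2 * real n * (of_bool (1 - x - y - c' < 0) * area2 x y c a' b' c' ^ (n - 1)
        + 2 * (real n - 1) * edge x y c b' c' * edge y x c a' c' * area2 x y c a' b' c' ^ (n - 2)))
       * indicator {b..b'} y * indicator {a..a'} x \<partial>lborel)
     = ennreal (2 * real n * (edge x b c b' c' * area2 x b c a' b' c' ^ (n - 1))) * indicator {a..a'} x" for x
    using nn_integral_min_density_2[of x a' b b' c c' n] le n
    by (auto simp: indicator_def split: if_splits)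
  show ?thesis
    unfolding 3 2 using nn_integral_min_density_1[of a a' b b' c c' n] le n by simp
qed

section \<open>Lebesgue measure on vectors and matrices\<close>

lemma measurable_fst_borel [measurable]: "fst \<in> borel_measurable borel"
  and measurable_snd_borel [measurable]: "snd \<in> borel_measurable borel"
  by (auto intro!: borel_measurable_continuous_onI continuous_intros)

lemma measurable_vec_nth [measurable]: "(\<lambda>x :: 'a::euclidean_space ^ 'n. x $ i) \<in> borel_measurable borel"
  by (intro borel_measurable_continuous_onI continuous_intros)

lemma prod_UNIV_2: "prod f (UNIV :: 2 set) = f 1 * f 2"
  unfolding UNIV_2 by simp

lemma prod_UNIV_3: "prod f (UNIV :: 3 set) = f 1 * f 2 * f 3"
  unfolding UNIV_3 by (simp add: ac_simps)

lemma prod_Basis_vec: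
  fixes f :: "real ^ 'n \<Rightarrow> 'a :: comm_monoid_mult"
  shows "(\<Prod>b\<in>Basis. f b) = (\<Prod>i\<in>UNIV. f (axis i 1))"
proof -
  have "(Basis :: (real ^ 'n) set) = (\<lambda>i. axis i 1) ` UNIV"
    by (auto simp: Basis_vec_def)
  moreover have "inj (\<lambda>i. axis i 1 :: real ^ 'n)"
    by (auto simp: inj_on_def axis_eq_axis)
  ultimately have "prod f Basis = prod (f \<circ> (\<lambda>i. axis i 1)) UNIV"
    using prod.reindex[of "\<lambda>i. axis i 1 :: real ^ 'n" UNIV f] by metis
  then show ?thesis
    by (simp only: comp_def)
qed

lemma prod_Basis_vec_vec:
  fixes f :: "real ^ 'n ^ 'm \<Rightarrow> 'a :: comm_monoid_mult"
  shows "(\<Prod>b\<in>Basis. f b) = (\<Prod>i\<in>UNIV. \<Prod>j\<in>UNIV. f (axis i (axis j 1)))"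
proof -
  have "(Basis :: (real ^ 'n ^ 'm) set) = (\<lambda>(i, j). axis i (axis j 1)) ` (UNIV \<times> UNIV)"
    by (auto simp: Basis_vec_def)
  moreover have "inj_on (\<lambda>(i, j). axis i (axis j 1) :: real ^ 'n ^ 'm) (UNIV \<times> UNIV)"
    by (auto simp: inj_on_def axis_eq_axis)
  ultimately have "prod f Basis = prod (f \<circ> (\<lambda>(i, j). axis i (axis j 1))) (UNIV \<times> UNIV)"
    using prod.reindex[of "\<lambda>(i, j). axis i (axis j 1) :: real ^ 'n ^ 'm" "UNIV \<times> UNIV" f] by metis
  then show ?thesis
    by (simp only: prod.cartesian_product case_prod_unfold comp_def)
qed

lemma emeasure_lborel_Times:
  fixes A :: "'a::euclidean_space set" and B :: "'b::euclidean_space set"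
  assumes "A \<in> sets borel" "B \<in> sets borel"
  shows "emeasure lborel (A \<times> B) = emeasure lborel A * emeasure lborel B"
  using assms by (simp add: lborel.emeasure_pair_measure_Times flip: lborel_prod)

lemma emeasure_lborel_box_pair:
  "emeasure lborel (box (a, b) (a', b')) = emeasure lborel (box a a') * emeasure lborel (box b b')"
  by (simp add: box_prod emeasure_lborel_Times)

text \<open>Matrices are indexed by rows first, whereas independence holds between columns; this
  transposition carries the product over \<open>'n\<close> of planar measures to the measure on
  matrices.\<close>

definition of_columns :: "('n::finite \<Rightarrow> real \<times> real) \<Rightarrow> real ^ 'n ^ 2" where
  "of_columns w = vector [\<chi> j. fst (w j), \<chi> j. snd (w j)]"

lemma of_columns_nth [simp]:
  "of_columns w $ 1 $ j = fst (w j)" "of_columns w $ 2 $ j = snd (w j)"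
  by (simp_all add: of_columns_def)

lemma measurable_of_columns [measurable]:
  "of_columns \<in> borel_measurable (Pi\<^sub>M UNIV (\<lambda>_. lborel))"
proof (rule borel_measurable_euclidean_space[THEN iffD2], rule ballI)
  fix b :: "real ^ 'n ^ 2" assume "b \<in> Basis"
  then obtain i j where b: "b = axis i (axis j 1)"
    by (auto simp: Basis_vec_def)
  have "i = 1 \<or> i = 2"
    using exhaust_2 by blast
  then show "(\<lambda>w. of_columns w \<bullet> b) \<in> borel_measurable (Pi\<^sub>M UNIV (\<lambda>_. lborel))"
    unfolding b using measurable_component_singleton[of j UNIV "\<lambda>_. lborel :: (real \<times> real) measure"]
    by (auto simp: inner_axis intro: measurable_compose[OF _ measurable_fst_borel] measurable_compose[OF _ measurable_snd_borel])
qed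

lemma mem_box_columns:
  fixes z :: "real ^ 'n ^ 2"
  shows "z \<in> box l u \<longleftrightarrow> (\<forall>j. l $ 1 $ j < z $ 1 $ j \<and> z $ 1 $ j < u $ 1 $ j \<and> l $ 2 $ j < z $ 2 $ j \<and> z $ 2 $ j < u $ 2 $ j)"
proof -
  have "z \<in> box l u \<longleftrightarrow> (\<forall>i j. l $ i $ j < z $ i $ j \<and> z $ i $ j < u $ i $ j)"
    by (auto simp: mem_box Basis_vec_def inner_axis)
  then show ?thesis
    by (auto simp: forall_2)
qed

lemma lborel_eq_distr_of_columns:
  "lborel = distr (Pi\<^sub>M UNIV (\<lambda>_. lborel)) borel (of_columns :: ('n::finite \<Rightarrow> _) \<Rightarrow> _)"
proof (rule lborel_eqI)
  interpret product_sigma_finite "\<lambda>_::'n. lborel :: (real \<times> real) measure" ..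
  fix l u :: "real ^ 'n ^ 2"
  assume lu: "\<And>b. b \<in> Basis \<Longrightarrow> l \<bullet> b \<le> u \<bullet> b"
  have le: "l $ i $ j \<le> u $ i $ j" for i j
    using lu[of "axis i (axis j 1)"] by (simp add: inner_axis axis_in_Basis_iff)
  have vimage: "of_columns -` box l u \<inter> space (Pi\<^sub>M UNIV (\<lambda>_. lborel))
      = Pi\<^sub>E UNIV (\<lambda>j. box (l $ 1 $ j, l $ 2 $ j) (u $ 1 $ j, u $ 2 $ j))"
    by (auto simp: mem_box_columns space_PiM box_prod PiE_def Pi_def mem_Times_iff)
  have "emeasure (distr (Pi\<^sub>M UNIV (\<lambda>_. lborel)) borel of_columns) (box l u)
      = (\<Prod>j\<in>UNIV. emeasure lborel (box (l $ 1 $ j, l $ 2 $ j) (u $ 1 $ j, u $ 2 $ j)))"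
    by (subst emeasure_distr) (simp_all add: vimage emeasure_PiM)
  also have "\<dots> = (\<Prod>j\<in>UNIV. ennreal ((u $ 1 $ j - l $ 1 $ j) * (u $ 2 $ j - l $ 2 $ j)))"
    unfolding emeasure_lborel_box_pair box_real using le by (simp add: ennreal_mult)
  also have "\<dots> = ennreal (\<Prod>b\<in>Basis. (u - l) \<bullet> b)"
    unfolding prod_Basis_vec_vec prod_UNIV_2 using le by (simp add: prod_ennreal inner_axis prod.distrib)
  finally show "emeasure (distr (Pi\<^sub>M UNIV (\<lambda>_. lborel)) borel of_columns) (box l u)
    = ennreal (\<Prod>b\<in>Basis. (u - l) \<bullet> b)" .
qed simp

text \<open>Under the product structure the set is a full product of copies of \<open>Q\<close>, one
  for each column.\<close>

lemma emeasure_columns: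
  assumes [measurable]: "Q \<in> sets borel"
  shows "emeasure lborel {z :: real ^ 'n ^ 2. \<forall>j. (z $ 1 $ j, z $ 2 $ j) \<in> Q} = emeasure lborel Q ^ CARD('n::finite)"
proof -
  interpret product_sigma_finite "\<lambda>_::'n. lborel :: (real \<times> real) measure" ..
  have "of_columns -` {z :: real ^ 'n ^ 2. \<forall>j. (z $ 1 $ j, z $ 2 $ j) \<in> Q} \<inter> space (Pi\<^sub>M UNIV (\<lambda>_. lborel))
    = Pi\<^sub>E UNIV (\<lambda>_. Q)"
    by (auto simp: space_PiM PiE_def Pi_def)
  moreover have "{z :: real ^ 'n ^ 2. \<forall>j. (z $ 1 $ j, z $ 2 $ j) \<in> Q} \<in> sets borel"
    by measurable
  ultimately show ?thesis
    by (subst lborel_eq_distr_of_columns) (simp add: emeasure_distr emeasure_PiM)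
qed

section \<open>Iterated integrals over vectors and tuples\<close>

lemma measurable_vector3 [measurable]:
  "(\<lambda>(x, y, z). vector [x, y, z] :: real ^ 3) \<in> borel_measurable borel"
proof (rule borel_measurable_euclidean_space[THEN iffD2], rule ballI)
  fix b :: "real ^ 3" assume "b \<in> Basis"
  then obtain i where b: "b = axis i 1"
    by (auto simp: Basis_vec_def)
  have "i = 1 \<or> i = 2 \<or> i = 3"
    using exhaust_3 by blast
  then show "(\<lambda>x. (case x of (x, y, z) \<Rightarrow> vector [x, y, z]) \<bullet> b) \<in> borel_measurable borel"
    unfolding b by (elim disjE) (simp_all add: inner_axis case_prod_unfold)
qed

lemma lborel_eq_distr_vector3:
  "lborel = distr lborel borel (\<lambda>(x, y, z). vector [x, y, z] :: real ^ 3)"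
proof (rule lborel_eqI)
  fix l u :: "real ^ 3"
  assume lu: "\<And>b. b \<in> Basis \<Longrightarrow> l \<bullet> b \<le> u \<bullet> b"
  have le: "l $ i \<le> u $ i" for i
    using lu[of "axis i 1"] by (simp add: inner_axis axis_in_Basis_iff)
  have "(\<lambda>(x, y, z). vector [x, y, z]) -` box l u = box (l $ 1, l $ 2, l $ 3) (u $ 1, u $ 2, u $ 3)"
    by (auto simp: mem_box_cart forall_3 box_prod)
  then have "emeasure (distr lborel borel (\<lambda>(x, y, z). vector [x, y, z])) (box l u)
    = emeasure lborel (box (l $ 1, l $ 2, l $ 3) (u $ 1, u $ 2, u $ 3))"
    by (simp add: emeasure_distr)
  also have "\<dots> = ennreal ((u $ 1 - l $ 1) * ((u $ 2 - l $ 2) * (u $ 3 - l $ 3)))"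
    unfolding emeasure_lborel_box_pair box_real using le by (simp add: ennreal_mult)
  also have "(u $ 1 - l $ 1) * ((u $ 2 - l $ 2) * (u $ 3 - l $ 3)) = (\<Prod>b\<in>Basis. (u - l) \<bullet> b)"
    unfolding prod_Basis_vec prod_UNIV_3 by (simp add: inner_axis mult.assoc)
  finally show "emeasure (distr lborel borel (\<lambda>(x, y, z). vector [x, y, z])) (box l u)
    = ennreal (\<Prod>b\<in>Basis. (u - l) \<bullet> b)" .
qed simp

lemma measurable_vector2 [measurable]:
  "(\<lambda>(x, y). vector [x, y] :: real ^ 2) \<in> borel_measurable borel"
proof (rule borel_measurable_euclidean_space[THEN iffD2], rule ballI)
  fix b :: "real ^ 2" assume "b \<in> Basis"
  then obtain i where b: "b = axis i 1"
    by (auto simp: Basis_vec_def)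
  have "i = 1 \<or> i = 2"
    using exhaust_2 by blast
  then show "(\<lambda>x. (case x of (x, y) \<Rightarrow> vector [x, y]) \<bullet> b) \<in> borel_measurable borel"
    unfolding b by (elim disjE) (simp_all add: inner_axis case_prod_unfold)
qed

lemma lborel_eq_distr_vector2:
  "lborel = distr lborel borel (\<lambda>(x, y). vector [x, y] :: real ^ 2)"
proof (rule lborel_eqI)
  fix l u :: "real ^ 2"
  assume lu: "\<And>b. b \<in> Basis \<Longrightarrow> l \<bullet> b \<le> u \<bullet> b"
  have le: "l $ i \<le> u $ i" for i
    using lu[of "axis i 1"] by (simp add: inner_axis axis_in_Basis_iff)
  have "(\<lambda>(x, y). vector [x, y]) -` box l u = box (l $ 1, l $ 2) (u $ 1, u $ 2)"
    by (auto simp: mem_box_cart forall_2 box_prod)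
  then have "emeasure (distr lborel borel (\<lambda>(x, y). vector [x, y])) (box l u)
    = emeasure lborel (box (l $ 1, l $ 2) (u $ 1, u $ 2))"
    by (simp add: emeasure_distr)
  also have "\<dots> = ennreal ((u $ 1 - l $ 1) * (u $ 2 - l $ 2))"
    unfolding emeasure_lborel_box_pair box_real using le by (simp add: ennreal_mult)
  also have "(u $ 1 - l $ 1) * (u $ 2 - l $ 2) = (\<Prod>b\<in>Basis. (u - l) \<bullet> b)"
    unfolding prod_Basis_vec prod_UNIV_2 by (simp add: inner_axis)
  finally show "emeasure (distr lborel borel (\<lambda>(x, y). vector [x, y])) (box l u)
    = ennreal (\<Prod>b\<in>Basis. (u - l) \<bullet> b)" .
qed simp

lemma nn_integral_lborel_pair:
  fixes f :: "'a::euclidean_space \<times> 'b::euclidean_space \<Rightarrow> ennreal"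
  assumes [measurable]: "f \<in> borel_measurable borel"
  shows "(\<integral>\<^sup>+p. f p \<partial>lborel) = (\<integral>\<^sup>+x. \<integral>\<^sup>+y. f (x, y) \<partial>lborel \<partial>lborel)"
proof -
  have "f \<in> borel_measurable (lborel \<Otimes>\<^sub>M lborel)"
    by (simp add: lborel_prod)
  from lborel.nn_integral_fst[OF this] show ?thesis
    by (simp add: lborel_prod)
qed

lemma nn_integral_vec3:
  assumes [measurable]: "f \<in> borel_measurable borel"
  shows "(\<integral>\<^sup>+v. f (v :: real ^ 3) \<partial>lborel) = (\<integral>\<^sup>+x. \<integral>\<^sup>+y. \<integral>\<^sup>+z. f (vector [x, y, z]) \<partial>lborel \<partial>lborel \<partial>lborel)"
proof -
  have m: "(\<lambda>(x, y, z). f (vector [x, y, z])) \<in> borel_measurable borel"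
    using measurable_compose[OF measurable_vector3 assms] by (simp add: case_prod_unfold)
  have "(\<lambda>(y, z). f (vector [x, y, z])) \<in> borel_measurable borel" for x
    using measurable_compose[OF _ m, of "Pair x"] by (simp add: borel_measurable_continuous_onI continuous_intros)
  then have "(\<integral>\<^sup>+p. (case p of (y, z) \<Rightarrow> f (vector [x, y, z])) \<partial>lborel)
      = (\<integral>\<^sup>+y. \<integral>\<^sup>+z. f (vector [x, y, z]) \<partial>lborel \<partial>lborel)" for x
    by (simp add: nn_integral_lborel_pair)
  then have "(\<integral>\<^sup>+p. (case p of (x, y, z) \<Rightarrow> f (vector [x, y, z])) \<partial>lborel)
      = (\<integral>\<^sup>+x. \<integral>\<^sup>+y. \<integral>\<^sup>+z. f (vector [x, y, z]) \<partial>lborel \<partial>lborel \<partial>lborel)"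
    using m by (simp add: nn_integral_lborel_pair)
  then show ?thesis
    by (subst lborel_eq_distr_vector3, subst nn_integral_distr) (simp_all add: case_prod_unfold[abs_def] measurable_vector3[unfolded case_prod_unfold])
qed

lemma nn_integral_vec2:
  assumes [measurable]: "f \<in> borel_measurable borel"
  shows "(\<integral>\<^sup>+v. f (v :: real ^ 2) \<partial>lborel) = (\<integral>\<^sup>+x. \<integral>\<^sup>+y. f (vector [x, y]) \<partial>lborel \<partial>lborel)"
  by (subst lborel_eq_distr_vector2) (simp add: nn_integral_distr nn_integral_lborel_pair)

text \<open>Upper orthants are the sets on which the law of a minimum is explicit. A half space is
  the countable union of orthants whose bounds in the other coordinates tend to minus
  infinity.\<close>

lemma borel_eq_atLeast:
  "borel = sigma UNIV (range (\<lambda>a. {a::'a::ordered_euclidean_space..}))"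
  (is "_ = ?SIGMA")
proof (rule borel_eq_sigmaI4[OF borel_eq_halfspace_ge])
  fix a :: real and i :: 'a assume "(a, i) \<in> UNIV \<times> Basis"
  then have "i \<in> Basis" by auto
  then have *: "{x::'a. a \<le> x\<bullet>i} = (\<Union>k::nat. {(\<Sum>n\<in>Basis. (if n = i then a else - real k)*\<^sub>R n)..})"
  proof (safe, simp_all add: eucl_le[where 'a='a] split: if_split_asm)
    fix x :: 'a
    obtain k where "Max ((\<lambda>i. - (x \<bullet> i)) ` Basis) \<le> real k"
      using real_arch_simple by blast
    then have "\<And>i. i \<in> Basis \<Longrightarrow> - (x\<bullet>i) \<le> real k"
      by (subst (asm) Max_le_iff) auto
    then show "\<exists>k::nat. \<forall>ia\<in>Basis. ia \<noteq> i \<longrightarrow> - real k \<le> x \<bullet> ia"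
      by (metis minus_le_iff)
  qed
  show "{x. a \<le> x\<bullet>i} \<in> ?SIGMA" unfolding *
    by (intro sets.countable_UN) auto
qed auto

lemma nn_integral_lborel_triple:
  fixes f :: "real \<times> real \<times> real \<Rightarrow> ennreal"
  assumes [measurable]: "f \<in> borel_measurable borel"
  shows "(\<integral>\<^sup>+p. f p \<partial>lborel) = (\<integral>\<^sup>+x. \<integral>\<^sup>+y. \<integral>\<^sup>+z. f (x, y, z) \<partial>lborel \<partial>lborel \<partial>lborel)"
proof -
  have "(\<lambda>p. f (x, p)) \<in> borel_measurable borel" for x
    using measurable_compose[OF _ assms, of "Pair x"] by (simp add: borel_measurable_continuous_onI continuous_intros)
  then show ?thesis
    by (simp add: nn_integral_lborel_pair)
qed

lemma measurable_edge [measurable (raw)]: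
  assumes [measurable]: "f1 \<in> borel_measurable M" "f2 \<in> borel_measurable M" "f3 \<in> borel_measurable M"
    "f4 \<in> borel_measurable M" "f5 \<in> borel_measurable M"
  shows "(\<lambda>x. edge (f1 x) (f2 x) (f3 x) (f4 x) (f5 x)) \<in> borel_measurable M"
  unfolding edge_def by measurable

lemma measurable_area2 [measurable (raw)]:
  assumes [measurable]: "f1 \<in> borel_measurable M" "f2 \<in> borel_measurable M" "f3 \<in> borel_measurable M"
    "f4 \<in> borel_measurable M" "f5 \<in> borel_measurable M" "f6 \<in> borel_measurable M"
  shows "(\<lambda>x. area2 (f1 x) (f2 x) (f3 x) (f4 x) (f5 x) (f6 x)) \<in> borel_measurable M"
  unfolding area2_def by measurable

lemma measurable_min_density [measurable (raw)]:
  assumes [measurable]: "f1 \<in> borel_measurable M" "f2 \<in> borel_measurable M" "f3 \<in> borel_measurable M"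
    "f4 \<in> borel_measurable M" "f5 \<in> borel_measurable M" "f6 \<in> borel_measurable M"
  shows "(\<lambda>x. min_density n (f1 x) (f2 x) (f3 x) (f4 x) (f5 x) (f6 x)) \<in> borel_measurable M"
  unfolding min_density_def of_bool_def by measurable

section \<open>The law of the row minima\<close>

type_synonym real3 = "real \<times> real \<times> real"

definition region :: "real3 \<Rightarrow> real3 \<Rightarrow> (real \<times> real) set" where
  "region = (\<lambda>(a, b, c) (a', b', c'). {(p, q). a \<le> p \<and> p \<le> a' \<and> b \<le> q \<and> q \<le> b' \<and> c \<le> 1 - p - q \<and> 1 - p - q \<le> c'})"

lemma region_borel [measurable]: "region m y \<in> sets borel"
proof -
  have "closed (region m y)"
    unfolding region_def case_prod_unfold by (intro closed_Collect_conj closed_Collect_le continuous_intros)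
  then show ?thesis
    by simp
qed

text \<open>The section at \<open>p\<close> is an interval, the upper and lower bounds of
  \<open>q\<close> coming from both row 2 and row 3; its length is \<open>edge p b c b' c'\<close>,
  so the slicing formula for \<open>area2\<close> applies.\<close>

lemma emeasure_region:
  assumes "a \<le> a'" "b \<le> b'" "c \<le> c'"
  shows "emeasure lborel (region (a, b, c) (a', b', c')) = ennreal (area2 a b c a' b' c' / 2)"
proof -
  let ?R = "region (a, b, c) (a', b', c')"
  have sect: "(\<integral>\<^sup>+q. indicator ?R (p, q) \<partial>lborel) = ennreal (edge p b c b' c') * indicator {a..a'} p" for p
  proof (cases "p \<in> {a..a'}")
    case True
    then have "(\<integral>\<^sup>+q. indicator ?R (p, q) \<partial>lborel)
        = (\<integral>\<^sup>+q. indicator {max b (1 - p - c')..min b' (1 - p - c)} q \<partial>lborel)"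
      by (intro nn_integral_cong) (auto simp: region_def indicator_def)
    also have "\<dots> = ennreal (pp (min b' (1 - p - c) - max b (1 - p - c')))"
      using assms by (simp add: emeasure_lborel_Icc_eq pp_def min_def max_def)
    also have "pp (min b' (1 - p - c) - max b (1 - p - c')) = edge p b c b' c'"
      using assms by (simp add: edge_def pp_def max_def min_def)
    finally show ?thesis
      using True by simp
  qed (auto simp: region_def indicator_def)
  have half: "ennreal (edge p b c b' c') = ennreal (1 / 2) * ennreal (2 * edge p b c b' c')" for p
    using assms edge_nonneg by (subst ennreal_mult[symmetric]) auto
  have "emeasure lborel ?R = (\<integral>\<^sup>+p. \<integral>\<^sup>+q. indicator ?R (p, q) \<partial>lborel \<partial>lborel)"
    by (simp flip: nn_integral_lborel_pair)
  also have "\<dots> = (\<integral>\<^sup>+p. ennreal (edge p b c b' c') * indicator {a..a'} p \<partial>lborel)"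
    by (simp add: sect)
  also have "\<dots> = (\<integral>\<^sup>+p. ennreal (1 / 2) * (ennreal (2 * edge p b c b' c') * indicator {a..a'} p) \<partial>lborel)"
    by (intro nn_integral_cong) (simp only: half mult.assoc)
  also have "\<dots> = ennreal (1 / 2) * ennreal (area2 a b c a' b' c')"
    using assms by (subst nn_integral_cmult) (auto simp: area2_nonneg)
  also have "\<dots> = ennreal (area2 a b c a' b' c' / 2)"
    using assms by (subst ennreal_mult[symmetric]) (auto simp: area2_nonneg)
  finally show ?thesis .
qed

lemma region_empty: "\<not> m \<le> y \<Longrightarrow> region m y = {}"
  by (cases m, cases y) (force simp: region_def less_eq_prod_def)

text \<open>The third entry is the minimum of the deleted row, recovered from the column sums
  1.\<close>

definition col_min :: "real ^ 'n ^ 2 \<Rightarrow> real3" where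
  "col_min z = (Min (range (\<lambda>j. z $ 1 $ j)), Min (range (\<lambda>j. z $ 2 $ j)), Min (range (\<lambda>j. 1 - z $ 1 $ j - z $ 2 $ j)))"

definition below :: "real3 \<Rightarrow> (real ^ 'n ^ 2) set" where
  "below = (\<lambda>(a', b', c'). {z. \<forall>j. z $ 1 $ j \<le> a' \<and> z $ 2 $ j \<le> b' \<and> 1 - z $ 1 $ j - z $ 2 $ j \<le> c'})"

lemma measurable_col_min [measurable]: "col_min \<in> borel_measurable borel"
  unfolding col_min_def by measurable

lemma closed_below: "closed (below y)"
  unfolding below_def case_prod_unfold
  by (intro closed_Collect_all closed_Collect_conj closed_Collect_le continuous_intros)

lemma below_borel [measurable]: "below y \<in> sets borel"
  by (rule borel_closed[OF closed_below])

lemma col_min_ge_iff: "m \<le> col_min z \<and> z \<in> below y \<longleftrightarrow> (\<forall>j. (z $ 1 $ j, z $ 2 $ j) \<in> region m y)"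
  by (cases m, cases y) (auto simp: col_min_def below_def region_def)

lemma col_min_le: "z \<in> below y \<Longrightarrow> col_min z \<le> y"
  by (cases y) (auto simp: col_min_def below_def less_eq_prod_def Min_le_iff)

text \<open>
  Both sides are measures in the variable \<open>m\<close>, and they agree on the sets \<open>{m..}\<close>.
\<close>

lemma distr_col_min:
  assumes n: "2 \<le> CARD('n::finite)"
  shows "distr (density lborel (indicator (below (a', b', c') :: (real ^ 'n ^ 2) set))) borel col_min
    = density lborel (\<lambda>(a, b, c). ennreal (min_density CARD('n) a b c a' b' c' / 2 ^ CARD('n))
        * indicator {..(a', b', c')} (a, b, c))" (is "?M = ?N")
proof (rule measure_eqI_generator_eq)
  let ?n = "CARD('n)"
  let ?y = "(a', b', c')"
  show "Int_stable (range (\<lambda>a::real3. {a..}))"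
  proof (rule Int_stableI)
    fix A B :: "real3 set" assume "A \<in> range (\<lambda>a. {a..})" "B \<in> range (\<lambda>a. {a..})"
    then obtain a b where "A = {a..}" "B = {b..}"
      by auto
    then have "A \<inter> B = {sup a b..}"
      by auto
    then show "A \<inter> B \<in> range (\<lambda>a. {a..})"
      by blast
  qed
  show "range (\<lambda>a::real3. {a..}) \<subseteq> Pow UNIV"
    by simp
  show "sets ?M = sigma_sets UNIV (range (\<lambda>a. {a..}))" "sets ?N = sigma_sets UNIV (range (\<lambda>a. {a..}))"
    by (simp_all add: borel_eq_atLeast)
  show "range (\<lambda>k. {(- real k, - real k, - real k)..}) \<subseteq> range (\<lambda>a::real3. {a..})"
    by auto
  show "(\<Union>k. {(- real k, - real k, - real k)..}) = UNIV"
  proof safe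
    fix a b c :: real
    obtain k where "max (- a) (max (- b) (- c)) \<le> real k"
      using real_arch_simple by blast
    then show "(a, b, c) \<in> (\<Union>k. {(- real k, - real k, - real k)..})"
      by (auto intro!: exI[of _ k])
  qed auto
  \<comment> \<open>All minima are at least \<open>m\<close> exactly when every column lies in
    \<open>region m ?y\<close>; independence of the columns gives the power.\<close>
  have M: "emeasure ?M {m..} = emeasure lborel (region m ?y) ^ ?n" for m
  proof -
    have [measurable]: "(col_min -` {m..} :: (real ^ 'n ^ 2) set) \<in> sets borel"
      using measurable_sets[OF measurable_col_min, of "{m..}"] by simp
    have "emeasure ?M {m..} = (\<integral>\<^sup>+z. indicator (below ?y :: (real ^ 'n ^ 2) set) z * indicator (col_min -` {m..}) z \<partial>lborel)"
      by (simp add: emeasure_distr emeasure_density space_density)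
    also have "\<dots> = (\<integral>\<^sup>+z. indicator {z :: real ^ 'n ^ 2. \<forall>j. (z $ 1 $ j, z $ 2 $ j) \<in> region m ?y} z \<partial>lborel)"
      by (intro nn_integral_cong) (auto simp: indicator_def simp flip: col_min_ge_iff)
    also have "\<dots> = emeasure lborel {z :: real ^ 'n ^ 2. \<forall>j. (z $ 1 $ j, z $ 2 $ j) \<in> region m ?y}"
      by (intro nn_integral_indicator) (simp, measurable)
    finally show ?thesis
      by (simp add: emeasure_columns)
  qed
  show "emeasure ?M {(- real k, - real k, - real k)..} \<noteq> \<infinity>" for k
  proof (cases "(- real k, - real k, - real k) \<le> ?y")
    case True
    then show ?thesis
      unfolding M by (subst emeasure_region) (auto simp: power_eq_top_ennreal)
  next
    case False
    then show ?thesis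
      unfolding M by (simp add: region_empty power_eq_top_ennreal)
  qed
  fix X :: "real3 set" assume "X \<in> range (\<lambda>a. {a..})"
  then obtain a b c where X: "X = {(a, b, c)..}"
    by auto
  have "emeasure ?N X = (\<integral>\<^sup>+p. (case p of (x, y, z) \<Rightarrow> ennreal (min_density ?n x y z a' b' c' / 2 ^ ?n)
        * indicator {..?y} (x, y, z)) * indicator {(a, b, c)..} p \<partial>lborel)"
    unfolding X by (subst emeasure_density) (auto simp: case_prod_unfold)
  also have "\<dots> = (\<integral>\<^sup>+x. \<integral>\<^sup>+y. \<integral>\<^sup>+z. ennreal (min_density ?n x y z a' b' c' / 2 ^ ?n)
        * indicator {..?y} (x, y, z) * indicator {(a, b, c)..} (x, y, z) \<partial>lborel \<partial>lborel \<partial>lborel)"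
    by (subst nn_integral_lborel_triple) (simp_all add: case_prod_unfold)
  also have "\<dots> = (\<integral>\<^sup>+x. \<integral>\<^sup>+y. \<integral>\<^sup>+z. ennreal (1 / 2 ^ ?n) * (ennreal (min_density ?n x y z a' b' c')
        * indicator {a..a'} x * indicator {b..b'} y * indicator {c..c'} z) \<partial>lborel \<partial>lborel \<partial>lborel)"
    using n by (intro nn_integral_cong)
      (auto simp: indicator_def min_density_nonneg simp flip: ennreal_mult)
  also have "\<dots> = ennreal (1 / 2 ^ ?n) * (\<integral>\<^sup>+x. \<integral>\<^sup>+y. \<integral>\<^sup>+z. ennreal (min_density ?n x y z a' b' c')
        * indicator {a..a'} x * indicator {b..b'} y * indicator {c..c'} z \<partial>lborel \<partial>lborel \<partial>lborel)"
    by (simp add: nn_integral_cmult)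
  also have "\<dots> = emeasure lborel (region (a, b, c) ?y) ^ ?n"
  proof (cases "(a, b, c) \<le> ?y")
    case True
    then have le: "a \<le> a'" "b \<le> b'" "c \<le> c'"
      by auto
    show ?thesis
      using le n by (simp add: nn_integral_min_density emeasure_region area2_nonneg ennreal_power
          power_divide flip: ennreal_mult)
  next
    case False
    then have "(\<integral>\<^sup>+x. \<integral>\<^sup>+y. \<integral>\<^sup>+z. ennreal (min_density ?n x y z a' b' c')
        * indicator {a..a'} x * indicator {b..b'} y * indicator {c..c'} z \<partial>lborel \<partial>lborel \<partial>lborel)
       = (\<integral>\<^sup>+x. \<integral>\<^sup>+y. \<integral>\<^sup>+z. 0 \<partial>(lborel :: real measure) \<partial>(lborel :: real measure) \<partial>(lborel :: real measure))"
      by (intro nn_integral_cong) (auto simp: indicator_def)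
    with False show ?thesis
      by (simp add: region_empty)
  qed
  finally show "emeasure ?M X = emeasure ?N X"
    unfolding X M by simp
qed

lemma nn_integral_col_min:
  fixes f :: "real3 \<Rightarrow> ennreal"
  assumes n: "2 \<le> CARD('n::finite)" and [measurable]: "f \<in> borel_measurable borel"
  shows "(\<integral>\<^sup>+z. f (col_min z) * indicator (below (a', b', c') :: (real ^ 'n ^ 2) set) z \<partial>lborel)
    = (\<integral>\<^sup>+a. \<integral>\<^sup>+b. \<integral>\<^sup>+c. f (a, b, c) * (ennreal (min_density CARD('n) a b c a' b' c' / 2 ^ CARD('n))
        * indicator {..(a', b', c')} (a, b, c)) \<partial>lborel \<partial>lborel \<partial>lborel)"
proof -
  let ?d = "\<lambda>(a, b, c). ennreal (min_density CARD('n) a b c a' b' c' / 2 ^ CARD('n)) * indicator {..(a', b', c')} (a, b, c)"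
  have [measurable]: "?d \<in> borel_measurable borel"
    unfolding case_prod_unfold by measurable
  have "(\<integral>\<^sup>+z. f (col_min z) * indicator (below (a', b', c') :: (real ^ 'n ^ 2) set) z \<partial>lborel)
     = (\<integral>\<^sup>+p. f p \<partial>(distr (density lborel (indicator (below (a', b', c') :: (real ^ 'n ^ 2) set))) borel col_min))"
    by (simp add: nn_integral_distr nn_integral_density mult.commute)
  also have "\<dots> = (\<integral>\<^sup>+p. ?d p * f p \<partial>lborel)"
    unfolding distr_col_min[OF n] by (simp add: nn_integral_density)
  also have "\<dots> = (\<integral>\<^sup>+a. \<integral>\<^sup>+b. \<integral>\<^sup>+c. f (a, b, c) * ?d (a, b, c) \<partial>lborel \<partial>lborel \<partial>lborel)"
    by (subst nn_integral_lborel_triple) (simp_all add: mult.commute)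
  finally show ?thesis
    by simp
qed

section \<open>Facets of the integer hull\<close>

abbreviation rows3 :: "('n \<Rightarrow> real) \<Rightarrow> ('n \<Rightarrow> real) \<Rightarrow> ('n \<Rightarrow> real) \<Rightarrow> real ^ 'n ^ 3" where
  "rows3 f g h \<equiv> vector [\<chi> j. f j, \<chi> j. g j, \<chi> j. h j]"

definition int_points :: "((real ^ 'n ^ 'm) \<times> (real ^ 'm)) set" where
  "int_points = {(x, y). (x, y) \<in> lin_relax \<inter> assign_space \<and> (\<forall>i. y $ i \<in> {0, 1})}"

lemma int_hull_eq: "int_hull = convex hull int_points"
  by (simp add: int_hull_def int_points_def)

text \<open>Weights are kept as scale factors, so a convex combination is built by adding points,
  and patterns of weight 0 need no separate treatment later.\<close>

definition scaled_hull :: "real \<Rightarrow> ((real ^ 'n ^ 'm) \<times> (real ^ 'm)) set" where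
  "scaled_hull l = (\<lambda>v. l *\<^sub>R v) ` int_hull"

lemma scaled_hull_add:
  assumes "w1 \<in> scaled_hull l1" "w2 \<in> scaled_hull l2" "0 \<le> l1" "0 \<le> l2"
  shows "w1 + w2 \<in> scaled_hull (l1 + l2)"
proof -
  obtain v1 v2 where v: "v1 \<in> int_hull" "v2 \<in> int_hull" "w1 = l1 *\<^sub>R v1" "w2 = l2 *\<^sub>R v2"
    using assms by (auto simp: scaled_hull_def)
  show ?thesis
  proof (cases "l1 + l2 = 0")
    case True
    then have "l1 = 0" "l2 = 0"
      using assms by auto
    then show ?thesis
      using v by (auto simp: scaled_hull_def)
  next
    case False
    then have "(l1 / (l1 + l2)) *\<^sub>R v1 + (l2 / (l1 + l2)) *\<^sub>R v2 \<in> int_hull"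
      using v assms unfolding int_hull_eq
      by (intro convexD[OF convex_convex_hull]) (auto simp: add_divide_distrib[symmetric])
    moreover have "w1 + w2 = (l1 + l2) *\<^sub>R ((l1 / (l1 + l2)) *\<^sub>R v1 + (l2 / (l1 + l2)) *\<^sub>R v2)"
      using False by (simp add: v scaleR_add_right)
    ultimately show ?thesis
      unfolding scaled_hull_def by blast
  qed
qed

lemma scaled_hull_pattern:
  fixes X :: "real ^ 'n ^ 3"
  assumes "0 \<le> l" and y: "\<And>i. y $ i \<in> {0, 1}" and i0: "y $ i0 = 1"
    and X: "\<And>i j. 0 \<le> X $ i $ j" "\<And>i j. X $ i $ j \<le> l * y $ i" "\<And>j. (\<Sum>i\<in>UNIV. X $ i $ j) = l"
  shows "(X, l *\<^sub>R y) \<in> scaled_hull l"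
proof (cases "l = 0")
  case True
  \<comment> \<open>With weight 0 the claim is that the hull is nonempty; the pattern with the
    single active row \<open>i0\<close> serves as a point of it.\<close>
  let ?v = "(\<chi> i j. if i = i0 then 1 else 0, axis i0 1) :: (real ^ 'n ^ 3) \<times> (real ^ 3)"
  have "?v \<in> int_points"
    by (auto simp: int_points_def lin_relax_def assign_space_def axis_def)
  then have "?v \<in> int_hull"
    unfolding int_hull_eq by (rule hull_inc)
  moreover have "X = 0"
    using X(1,2) True by (auto simp: vec_eq_iff intro: antisym)
  then have "(X, l *\<^sub>R y) = l *\<^sub>R ?v"
    using True by (simp add: zero_prod_def)
  ultimately show ?thesis
    unfolding scaled_hull_def by blast
next
  case False
  let ?v = "((1 / l) *\<^sub>R X, y)"
  have "?v \<in> int_points"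
    using False X y \<open>0 \<le> l\<close>
    by (auto simp: int_points_def lin_relax_def assign_space_def field_simps simp flip: sum_divide_distrib)
      (metis (mono_tags) insertE order.refl singletonD zero_le_one)+
  then have "?v \<in> int_hull"
    unfolding int_hull_eq by (rule hull_inc)
  moreover have "(X, l *\<^sub>R y) = l *\<^sub>R ?v"
    using False by simp
  ultimately show ?thesis
    unfolding scaled_hull_def by blast
qed

lemma rows3_in_scaled_hull:
  assumes "0 \<le> l" "y1 \<in> {0, 1}" "y2 \<in> {0, 1}" "y3 \<in> {0, 1}" and ne: "y1 = 1 \<or> y2 = 1 \<or> y3 = 1"
    and "\<And>j. 0 \<le> f j \<and> f j \<le> l * y1" "\<And>j. 0 \<le> g j \<and> g j \<le> l * y2" "\<And>j. 0 \<le> h j \<and> h j \<le> l * y3"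
    and "\<And>j. f j + g j + h j = l"
  shows "(rows3 f g h :: real ^ 'n ^ 3, vector [l * y1, l * y2, l * y3]) \<in> scaled_hull l"
proof -
  obtain i0 :: 3 where "(vector [y1, y2, y3] :: real ^ 3) $ i0 = 1"
    using ne vector_3[of y1 y2 y3] by metis
  moreover have "(vector [y1, y2, y3] :: real ^ 3) $ i \<in> {0, 1}" for i
    using assms(2-4) exhaust_3[of i] by auto
  moreover have "0 \<le> (rows3 f g h :: real ^ 'n ^ 3) $ i $ j
      \<and> (rows3 f g h :: real ^ 'n ^ 3) $ i $ j \<le> l * (vector [y1, y2, y3] :: real ^ 3) $ i" for i j
    using assms(6-8) exhaust_3[of i] by auto
  ultimately have "(rows3 f g h :: real ^ 'n ^ 3, l *\<^sub>R vector [y1, y2, y3]) \<in> scaled_hull l"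
    using assms by (intro scaled_hull_pattern) (auto simp: sum_3)
  moreover have "l *\<^sub>R vector [y1, y2, y3] = (vector [l * y1, l * y2, l * y3] :: real ^ 3)"
    by (simp add: vec_eq_iff forall_3)
  ultimately show ?thesis
    by simp
qed

text \<open>Here \<open>s\<^sub>i = 1 - y\<^sub>i\<close>, and \<open>p\<^sub>i\<close> is the
  weight of the patterns in which only row \<open>i\<close> is active. The weight of the patterns
  with exactly row \<open>i\<close> inactive is then forced to be
  \<open>s\<^sub>i - p\<^sub>j - p\<^sub>k\<close>, and the rest goes to the patterns with all rows
  active; the conclusion says that all these weights are nonnegative. The last hypothesis is the
  cut.\<close>

lemma exists_singleton_weights:
  fixes m1 m2 m3 s1 s2 s3 :: real
  assumes "0 \<le> m1" "0 \<le> m2" "0 \<le> m3" "0 \<le> s1" "0 \<le> s2" "0 \<le> s3" "s1 \<le> 1" "s2 \<le> 1" "s3 \<le> 1"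
    and "s2 + s3 - 1 \<le> m1" "s1 + s3 - 1 \<le> m2" "s1 + s2 - 1 \<le> m3"
    and "s1 + s2 + s3 \<le> 2" "s1 + s2 + s3 - 1 \<le> m1 + m2 + m3"
  shows "\<exists>p1 p2 p3. 0 \<le> p1 \<and> 0 \<le> p2 \<and> 0 \<le> p3 \<and> p1 \<le> m1 \<and> p2 \<le> m2 \<and> p3 \<le> m3 \<and>
    p2 + p3 \<le> s1 \<and> p1 + p3 \<le> s2 \<and> p1 + p2 \<le> s3 \<and> s1 + s2 + s3 - 1 \<le> p1 + p2 + p3"
proof (cases "s1 + s2 + s3 \<le> 1")
  case True
  then show ?thesis
    using assms by (intro exI[of _ 0]) auto
next
  case False
  \<comment> \<open>Choosing the total of the \<open>p\<close> to be exactly \<open>t\<close> turns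
    \<open>p2 + p3 \<le> s1\<close> into \<open>s2 + s3 - 1 \<le> p1\<close>, so the pair
    constraints become lower bounds on single weights.\<close>
  define L1 L2 L3 where L: "L1 = max 0 (s2 + s3 - 1)" "L2 = max 0 (s1 + s3 - 1)" "L3 = max 0 (s1 + s2 - 1)"
  define t where "t = s1 + s2 + s3 - 1"
  \<comment> \<open>Greedy choice: as much as \<open>m1\<close> allows while room is kept for the
    remaining lower bounds.\<close>
  define p1 where "p1 = min m1 (t - L2 - L3)"
  define p2 where "p2 = min m2 (t - p1 - L3)"
  have Lm: "L1 \<le> m1" "L2 \<le> m2" "L3 \<le> m3"
    using assms by (auto simp: L)
  \<comment> \<open>With three positive terms this is \<open>s1 + s2 + s3 \<le> 2\<close>; with two
    it is that one of the \<open>s\<close> is at most 1.\<close>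
  have Lt: "L1 + L2 + L3 \<le> t"
    using assms False unfolding L t_def by (simp add: max_def)
  have tm: "t \<le> m1 + m2 + m3"
    using assms by (simp add: t_def)
  have p1: "L1 \<le> p1" "p1 \<le> m1" "p1 + L2 + L3 \<le> t" "t \<le> p1 + m2 + m3"
    using Lm Lt tm unfolding p1_def by linarith+
  have p2: "L2 \<le> p2" "p2 \<le> m2" "p1 + p2 + L3 \<le> t" "t \<le> p1 + p2 + m3"
    using Lm p1 unfolding p2_def by linarith+
  have L': "0 \<le> L1" "0 \<le> L2" "0 \<le> L3" "s2 + s3 - 1 \<le> L1" "s1 + s3 - 1 \<le> L2" "s1 + s2 - 1 \<le> L3"
    by (auto simp: L)
  show ?thesis
    using p1 p2 L' unfolding t_def
    by (intro exI[of _ p1] exI[of _ p2] exI[of _ "t - p1 - p2"]) (auto simp: t_def)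
qed

text \<open>
  A transportation problem: \<open>q1\<close>, \<open>q2\<close>, \<open>q3\<close> are to be split between two of the capacities
  \<open>c1\<close>, \<open>c2\<close>, \<open>c3\<close> each. The constraints bound differences of \<open>a\<close>, \<open>b\<close>, \<open>g\<close>, and the
  solution consists of shortest path lengths.
\<close>

lemma exists_pair_splitting:
  fixes c1 c2 c3 q1 q2 q3 :: real
  assumes "0 \<le> c1" "0 \<le> c2" "0 \<le> c3" "0 \<le> q1" "0 \<le> q2" "0 \<le> q3"
    and "q1 \<le> c2 + c3" "q2 \<le> c1 + c3" "q3 \<le> c1 + c2" "q1 + q2 + q3 \<le> c1 + c2 + c3"
  shows "\<exists>a b g. 0 \<le> a \<and> a \<le> q1 \<and> 0 \<le> b \<and> b \<le> q2 \<and> 0 \<le> g \<and> g \<le> q3 \<and>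
    g + (q2 - b) \<le> c1 \<and> a + (q3 - g) \<le> c2 \<and> b + (q1 - a) \<le> c3"
  using assms
  by (intro exI[of _ "min q1 (min c2 (c1 + c2 - q3))"] exI[of _ "min q2 (min c3 (c2 + c3 - q1))"]
      exI[of _ "min q3 (min c1 (c1 + c3 - q2))"]) (simp add: min_def)

lemma convex_cut:
  "convex {(x :: real ^ 'n ^ 3, y). (x, y) \<in> lin_relax \<inter> assign_space \<and>
     (\<forall>j1 j2 j3. 2 \<le> x $ 1 $ j1 + x $ 2 $ j2 + x $ 3 $ j3 + y $ 1 + y $ 2 + y $ 3)}" (is "convex ?C")
proof (rule convexI)
  fix p q :: "(real ^ 'n ^ 3) \<times> (real ^ 3)" and u v :: real
  assume pq: "p \<in> ?C" "q \<in> ?C" and uv: "0 \<le> u" "0 \<le> v" "u + v = 1"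
  obtain x y x' y' where p: "p = (x, y)" and q: "q = (x', y')"
    by (cases p, cases q)
  have "u * (x $ 1 $ j + x $ 2 $ j + x $ 3 $ j) + v * (x' $ 1 $ j + x' $ 2 $ j + x' $ 3 $ j) = 1" for j
    using pq uv by (simp add: p q assign_space_def sum_3)
  moreover have "u * 2 + v * 2 \<le> u * (x $ 1 $ j1 + x $ 2 $ j2 + x $ 3 $ j3 + y $ 1 + y $ 2 + y $ 3)
      + v * (x' $ 1 $ j1 + x' $ 2 $ j2 + x' $ 3 $ j3 + y' $ 1 + y' $ 2 + y' $ 3)" for j1 j2 j3
    using pq uv by (intro add_mono mult_left_mono) (auto simp: p q)
  then have "2 \<le> u * (x $ 1 $ j1 + x $ 2 $ j2 + x $ 3 $ j3 + y $ 1 + y $ 2 + y $ 3)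
      + v * (x' $ 1 $ j1 + x' $ 2 $ j2 + x' $ 3 $ j3 + y' $ 1 + y' $ 2 + y' $ 3)" for j1 j2 j3
    using uv(3) by (simp flip: distrib_right)
  moreover have "0 \<le> u * x $ i $ j + v * x' $ i $ j" for i j
    using pq uv by (auto simp: p q lin_relax_def)
  moreover have "u * x $ i $ j + v * x' $ i $ j \<le> u * y $ i + v * y' $ i" for i j
    using pq uv by (auto simp: p q lin_relax_def intro!: add_mono mult_left_mono)
  moreover have "u * y $ i + v * y' $ i \<le> 1" for i
    using pq uv by (intro convex_bound_le) (auto simp: p q lin_relax_def)
  ultimately show "u *\<^sub>R p + v *\<^sub>R q \<in> ?C"
    by (simp add: p q lin_relax_def assign_space_def sum_3 algebra_simps)
qed

text \<open>If two rows are active, the \<open>y\<close> already sum to 2. If one is active, its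
  entries are all 1, which adds the missing 1. No active row contradicts the column sums.\<close>

lemma int_points_cut:
  fixes x :: "real ^ 'n ^ 3"
  assumes "(x, y) \<in> int_points"
  shows "2 \<le> x $ 1 $ j1 + x $ 2 $ j2 + x $ 3 $ j3 + y $ 1 + y $ 2 + y $ 3"
proof -
  have b: "0 \<le> x $ i $ j" "x $ i $ j \<le> y $ i" "y $ i = 0 \<or> y $ i = 1" for i j
    using assms by (auto simp: int_points_def lin_relax_def)
  have s: "x $ 1 $ j + x $ 2 $ j + x $ 3 $ j = 1" for j
    using assms by (auto simp: int_points_def assign_space_def sum_3)
  show ?thesis
    using b(3)[of 1] b(3)[of 2] b(3)[of 3] b(1,2)[of 1 j1] b(1,2)[of 2 j1] b(1,2)[of 3 j1]
      b(1,2)[of 1 j2] b(1,2)[of 2 j2] b(1,2)[of 3 j2] b(1,2)[of 1 j3] b(1,2)[of 2 j3] b(1,2)[of 3 j3]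
      s[of j1] s[of j2] s[of j3]
    by (elim disjE) linarith+
qed

lemma cut_in_int_hull:
  fixes x :: "real ^ 'n ^ 3"
  assumes P: "(x, y) \<in> lin_relax \<inter> assign_space"
    and cut: "\<And>j1 j2 j3. 2 \<le> x $ 1 $ j1 + x $ 2 $ j2 + x $ 3 $ j3 + y $ 1 + y $ 2 + y $ 3"
  shows "(x, y) \<in> int_hull"
proof -
  define m where "m i = Min (range (\<lambda>j. x $ i $ j))" for i
  have m_le: "m i \<le> x $ i $ j" for i j
    unfolding m_def by (rule Min_le) auto
  have "\<exists>j. m i = x $ i $ j" for i
    unfolding m_def using Min_in[of "range (\<lambda>j. x $ i $ j)"] by (metis finite finite_imageI image_is_empty rangeE UNIV_not_empty)
  then obtain J where J: "\<And>i. m i = x $ i $ J i"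
    by metis
  have b: "0 \<le> x $ i $ j" "x $ i $ j \<le> y $ i" "y $ i \<le> 1" for i j
    using P by (auto simp: lin_relax_def)
  have s: "x $ 1 $ j + x $ 2 $ j + x $ 3 $ j = 1" for j
    using P by (auto simp: assign_space_def sum_3)
  define s1 s2 s3 where sdef: "s1 = 1 - y $ 1" "s2 = 1 - y $ 2" "s3 = 1 - y $ 3"
  have y0: "0 \<le> y $ i" for i
    using b(1,2)[of i undefined] by linarith
  \<comment> \<open>In the column where row 1 attains its minimum, the other two entries are at most
    \<open>y $ 2\<close> and \<open>y $ 3\<close>, and the column sums to 1.\<close>
  have "s2 + s3 - 1 \<le> m 1" "s1 + s3 - 1 \<le> m 2" "s1 + s2 - 1 \<le> m 3"
    unfolding J sdef using s[of "J 1"] s[of "J 2"] s[of "J 3"] b(2)[of 1 "J 2"] b(2)[of 1 "J 3"]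
      b(2)[of 2 "J 1"] b(2)[of 2 "J 3"] b(2)[of 3 "J 1"] b(2)[of 3 "J 2"] by linarith+
  moreover have "s1 + s2 + s3 \<le> 2"
    unfolding sdef using s[of undefined] b(2)[of 1 undefined] b(2)[of 2 undefined] b(2)[of 3 undefined]
    by linarith
  moreover have "s1 + s2 + s3 - 1 \<le> m 1 + m 2 + m 3"
    using cut[of "J 1" "J 2" "J 3"] unfolding J sdef by linarith
  moreover have "0 \<le> m i" for i
    using b by (simp add: J)
  ultimately obtain p1 p2 p3 where p: "0 \<le> p1" "0 \<le> p2" "0 \<le> p3" "p1 \<le> m 1" "p2 \<le> m 2" "p3 \<le> m 3"
      "p2 + p3 \<le> s1" "p1 + p3 \<le> s2" "p1 + p2 \<le> s3" "s1 + s2 + s3 - 1 \<le> p1 + p2 + p3"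
    using exists_singleton_weights[of "m 1" "m 2" "m 3" s1 s2 s3] b(3) y0 unfolding sdef by auto
  \<comment> \<open>\<open>q1\<close> is the weight with row 1 inactive and the other two active,
    \<open>r\<close> the weight with all rows active. In each column, \<open>x - p\<close> is the
    mass left after the single-row patterns; the \<open>q\<close> must be distributed within it, and
    what then remains sums to \<open>r\<close>.\<close>
  define q1 q2 q3 r where q: "q1 = s1 - p2 - p3" "q2 = s2 - p1 - p3" "q3 = s3 - p1 - p2"
    "r = 1 - s1 - s2 - s3 + p1 + p2 + p3"
  have "\<exists>a b g. 0 \<le> a \<and> a \<le> q1 \<and> 0 \<le> b \<and> b \<le> q2 \<and> 0 \<le> g \<and> g \<le> q3 \<and>
    g + (q2 - b) \<le> x $ 1 $ j - p1 \<and> a + (q3 - g) \<le> x $ 2 $ j - p2 \<and> b + (q1 - a) \<le> x $ 3 $ j - p3" for j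
    using p m_le[of 1 j] m_le[of 2 j] m_le[of 3 j] s[of j] b(2)[of 1 j] b(2)[of 2 j] b(2)[of 3 j]
    by (intro exists_pair_splitting) (auto simp: q sdef)
  then obtain A B G where ABG: "\<And>j. 0 \<le> A j \<and> A j \<le> q1 \<and> 0 \<le> B j \<and> B j \<le> q2 \<and> 0 \<le> G j \<and> G j \<le> q3 \<and>
    G j + (q2 - B j) \<le> x $ 1 $ j - p1 \<and> A j + (q3 - G j) \<le> x $ 2 $ j - p2 \<and> B j + (q1 - A j) \<le> x $ 3 $ j - p3"
    by metis
  have q0: "0 \<le> q1" "0 \<le> q2" "0 \<le> q3" "0 \<le> r"
    using p by (auto simp: q)
  have "(rows3 (\<lambda>j. p1) (\<lambda>j. 0) (\<lambda>j. 0) :: real ^ 'n ^ 3, vector [p1 * 1, p1 * 0, p1 * 0]) \<in> scaled_hull p1"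
    "(rows3 (\<lambda>j. 0) (\<lambda>j. p2) (\<lambda>j. 0) :: real ^ 'n ^ 3, vector [p2 * 0, p2 * 1, p2 * 0]) \<in> scaled_hull p2"
    "(rows3 (\<lambda>j. 0) (\<lambda>j. 0) (\<lambda>j. p3) :: real ^ 'n ^ 3, vector [p3 * 0, p3 * 0, p3 * 1]) \<in> scaled_hull p3"
    using p by (intro rows3_in_scaled_hull; auto)+
  moreover have "(rows3 (\<lambda>j. 0) (\<lambda>j. A j) (\<lambda>j. q1 - A j) :: real ^ 'n ^ 3, vector [q1 * 0, q1 * 1, q1 * 1]) \<in> scaled_hull q1"
    "(rows3 (\<lambda>j. q2 - B j) (\<lambda>j. 0) (\<lambda>j. B j) :: real ^ 'n ^ 3, vector [q2 * 1, q2 * 0, q2 * 1]) \<in> scaled_hull q2"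
    "(rows3 (\<lambda>j. G j) (\<lambda>j. q3 - G j) (\<lambda>j. 0) :: real ^ 'n ^ 3, vector [q3 * 1, q3 * 1, q3 * 0]) \<in> scaled_hull q3"
    using q0 ABG by (intro rows3_in_scaled_hull; auto)+
  moreover have "(rows3 (\<lambda>j. x $ 1 $ j - p1 - G j - (q2 - B j)) (\<lambda>j. x $ 2 $ j - p2 - A j - (q3 - G j))
      (\<lambda>j. x $ 3 $ j - p3 - B j - (q1 - A j)) :: real ^ 'n ^ 3, vector [r * 1, r * 1, r * 1]) \<in> scaled_hull r"
  proof (rule rows3_in_scaled_hull)
    fix j
    have 1: "0 \<le> x $ 1 $ j - p1 - G j - (q2 - B j)" "0 \<le> x $ 2 $ j - p2 - A j - (q3 - G j)"
      "0 \<le> x $ 3 $ j - p3 - B j - (q1 - A j)"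
      using ABG[of j] by linarith+
    have 2: "x $ 1 $ j - p1 - G j - (q2 - B j) + (x $ 2 $ j - p2 - A j - (q3 - G j))
        + (x $ 3 $ j - p3 - B j - (q1 - A j)) = r"
      using s[of j] by (simp add: q)
    show "x $ 1 $ j - p1 - G j - (q2 - B j) + (x $ 2 $ j - p2 - A j - (q3 - G j))
        + (x $ 3 $ j - p3 - B j - (q1 - A j)) = r"
      by (rule 2)
    show "0 \<le> x $ 1 $ j - p1 - G j - (q2 - B j) \<and> x $ 1 $ j - p1 - G j - (q2 - B j) \<le> r * 1"
      "0 \<le> x $ 2 $ j - p2 - A j - (q3 - G j) \<and> x $ 2 $ j - p2 - A j - (q3 - G j) \<le> r * 1"
      "0 \<le> x $ 3 $ j - p3 - B j - (q1 - A j) \<and> x $ 3 $ j - p3 - B j - (q1 - A j) \<le> r * 1"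
      using 1 2 by linarith+
  qed (use q0 in auto)
  ultimately have "(rows3 (\<lambda>j. p1) (\<lambda>j. 0) (\<lambda>j. 0) :: real ^ 'n ^ 3, vector [p1 * 1, p1 * 0, p1 * 0])
    + (rows3 (\<lambda>j. 0) (\<lambda>j. p2) (\<lambda>j. 0), vector [p2 * 0, p2 * 1, p2 * 0])
    + (rows3 (\<lambda>j. 0) (\<lambda>j. 0) (\<lambda>j. p3), vector [p3 * 0, p3 * 0, p3 * 1])
    + (rows3 (\<lambda>j. 0) (\<lambda>j. A j) (\<lambda>j. q1 - A j), vector [q1 * 0, q1 * 1, q1 * 1])
    + (rows3 (\<lambda>j. q2 - B j) (\<lambda>j. 0) (\<lambda>j. B j), vector [q2 * 1, q2 * 0, q2 * 1])
    + (rows3 (\<lambda>j. G j) (\<lambda>j. q3 - G j) (\<lambda>j. 0), vector [q3 * 1, q3 * 1, q3 * 0])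
    + (rows3 (\<lambda>j. x $ 1 $ j - p1 - G j - (q2 - B j)) (\<lambda>j. x $ 2 $ j - p2 - A j - (q3 - G j))
      (\<lambda>j. x $ 3 $ j - p3 - B j - (q1 - A j)), vector [r * 1, r * 1, r * 1])
    \<in> scaled_hull (p1 + p2 + p3 + q1 + q2 + q3 + r)" (is "?w \<in> _")
    using p q0 by (intro scaled_hull_add add_nonneg_nonneg)
  also have "?w = (x, y)"
    by (simp add: vec_eq_iff forall_3 q sdef)
  also have "p1 + p2 + p3 + q1 + q2 + q3 + r = 1"
    by (simp add: q)
  finally show ?thesis
    by (simp add: scaled_hull_def)
qed

lemma int_hull_eq_cut:
  "(int_hull :: ((real ^ 'n ^ 3) \<times> (real ^ 3)) set) = {(x, y). (x, y) \<in> lin_relax \<inter> assign_space \<and>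
     (\<forall>j1 j2 j3. 2 \<le> x $ 1 $ j1 + x $ 2 $ j2 + x $ 3 $ j3 + y $ 1 + y $ 2 + y $ 3)}"
proof (rule antisym)
  show "(int_hull :: ((real ^ 'n ^ 3) \<times> (real ^ 3)) set) \<subseteq> {(x, y). (x, y) \<in> lin_relax \<inter> assign_space \<and>
     (\<forall>j1 j2 j3. 2 \<le> x $ 1 $ j1 + x $ 2 $ j2 + x $ 3 $ j3 + y $ 1 + y $ 2 + y $ 3)}"
    unfolding int_hull_eq
  proof (rule hull_minimal)
    show "int_points \<subseteq> {(x :: real ^ 'n ^ 3, y). (x, y) \<in> lin_relax \<inter> assign_space \<and>
     (\<forall>j1 j2 j3. 2 \<le> x $ 1 $ j1 + x $ 2 $ j2 + x $ 3 $ j3 + y $ 1 + y $ 2 + y $ 3)}"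
      using int_points_cut by (fastforce simp: int_points_def)
  qed (rule convex_cut)
qed (use cut_in_int_hull in auto)

section \<open>Volumes as integrals against the density of the minima\<close>

definition triple :: "real ^ 3 \<Rightarrow> real3" where
  "triple y = (y $ 1, y $ 2, y $ 3)"

lemma measurable_triple [measurable]: "triple \<in> borel_measurable borel"
  unfolding triple_def by measurable

lemma nn_integral_triple:
  assumes [measurable]: "f \<in> borel_measurable borel"
  shows "(\<integral>\<^sup>+y. f (triple y) \<partial>lborel) = (\<integral>\<^sup>+p. f p \<partial>lborel)"
  by (subst nn_integral_vec3) (simp_all add: triple_def nn_integral_lborel_triple)

text \<open>Relaxation, hull and gap all have this form, so a single integral formula serves the
  three.\<close>

definition min_region :: "(real3 \<times> real3) set \<Rightarrow> ((real ^ 'n ^ 2) \<times> (real ^ 3)) set" where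
  "min_region Q = {(z, y). z \<in> below (triple y) \<and> (col_min z, triple y) \<in> Q}"

lemma min_region_borel:
  assumes [measurable]: "Q \<in> sets borel"
  shows "(min_region Q :: ((real ^ 'n ^ 2) \<times> (real ^ 3)) set) \<in> sets borel"
proof -
  have "min_region Q = {p :: (real ^ 'n ^ 2) \<times> (real ^ 3). (\<forall>j. fst p $ 1 $ j \<le> snd p $ 1 \<and> fst p $ 2 $ j \<le> snd p $ 2
      \<and> 1 - fst p $ 1 $ j - fst p $ 2 $ j \<le> snd p $ 3)}
      \<inter> (\<lambda>p. (col_min (fst p), triple (snd p))) -` Q"
    by (auto simp: min_region_def below_def triple_def)
  moreover have "closed {p :: (real ^ 'n ^ 2) \<times> (real ^ 3). (\<forall>j. fst p $ 1 $ j \<le> snd p $ 1 \<and> fst p $ 2 $ j \<le> snd p $ 2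
      \<and> 1 - fst p $ 1 $ j - fst p $ 2 $ j \<le> snd p $ 3)}"
    by (intro closed_Collect_all closed_Collect_conj closed_Collect_le continuous_intros)
  moreover have "(\<lambda>p :: (real ^ 'n ^ 2) \<times> (real ^ 3). (col_min (fst p), triple (snd p))) \<in> borel_measurable borel"
    by measurable
  from measurable_sets[OF this, of Q]
  have "(\<lambda>p :: (real ^ 'n ^ 2) \<times> (real ^ 3). (col_min (fst p), triple (snd p))) -` Q \<in> sets borel"
    by simp
  ultimately show ?thesis
    by simp
qed

definition joint_density :: "nat \<Rightarrow> real3 \<Rightarrow> real3 \<Rightarrow> real" where
  "joint_density n = (\<lambda>(a, b, c) (a', b', c'). if a \<le> a' \<and> b \<le> b' \<and> c \<le> c' then min_density n a b c a' b' c' else 0)"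

lemma measurable_joint_density [measurable]:
  "(\<lambda>(m, y). joint_density n m y) \<in> borel_measurable borel"
  unfolding joint_density_def case_prod_unfold by measurable

lemma joint_density_nonneg: "1 \<le> n \<Longrightarrow> 0 \<le> joint_density n m y"
  by (auto simp: joint_density_def min_density_nonneg split: prod.split)

text \<open>For fixed \<open>y\<close> the law of the minima applies; the factor
  \<open>2 ^ n\<close> compensates for \<open>area2\<close> being twice the area. The order of
  integration is then exchanged, because the substitution to follow is affine in \<open>y\<close>
  for fixed minima.\<close>

lemma emeasure_min_region:
  assumes n: "2 \<le> CARD('n::finite)" and [measurable]: "Q \<in> sets borel"
  shows "2 ^ CARD('n) * emeasure lborel (min_region Q :: ((real ^ 'n ^ 2) \<times> (real ^ 3)) set)
    = (\<integral>\<^sup>+m. \<integral>\<^sup>+y. ennreal (joint_density CARD('n) m y) * indicator Q (m, y) \<partial>lborel \<partial>lborel)"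
proof -
  let ?n = "CARD('n)"
  let ?V = "min_region Q :: ((real ^ 'n ^ 2) \<times> (real ^ 3)) set"
  have [measurable]: "?V \<in> sets borel"
    by (rule min_region_borel) fact
  have m1 [measurable]: "(\<lambda>m. indicator Q (m, p) :: ennreal) \<in> borel_measurable borel" for p
  proof -
    have "(\<lambda>m::real3. (m, p)) \<in> borel_measurable borel"
      by (intro borel_measurable_continuous_onI continuous_intros)
    then show ?thesis
      by measurable
  qed
  have [measurable]: "(\<lambda>(m, p). ennreal (joint_density ?n m p) * indicator Q (m, p)) \<in> borel_measurable borel"
    unfolding case_prod_unfold prod.collapse
    by (intro borel_measurable_times_ennreal measurable_compose[OF _ measurable_ennreal]
        measurable_joint_density[unfolded case_prod_unfold]) measurable
  then have m2: "(\<lambda>(m, p). ennreal (joint_density ?n m p) * indicator Q (m, p)) \<in> borel_measurable (lborel \<Otimes>\<^sub>M lborel)"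
    by (simp add: lborel_prod)
  have inner: "(\<integral>\<^sup>+z. indicator ?V (z, y) \<partial>lborel)
      = ennreal (1 / 2 ^ ?n) * (\<integral>\<^sup>+m. ennreal (joint_density ?n m (triple y)) * indicator Q (m, triple y) \<partial>lborel)" for y
  proof -
    obtain a' b' c' where y: "triple y = (a', b', c')"
      by (metis prod_cases3)
    have "(\<lambda>x. (x, (a', b', c'))) \<in> borel_measurable borel"
      by (intro borel_measurable_continuous_onI continuous_intros)
    from measurable_compose[OF this measurable_joint_density]
    have [measurable]: "(\<lambda>m. joint_density ?n m (a', b', c')) \<in> borel_measurable borel"
      by simp
    have "(\<integral>\<^sup>+z. indicator ?V (z, y) \<partial>lborel)
        = (\<integral>\<^sup>+z. indicator Q (col_min z, (a', b', c')) * indicator (below (a', b', c') :: (real ^ 'n ^ 2) set) z \<partial>lborel)"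
      by (intro nn_integral_cong) (auto simp: min_region_def indicator_def y)
    also have "\<dots> = (\<integral>\<^sup>+a. \<integral>\<^sup>+b. \<integral>\<^sup>+c. indicator Q ((a, b, c), (a', b', c')) * (ennreal (min_density ?n a b c a' b' c' / 2 ^ ?n)
        * indicator {..(a', b', c')} (a, b, c)) \<partial>lborel \<partial>lborel \<partial>lborel)"
      by (rule nn_integral_col_min[OF n]) (rule m1)
    also have "\<dots> = (\<integral>\<^sup>+a. \<integral>\<^sup>+b. \<integral>\<^sup>+c. ennreal (1 / 2 ^ ?n) * (ennreal (joint_density ?n (a, b, c) (a', b', c'))
        * indicator Q ((a, b, c), (a', b', c'))) \<partial>lborel \<partial>lborel \<partial>lborel)"
      using n by (intro nn_integral_cong)
        (auto simp: joint_density_def indicator_def min_density_nonneg simp flip: ennreal_mult)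
    also have "\<dots> = (\<integral>\<^sup>+m. ennreal (1 / 2 ^ ?n) * (ennreal (joint_density ?n m (a', b', c'))
        * indicator Q (m, (a', b', c'))) \<partial>lborel)"
      by (subst nn_integral_lborel_triple) simp_all
    also have "\<dots> = ennreal (1 / 2 ^ ?n) * (\<integral>\<^sup>+m. ennreal (joint_density ?n m (a', b', c'))
        * indicator Q (m, (a', b', c')) \<partial>lborel)"
      by (subst nn_integral_cmult) simp_all
    finally show ?thesis
      by (simp add: y)
  qed
  have "emeasure lborel ?V = (\<integral>\<^sup>+p. indicator ?V p \<partial>(lborel \<Otimes>\<^sub>M lborel))"
    by (simp add: lborel_prod)
  also have "\<dots> = (\<integral>\<^sup>+y. \<integral>\<^sup>+z. indicator ?V (z, y) \<partial>lborel \<partial>lborel)"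
    by (rule lborel_pair.nn_integral_snd[symmetric]) (simp add: lborel_prod)
  also have "\<dots> = (\<integral>\<^sup>+y. ennreal (1 / 2 ^ ?n) * (\<integral>\<^sup>+m. ennreal (joint_density ?n m y) * indicator Q (m, y) \<partial>lborel) \<partial>lborel)"
    unfolding inner by (rule nn_integral_triple) (use m2 in measurable)
  also have "\<dots> = ennreal (1 / 2 ^ ?n) * (\<integral>\<^sup>+y. \<integral>\<^sup>+m. ennreal (joint_density ?n m y) * indicator Q (m, y) \<partial>lborel \<partial>lborel)"
    by (rule nn_integral_cmult) (use m2 in measurable)
  also have "(\<integral>\<^sup>+y. \<integral>\<^sup>+m. ennreal (joint_density ?n m y) * indicator Q (m, y) \<partial>lborel \<partial>lborel)
      = (\<integral>\<^sup>+m. \<integral>\<^sup>+y. ennreal (joint_density ?n m y) * indicator Q (m, y) \<partial>lborel \<partial>lborel)"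
    by (rule lborel_pair.Fubini'[OF m2])
  finally have "2 ^ ?n * emeasure lborel ?V = ennreal (2 ^ ?n * (1 / 2 ^ ?n)) * \<dots>"
    by (subst ennreal_mult) (simp_all add: mult.assoc flip: ennreal_power)
  then show ?thesis
    by simp
qed

section \<open>The projected bodies in terms of minima and bounds\<close>

definition lift_row3 :: "real ^ 'n ^ 2 \<Rightarrow> real ^ 'n ^ 3" where
  "lift_row3 z = vector [z $ 1, z $ 2, \<chi> j. 1 - z $ 1 $ j - z $ 2 $ j]"

lemma lift_row3_nth [simp]:
  "lift_row3 z $ 1 = z $ 1" "lift_row3 z $ 2 = z $ 2" "lift_row3 z $ 3 $ j = 1 - z $ 1 $ j - z $ 2 $ j"
  by (simp_all add: lift_row3_def)

text \<open>The column sums determine the deleted row, so the image is a preimage under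
  \<open>lift_row3\<close>.\<close>

lemma delete_row3_image:
  assumes "S \<subseteq> assign_space"
  shows "delete_row3 ` S = {(z, y). (lift_row3 z, y) \<in> S}"
proof (intro set_eqI iffI)
  fix p assume "p \<in> delete_row3 ` S"
  then obtain x y where xy: "(x, y) \<in> S" and p: "p = delete_row3 (x, y)"
    by auto
  then have "x $ 1 $ j + x $ 2 $ j + x $ 3 $ j = 1" for j
    using assms by (auto simp: assign_space_def sum_3)
  then have "lift_row3 (vector [x $ 1, x $ 2]) = x"
    by (simp add: vec_eq_iff forall_3 algebra_simps)
  then show "p \<in> {(z, y). (lift_row3 z, y) \<in> S}"
    using xy p by (simp add: delete_row3_def)
next
  fix p assume "p \<in> {(z, y). (lift_row3 z, y) \<in> S}"
  then obtain z y where "(lift_row3 z, y) \<in> S" and p: "p = (z, y)"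
    by auto
  moreover have "delete_row3 (lift_row3 z, y) = (z, y)"
    by (simp add: delete_row3_def vec_eq_iff forall_2)
  ultimately show "p \<in> delete_row3 ` S"
    by (metis imageI)
qed

lemma lift_row3_relax_iff:
  "(lift_row3 z, y) \<in> lin_relax \<inter> assign_space \<longleftrightarrow>
     z \<in> below (triple y) \<and> (0, 0, 0) \<le> col_min z \<and> triple y \<le> (1, 1, 1)"
proof -
  have 1: "z \<in> below (triple y) \<and> (0, 0, 0) \<le> col_min z \<longleftrightarrow> (\<forall>j. (z $ 1 $ j, z $ 2 $ j) \<in> region (0, 0, 0) (triple y))"
    using col_min_ge_iff[of "(0, 0, 0)" z "triple y"] by blast
  have 2: "(lift_row3 z, y) \<in> lin_relax \<inter> assign_space \<longleftrightarrow>
     (\<forall>j. (z $ 1 $ j, z $ 2 $ j) \<in> region (0, 0, 0) (triple y)) \<and> y $ 1 \<le> 1 \<and> y $ 2 \<le> 1 \<and> y $ 3 \<le> 1"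
    by (simp add: lin_relax_def assign_space_def sum_3 forall_3 region_def triple_def) blast
  have 3: "triple y \<le> (1, 1, 1) \<longleftrightarrow> y $ 1 \<le> 1 \<and> y $ 2 \<le> 1 \<and> y $ 3 \<le> 1"
    by (simp add: triple_def)
  show ?thesis
    unfolding 2 by (simp only: 3[symmetric] 1[symmetric] conj_assoc)
qed

fun coord_sum :: "real3 \<Rightarrow> real" where
  "coord_sum (a, b, c) = a + b + c"

lemma coord_sum_triple: "coord_sum (triple y) = y $ 1 + y $ 2 + y $ 3"
  by (simp add: triple_def)

text \<open>The three column indices vary independently, so each entry can be minimised on its
  own.\<close>

lemma le_coord_sum_col_min_iff:
  fixes z :: "real ^ 'n ^ 2"
  shows "(\<forall>j1 j2 j3. r \<le> z $ 1 $ j1 + z $ 2 $ j2 + (1 - z $ 1 $ j3 - z $ 2 $ j3) + s) \<longleftrightarrow> r \<le> coord_sum (col_min z) + s"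
    (is "?L \<longleftrightarrow> ?R")
proof
  assume ?L
  have "\<exists>j. Min (range f) = f j" for f :: "'n \<Rightarrow> real"
    using Min_in[of "range f"] by (metis finite finite_imageI image_is_empty rangeE UNIV_not_empty)
  from this[of "\<lambda>j. z $ 1 $ j"] this[of "\<lambda>j. z $ 2 $ j"] this[of "\<lambda>j. 1 - z $ 1 $ j - z $ 2 $ j"]
  obtain j1 j2 j3 where "Min (range (\<lambda>j. z $ 1 $ j)) = z $ 1 $ j1" "Min (range (\<lambda>j. z $ 2 $ j)) = z $ 2 $ j2"
      "Min (range (\<lambda>j. 1 - z $ 1 $ j - z $ 2 $ j)) = 1 - z $ 1 $ j3 - z $ 2 $ j3"
    by blast
  then show ?R
    using \<open>?L\<close> by (simp add: col_min_def)
next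
  assume R: ?R
  have "Min (range f) \<le> f j" for f :: "'n \<Rightarrow> real" and j
    by (rule Min_le) auto
  note le = this[of "\<lambda>j. z $ 1 $ j"] this[of "\<lambda>j. z $ 2 $ j"] this[of "\<lambda>j. 1 - z $ 1 $ j - z $ 2 $ j"]
  show ?L
  proof (intro allI)
    fix j1 j2 j3
    show "r \<le> z $ 1 $ j1 + z $ 2 $ j2 + (1 - z $ 1 $ j3 - z $ 2 $ j3) + s"
      using le(1)[of j1] le(2)[of j2] le(3)[of j3] R unfolding col_min_def coord_sum.simps by linarith
  qed
qed

definition relax_range :: "(real3 \<times> real3) set" where
  "relax_range = {(m, y). (0, 0, 0) \<le> m \<and> y \<le> (1, 1, 1)}"

definition hull_range :: "(real3 \<times> real3) set" where
  "hull_range = {(m, y). (0, 0, 0) \<le> m \<and> y \<le> (1, 1, 1) \<and> 2 \<le> coord_sum m + coord_sum y}"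

lemma delete_row3_relax:
  "delete_row3 ` (lin_relax \<inter> assign_space) = min_region relax_range"
  by (subst delete_row3_image) (auto simp: lift_row3_relax_iff[simplified] min_region_def relax_range_def)

lemma delete_row3_hull:
  "delete_row3 ` (int_hull :: ((real ^ 'n ^ 3) \<times> (real ^ 3)) set) = min_region hull_range"
proof -
  have sub: "(int_hull :: ((real ^ 'n ^ 3) \<times> (real ^ 3)) set) \<subseteq> assign_space"
    by (auto simp: int_hull_eq_cut)
  have "(lift_row3 z, y) \<in> (int_hull :: ((real ^ 'n ^ 3) \<times> (real ^ 3)) set) \<longleftrightarrow>
      (z, y) \<in> min_region hull_range" for z :: "real ^ 'n ^ 2" and y
  proof -
    have "(lift_row3 z, y) \<in> (int_hull :: ((real ^ 'n ^ 3) \<times> (real ^ 3)) set) \<longleftrightarrow>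
      (lift_row3 z, y) \<in> lin_relax \<inter> assign_space \<and> 2 \<le> coord_sum (col_min z) + coord_sum (triple y)"
      unfolding int_hull_eq_cut coord_sum_triple le_coord_sum_col_min_iff[symmetric]
      by (simp add: add.assoc)
    then show ?thesis
      unfolding lift_row3_relax_iff by (auto simp: min_region_def hull_range_def)
  qed
  then show ?thesis
    using delete_row3_image[OF sub] by auto
qed

lemma coord_sum_eq: "coord_sum p = fst p + fst (snd p) + snd (snd p)"
  by (cases p) simp

lemma closed_relax_range: "closed relax_range"
  unfolding relax_range_def case_prod_unfold less_eq_prod_def
  by (intro closed_Collect_conj closed_Collect_le continuous_intros)

lemma closed_hull_range: "closed hull_range"
  unfolding hull_range_def case_prod_unfold less_eq_prod_def coord_sum_eq
  by (intro closed_Collect_conj closed_Collect_le continuous_intros)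

lemma hull_range_subset: "hull_range \<subseteq> relax_range"
  by (auto simp: hull_range_def relax_range_def)

lemma emeasure_min_region_relax_finite:
  "emeasure lborel (min_region relax_range :: ((real ^ 'n ^ 2) \<times> (real ^ 3)) set) < \<infinity>"
proof -
  have "(min_region relax_range :: ((real ^ 'n ^ 2) \<times> (real ^ 3)) set) \<subseteq> cbox (0, 0) (\<chi> i j. 1, \<chi> i. 1)"
  proof (rule subsetI)
    fix p :: "(real ^ 'n ^ 2) \<times> (real ^ 3)" assume "p \<in> min_region relax_range"
    then obtain z y where "(z, y) \<in> min_region relax_range" and p: "p = (z, y)"
      by (cases p) auto
    then have b: "z \<in> below (triple y)" "(0, 0, 0) \<le> col_min z" "triple y \<le> (1, 1, 1)"
      by (auto simp: min_region_def relax_range_def)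
    then have r: "(z $ 1 $ j, z $ 2 $ j) \<in> region (0, 0, 0) (triple y)" for j
      using col_min_ge_iff[of "(0, 0, 0)" z "triple y"] by blast
    have z: "0 \<le> z $ 1 $ j \<and> z $ 1 $ j \<le> 1" "0 \<le> z $ 2 $ j \<and> z $ 2 $ j \<le> 1" for j
      using r[of j] b(3) by (auto simp: region_def triple_def)
    have y: "0 \<le> y $ 1 \<and> y $ 1 \<le> 1" "0 \<le> y $ 2 \<and> y $ 2 \<le> 1" "0 \<le> y $ 3 \<and> y $ 3 \<le> 1"
      using r[of undefined] b(3) by (auto simp: region_def triple_def)
    have "z \<in> cbox 0 (\<chi> i j. 1)"
      using z by (auto simp: mem_box Basis_vec_def inner_axis forall_2)
    moreover have "y \<in> cbox 0 (\<chi> i. 1)"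
      using y by (simp add: mem_box_cart forall_3)
    ultimately show "p \<in> cbox (0, 0) (\<chi> i j. 1, \<chi> i. 1)"
      by (simp add: cbox_Pair_eq p)
  qed
  then have "emeasure lborel (min_region relax_range :: ((real ^ 'n ^ 2) \<times> (real ^ 3)) set)
      \<le> emeasure lborel (cbox (0 :: real ^ 'n ^ 2, 0 :: real ^ 3) (\<chi> i j. 1, \<chi> i. 1))"
    by (intro emeasure_mono) auto
  also have "\<dots> < \<infinity>"
    by (rule emeasure_lborel_cbox_finite)
  finally show ?thesis .
qed

section \<open>The density in scaled variables\<close>

definition kernel :: "nat \<Rightarrow> real \<Rightarrow> real \<Rightarrow> real \<Rightarrow> real \<Rightarrow> real" where
  "kernel n t u1 u2 u3 =
     4 * real n * (real n - 1) * (t\<^sup>2 - (pp u1)\<^sup>2 - (pp u2)\<^sup>2 - (pp u3)\<^sup>2) ^ (n - 2) *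
       (of_bool (u1 < 0) * pp (t - pp u2 - pp u3) + of_bool (u2 < 0) * pp (t - pp u1 - pp u3)
        + of_bool (u3 < 0) * pp (t - pp u1 - pp u2))
     + 8 * falling3 n * (pp (t - pp u2 - pp u3) * pp (t - pp u1 - pp u3) * pp (t - pp u1 - pp u2)) *
       (t\<^sup>2 - (pp u1)\<^sup>2 - (pp u2)\<^sup>2 - (pp u3)\<^sup>2) ^ (n - 3)"

text \<open>
  The density of the minima \<open>(a, b, c)\<close> in the variables \<open>t = 1 - a - b - c\<close> and \<open>u\<^sub>1 = 1 - y\<^sub>1 - b - c\<close>,
  etc. On its support the mixed terms of \<open>area2\<close> vanish, which leaves \<open>t\<^sup>2 - \<Sum> (pp u\<^sub>i)\<^sup>2\<close>.
\<close>

lemma measurable_kernel [measurable (raw)]: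
  assumes [measurable]: "f0 \<in> borel_measurable M" "f1 \<in> borel_measurable M" "f2 \<in> borel_measurable M" "f3 \<in> borel_measurable M"
  shows "(\<lambda>x. kernel n (f0 x) (f1 x) (f2 x) (f3 x)) \<in> borel_measurable M"
  unfolding kernel_def of_bool_def by measurable

lemma kernel_swap:
  "kernel n t u1 u2 u3 = kernel n t u2 u1 u3"
  "kernel n t u1 u2 u3 = kernel n t u1 u3 u2"
proof -
  have 1: "t\<^sup>2 - (pp u1)\<^sup>2 - (pp u2)\<^sup>2 - (pp u3)\<^sup>2 = t\<^sup>2 - (pp u2)\<^sup>2 - (pp u1)\<^sup>2 - (pp u3)\<^sup>2"
    and 2: "t\<^sup>2 - (pp u1)\<^sup>2 - (pp u2)\<^sup>2 - (pp u3)\<^sup>2 = t\<^sup>2 - (pp u1)\<^sup>2 - (pp u3)\<^sup>2 - (pp u2)\<^sup>2"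
    by simp_all
  have 3: "t - pp x - pp y = t - pp y - pp x" for x y
    by simp
  show "kernel n t u1 u2 u3 = kernel n t u2 u1 u3"
    unfolding kernel_def 1 3[of u1 u2] by (simp add: algebra_simps)
  show "kernel n t u1 u2 u3 = kernel n t u1 u3 u2"
    unfolding kernel_def 2 3[of u2 u3] by (simp add: algebra_simps)
qed

text \<open>A negative coordinate enters only through its sign; \<open>- 1\<close> is the
  representative used from here on.\<close>

lemma kernel_sign: "x < 0 \<Longrightarrow> kernel n t x u v = kernel n t (- 1) u v"
  by (simp add: kernel_def)

lemma kernel_eq_0:
  assumes "t < u1"
  shows "kernel n t u1 u2 u3 = 0"
proof -
  have "pp (t - pp u1 - pp u3) = 0" "pp (t - pp u1 - pp u2) = 0" "of_bool (u1 < 0) * pp (t - pp u2 - pp u3) = (0::real)"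
    using assms by (auto simp: pp_def)
  then show ?thesis
    by (simp add: kernel_def)
qed

lemma kernel_nonpos: "t \<le> 0 \<Longrightarrow> kernel n t u1 u2 u3 = 0"
  unfolding kernel_def by (simp add: pp_def)

lemma joint_density_eq_kernel:
  "joint_density n (a, b, c) (1 - b - c - u1, 1 - a - c - u2, 1 - a - b - u3) = kernel n (1 - a - b - c) u1 u2 u3"
proof -
  define t where "t = 1 - a - b - c"
  show ?thesis
  proof (cases "u1 \<le> t \<and> u2 \<le> t \<and> u3 \<le> t")
    case False
    then have "kernel n t u1 u2 u3 = 0"
      using kernel_eq_0[of t u1 n u2 u3] kernel_eq_0[of t u2 n u1 u3] kernel_eq_0[of t u3 n u1 u2]
        kernel_swap(1)[of n t u1 u2 u3] kernel_swap(2)[of n t u1 u2 u3] kernel_swap(1)[of n t u1 u3 u2] by auto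
    moreover have "\<not> (a \<le> 1 - b - c - u1 \<and> b \<le> 1 - a - c - u2 \<and> c \<le> 1 - a - b - u3)"
      using False by (auto simp: t_def)
    ultimately show ?thesis
      unfolding joint_density_def t_def by (simp only: prod.case if_False)
  next
    case True
    let ?y1 = "1 - b - c - u1" and ?y2 = "1 - a - c - u2" and ?y3 = "1 - a - b - u3"
    have le: "a \<le> ?y1" "b \<le> ?y2" "c \<le> ?y3"
      using True by (auto simp: t_def)
    define e1 e2 e3 where e: "e1 = pp (t - pp u2 - pp u3)" "e2 = pp (t - pp u1 - pp u3)" "e3 = pp (t - pp u1 - pp u2)"
    have edges: "edge a b c ?y2 ?y3 = e1" "edge b a c ?y1 ?y3 = e2" "edge c a b ?y1 ?y2 = e3"
      using le by (simp_all add: edge_eq e t_def algebra_simps)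
    define B where "B = t\<^sup>2 - (pp u1)\<^sup>2 - (pp u2)\<^sup>2 - (pp u3)\<^sup>2"
    define A where "A = area2 a b c ?y1 ?y2 ?y3"
    have A: "A = (pp t)\<^sup>2 - (pp u1)\<^sup>2 - (pp u2)\<^sup>2 - (pp u3)\<^sup>2
        + (pp (u1 + u2 - t))\<^sup>2 + (pp (u1 + u3 - t))\<^sup>2 + (pp (u2 + u3 - t))\<^sup>2 - (pp (u1 + u2 + u3 - 2 * t))\<^sup>2"
      unfolding A_def area2_def t_def by (simp add: algebra_simps)
    have AB: "A = B" if "0 \<le> t" "u1 + u2 \<le> t" "u1 + u3 \<le> t" "u2 + u3 \<le> t"
    proof -
      have "u1 + u2 + u3 - 2 * t \<le> 0"
        using that True by linarith
      then show ?thesis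
        using that by (simp add: A B_def)
    qed
    have AB': "r * A ^ k = r * B ^ k" if "r \<noteq> 0 \<Longrightarrow> A = B" for r k
      using that by (cases "r = 0") auto
    \<comment> \<open>A nonzero factor in front of the power puts every pairwise sum of the
      \<open>u\<close> below \<open>t\<close>: from \<open>e1\<close> one gets
      \<open>pp u2 + pp u3 < t\<close>, and \<open>u1 < 0\<close> handles the other two sums. Then
      all mixed terms of \<open>A\<close> vanish.\<close>
    have k1: "of_bool (u1 < 0) * e1 * A ^ k = of_bool (u1 < 0) * e1 * B ^ k"
      and k2: "of_bool (u2 < 0) * e2 * A ^ k = of_bool (u2 < 0) * e2 * B ^ k"
      and k3: "of_bool (u3 < 0) * e3 * A ^ k = of_bool (u3 < 0) * e3 * B ^ k"
      and k: "e1 * e2 * e3 * A ^ k = e1 * e2 * e3 * B ^ k" for k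
      by (rule AB', rule AB; use True in \<open>auto simp: e pp_def max_def split: if_splits\<close>)+
    have "min_density n a b c ?y1 ?y2 ?y3 = 4 * real n * (real n - 1) *
        (of_bool (u1 < 0) * e1 * A ^ (n - 2) + of_bool (u2 < 0) * e2 * A ^ (n - 2) + of_bool (u3 < 0) * e3 * A ^ (n - 2))
        + 8 * falling3 n * (e1 * e2 * e3 * A ^ (n - 3))"
      unfolding min_density_def edges A_def[symmetric] by (simp add: algebra_simps)
    also have "\<dots> = kernel n t u1 u2 u3"
      unfolding k1 k2 k3 k unfolding kernel_def B_def[symmetric] e[symmetric] by (simp add: algebra_simps)
    finally show ?thesis
      using le by (simp add: joint_density_def t_def)
  qed
qed

text \<open>Any \<open>t\<close> and \<open>u\<close> arise from the minima
  \<open>(1 - t, 0, 0)\<close> with suitable bounds, so positivity of the density carries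
  over.\<close>

lemma kernel_nonneg:
  assumes "1 \<le> n"
  shows "0 \<le> kernel n t u1 u2 u3"
  using joint_density_nonneg[OF assms, of "(1 - t, 0, 0)" "(1 - u1, 1 - (1 - t) - u2, 1 - (1 - t) - u3)"]
    joint_density_eq_kernel[of n "1 - t" 0 0 u1 u2 u3] by simp

lemma pp_mult: "0 \<le> t \<Longrightarrow> pp (t * x) = t * pp x"
  by (auto simp: pp_def max_def mult_le_0_iff zero_le_mult_iff)

text \<open>The degree is \<open>2 (n - 2) + 1\<close> in the first summand and
  \<open>2 (n - 3) + 3\<close> in the second; for \<open>n = 2\<close> the latter is killed by
  \<open>falling3\<close>.\<close>

lemma kernel_scale:
  assumes "0 < t" "2 \<le> n"
  shows "kernel n t (t * x) (t * y) (t * z) = t ^ (2 * n - 3) * kernel n 1 x y z"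
proof -
  define B where "B = 1 - (pp x)\<^sup>2 - (pp y)\<^sup>2 - (pp z)\<^sup>2"
  have B: "t\<^sup>2 - (pp (t * x))\<^sup>2 - (pp (t * y))\<^sup>2 - (pp (t * z))\<^sup>2 = t\<^sup>2 * B"
    using assms by (simp add: pp_mult B_def power_mult_distrib algebra_simps)
  have e: "pp (t - pp (t * u) - pp (t * v)) = t * pp (1 - pp u - pp v)" for u v
    using assms pp_mult[of t "1 - pp u - pp v"] by (simp add: pp_mult algebra_simps)
  have s: "t * u < 0 \<longleftrightarrow> u < 0" for u
    using assms by (simp add: mult_less_0_iff)
  obtain k where k: "n = Suc (Suc k)"
    using assms by (metis Suc_le_D numeral_2_eq_2 Suc_le_mono)
  have p1: "(t\<^sup>2 * B) ^ (n - 2) * t = t ^ (2 * n - 3) * B ^ (n - 2)"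
    by (simp add: k power_mult_distrib flip: power_mult)
  have p2: "falling3 n * t ^ 3 * (t\<^sup>2 * B) ^ (n - 3) = falling3 n * t ^ (2 * n - 3) * B ^ (n - 3)"
  proof (cases k)
    case 0
    then show ?thesis by (simp add: k falling3_def)
  next
    case (Suc j)
    then show ?thesis
      by (simp add: k power_mult_distrib eval_nat_numeral power_add flip: power_mult)
  qed
  have "kernel n t (t * x) (t * y) (t * z) = 4 * real n * (real n - 1) * ((t\<^sup>2 * B) ^ (n - 2) * t) *
       (of_bool (x < 0) * pp (1 - pp y - pp z) + of_bool (y < 0) * pp (1 - pp x - pp z)
        + of_bool (z < 0) * pp (1 - pp x - pp y))
     + 8 * (falling3 n * t ^ 3 * (t\<^sup>2 * B) ^ (n - 3)) * (pp (1 - pp y - pp z) * pp (1 - pp x - pp z) * pp (1 - pp x - pp y))"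
    unfolding kernel_def B e s by (simp add: algebra_simps power3_eq_cube)
  also have "\<dots> = t ^ (2 * n - 3) * kernel n 1 x y z"
    unfolding p1 p2 kernel_def by (simp add: B_def algebra_simps)
  finally show ?thesis .
qed

lemma nn_integral_lborel_affine:
  fixes f :: "'a::euclidean_space \<Rightarrow> ennreal"
  assumes [measurable]: "f \<in> borel_measurable borel" and "c \<noteq> 0"
  shows "(\<integral>\<^sup>+x. f x \<partial>lborel) = ennreal (\<bar>c\<bar> ^ DIM('a)) * (\<integral>\<^sup>+x. f (r + c *\<^sub>R x) \<partial>lborel)"
  by (subst lborel_affine[OF assms(2), of r])
    (simp add: nn_integral_density nn_integral_distr nn_integral_cmult)

text \<open>The substitution has Jacobian \<open>t ^ 3\<close>, which together with the homogeneity
  \<open>t ^ (2 * n - 3)\<close> gives \<open>t ^ (2 * n)\<close>.\<close>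

lemma nn_integral_joint_density:
  fixes Q :: "real3 \<Rightarrow> ennreal"
  assumes n: "2 \<le> n" and t: "t = 1 - a - b - c" "0 < t" and Q [measurable]: "Q \<in> borel_measurable borel"
  shows "(\<integral>\<^sup>+y. ennreal (joint_density n (a, b, c) y) * Q y \<partial>lborel)
    = ennreal (t ^ (2 * n)) * (\<integral>\<^sup>+x. \<integral>\<^sup>+y. \<integral>\<^sup>+z. ennreal (kernel n 1 x y z) *
        Q (1 - b - c - t * x, 1 - a - c - t * y, 1 - a - b - t * z) \<partial>lborel \<partial>lborel \<partial>lborel)"
proof -
  have "(\<lambda>y. ((a, b, c), y)) \<in> borel_measurable borel"
    by (intro borel_measurable_continuous_onI continuous_intros)
  from measurable_compose[OF this measurable_joint_density]
  have [measurable]: "(\<lambda>y. joint_density n (a, b, c) y) \<in> borel_measurable borel"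
    by simp
  let ?f = "\<lambda>y. ennreal (joint_density n (a, b, c) y) * Q y"
  have f [measurable]: "?f \<in> borel_measurable borel"
    by measurable
  let ?r = "(1 - b - c, 1 - a - c, 1 - a - b)"
  have [measurable]: "(\<lambda>p. ?f (?r + (- t) *\<^sub>R p)) \<in> borel_measurable borel"
    by (rule measurable_compose[OF _ f]) (intro borel_measurable_continuous_onI continuous_intros)
  have [measurable]: "(\<lambda>(x, y, z). Q (1 - b - c - t * x, 1 - a - c - t * y, 1 - a - b - t * z)) \<in> borel_measurable borel"
    unfolding case_prod_unfold
    by (rule measurable_compose[OF _ Q]) (intro borel_measurable_continuous_onI continuous_intros)
  have "(\<integral>\<^sup>+y. ?f y \<partial>lborel) = ennreal (t ^ 3) * (\<integral>\<^sup>+p. ?f (?r + (- t) *\<^sub>R p) \<partial>lborel)"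
    using nn_integral_lborel_affine[OF f, of "- t" ?r] t(2) by (simp add: power3_eq_cube mult.assoc)
  also have "(\<integral>\<^sup>+p. ?f (?r + (- t) *\<^sub>R p) \<partial>lborel)
      = (\<integral>\<^sup>+p. ennreal (t ^ (2 * n - 3)) * (case p of (x, y, z) \<Rightarrow> ennreal (kernel n 1 x y z) *
        Q (1 - b - c - t * x, 1 - a - c - t * y, 1 - a - b - t * z)) \<partial>lborel)"
  proof (rule nn_integral_cong)
    fix p :: "real3"
    obtain x y z where p: "p = (x, y, z)"
      by (metis prod_cases3)
    show "?f (?r + (- t) *\<^sub>R p) = ennreal (t ^ (2 * n - 3)) * (case p of (x, y, z) \<Rightarrow> ennreal (kernel n 1 x y z) *
        Q (1 - b - c - t * x, 1 - a - c - t * y, 1 - a - b - t * z))"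
      using joint_density_eq_kernel[of n a b c "t * x" "t * y" "t * z", folded t(1)] kernel_scale[OF t(2) n, of x y z] t(2) n
      by (simp add: p ennreal_mult kernel_nonneg mult.assoc)
  qed
  also have "\<dots> = ennreal (t ^ (2 * n - 3)) * (\<integral>\<^sup>+p. (case p of (x, y, z) \<Rightarrow> ennreal (kernel n 1 x y z) *
        Q (1 - b - c - t * x, 1 - a - c - t * y, 1 - a - b - t * z)) \<partial>lborel)"
    by (rule nn_integral_cmult) (simp add: case_prod_unfold)
  also have "(\<integral>\<^sup>+p. (case p of (x, y, z) \<Rightarrow> ennreal (kernel n 1 x y z) *
        Q (1 - b - c - t * x, 1 - a - c - t * y, 1 - a - b - t * z)) \<partial>lborel)
      = (\<integral>\<^sup>+x. \<integral>\<^sup>+y. \<integral>\<^sup>+z. ennreal (kernel n 1 x y z) *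
        Q (1 - b - c - t * x, 1 - a - c - t * y, 1 - a - b - t * z) \<partial>lborel \<partial>lborel \<partial>lborel)"
    by (subst nn_integral_lborel_triple) (simp_all add: case_prod_unfold)
  also have "ennreal (t ^ 3) * (ennreal (t ^ (2 * n - 3)) * X) = ennreal (t ^ (2 * n)) * X" for X
  proof -
    have "t ^ (2 * n) = t ^ 3 * t ^ (2 * n - 3)"
      using n by (simp flip: power_add)
    then show ?thesis
      using t by (simp add: ennreal_mult mult.assoc)
  qed
  finally show ?thesis .
qed

section \<open>Splitting by signs\<close>

lemma nn_integral_sign_split:
  fixes f :: "real \<Rightarrow> ennreal"
  assumes [measurable]: "f \<in> borel_measurable borel" and "\<And>x. x < 0 \<Longrightarrow> f x = f (- 1)" "0 \<le> b"
  shows "(\<integral>\<^sup>+x. f x * indicator {- b..} x \<partial>lborel) = ennreal b * f (- 1) + (\<integral>\<^sup>+x. f x * indicator {0..} x \<partial>lborel)"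
proof -
  have "(\<integral>\<^sup>+x. f x * indicator {- b..} x \<partial>lborel)
      = (\<integral>\<^sup>+x. f (- 1) * indicator {- b..<0} x + f x * indicator {0..} x \<partial>lborel)"
  proof (rule nn_integral_cong)
    fix x
    show "f x * indicator {- b..} x = f (- 1) * indicator {- b..<0} x + f x * indicator {0..} x"
      using assms(2)[of x] assms(3) by (auto simp: indicator_def)
  qed
  also have "\<dots> = ennreal b * f (- 1) + (\<integral>\<^sup>+x. f x * indicator {0..} x \<partial>lborel)"
    using assms(3) by (simp add: nn_integral_add nn_integral_cmult mult.commute)
  finally show ?thesis .
qed

text \<open>Each negative coordinate integrates to the length of its interval. By symmetry of
  \<open>g\<close>, octants with equally many negative coordinates share one integral, whose
  coefficient is an elementary symmetric polynomial of the lengths.\<close>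

lemma nn_integral_orthant_split:
  fixes g :: "real \<Rightarrow> real \<Rightarrow> real \<Rightarrow> ennreal"
  assumes meas: "(\<lambda>(x, y, z). g x y z) \<in> borel_measurable borel"
    and sign: "\<And>x y z. x < 0 \<Longrightarrow> g x y z = g (- 1) y z"
    and sym: "\<And>x y z. g x y z = g y x z" "\<And>x y z. g x y z = g x z y"
    and b: "0 \<le> b1" "0 \<le> b2" "0 \<le> b3"
  shows "(\<integral>\<^sup>+x. \<integral>\<^sup>+y. \<integral>\<^sup>+z. g x y z * indicator {- b1..} x * indicator {- b2..} y * indicator {- b3..} z \<partial>lborel \<partial>lborel \<partial>lborel)
    = (\<integral>\<^sup>+x. \<integral>\<^sup>+y. \<integral>\<^sup>+z. g x y z * indicator {0..} x * indicator {0..} y * indicator {0..} z \<partial>lborel \<partial>lborel \<partial>lborel)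
      + ennreal (b1 + b2 + b3) * (\<integral>\<^sup>+y. \<integral>\<^sup>+z. g (- 1) y z * indicator {0..} y * indicator {0..} z \<partial>lborel \<partial>lborel)
      + ennreal (b1 * b2 + b1 * b3 + b2 * b3) * (\<integral>\<^sup>+z. g (- 1) (- 1) z * indicator {0..} z \<partial>lborel)
      + ennreal (b1 * b2 * b3) * g (- 1) (- 1) (- 1)"
proof -
  have [measurable (raw)]: "(\<lambda>w. g (f1 w) (f2 w) (f3 w)) \<in> borel_measurable M"
    if "f1 \<in> borel_measurable M" "f2 \<in> borel_measurable M" "f3 \<in> borel_measurable M"
    for M :: "'z measure" and f1 f2 f3 :: "'z \<Rightarrow> real"
  proof -
    have "(\<lambda>w. (f1 w, f2 w, f3 w)) \<in> borel_measurable M"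
      using that by (intro borel_measurable_Pair)
    from measurable_compose[OF this meas] show ?thesis
      by simp
  qed
  have s2: "g x y z = g x (- 1) z" if "y < 0" for x y z
    using sign[OF that] sym(1) by metis
  have s3: "g x y z = g x y (- 1)" if "z < 0" for x y z
    using s2[OF that] sym(2) by metis
  define Z where "Z x y = (\<integral>\<^sup>+z. g x y z * indicator {0..} z \<partial>lborel)" for x y
  define Y where "Y x = (\<integral>\<^sup>+y. Z x y * indicator {0..} y \<partial>lborel)" for x
  have Zs: "Z x y = Z (- 1) y" if "x < 0" for x y
    unfolding Z_def using sign[OF that] by simp
  have Zs2: "Z x y = Z x (- 1)" if "y < 0" for x y
    unfolding Z_def using s2[OF that] by simp
  have Ys: "Y x = Y (- 1)" if "x < 0" for x
    unfolding Y_def using Zs[OF that] by simp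
  have [measurable (raw)]: "(\<lambda>w. Z (f1 w) (f2 w)) \<in> borel_measurable M"
    if [measurable]: "f1 \<in> borel_measurable M" "f2 \<in> borel_measurable M"
    for M :: "'z measure" and f1 f2 :: "'z \<Rightarrow> real"
    unfolding Z_def by measurable
  have [measurable (raw)]: "(\<lambda>w. Y (f1 w)) \<in> borel_measurable M"
    if [measurable]: "f1 \<in> borel_measurable M" for M :: "'z measure" and f1 :: "'z \<Rightarrow> real"
    unfolding Y_def by measurable
  have 3: "(\<integral>\<^sup>+z. g x y z * indicator {- b3..} z \<partial>lborel) = ennreal b3 * g x y (- 1) + Z x y" for x y
    unfolding Z_def
  proof (rule nn_integral_sign_split)
    show "g x y z = g x y (- 1)" if "z < 0" for z
      by (rule s3[OF that])
  qed (measurable, fact b)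
  have c2: "(\<integral>\<^sup>+y. g x y (- 1) * indicator {0..} y \<partial>lborel) = Z x (- 1)" for x
    unfolding Z_def using sym(2) by simp
  have 2: "(\<integral>\<^sup>+y. (ennreal b3 * g x y (- 1) + Z x y) * indicator {- b2..} y \<partial>lborel)
    = ennreal b2 * (ennreal b3 * g x (- 1) (- 1) + Z x (- 1)) + (ennreal b3 * Z x (- 1) + Y x)" for x
  proof -
    have "(\<integral>\<^sup>+y. (ennreal b3 * g x y (- 1) + Z x y) * indicator {- b2..} y \<partial>lborel)
      = ennreal b2 * (ennreal b3 * g x (- 1) (- 1) + Z x (- 1))
        + (\<integral>\<^sup>+y. (ennreal b3 * g x y (- 1) + Z x y) * indicator {0..} y \<partial>lborel)"
      using b by (intro nn_integral_sign_split) (measurable, metis s2 Zs2)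
    also have "(\<integral>\<^sup>+y. (ennreal b3 * g x y (- 1) + Z x y) * indicator {0..} y \<partial>lborel)
       = (\<integral>\<^sup>+y. ennreal b3 * (g x y (- 1) * indicator {0..} y) + Z x y * indicator {0..} y \<partial>lborel)"
      by (simp add: distrib_right mult.assoc)
    also have "\<dots> = ennreal b3 * Z x (- 1) + Y x"
      by (simp add: nn_integral_add nn_integral_cmult c2 Y_def)
    finally show ?thesis .
  qed
  have e: "g x (- 1) (- 1) = g (- 1) (- 1) x" for x
    using sym(1)[of x "- 1" "- 1"] sym(2)[of "- 1" x "- 1"] by (rule trans)
  have c1: "(\<integral>\<^sup>+x. g x (- 1) (- 1) * indicator {0..} x \<partial>lborel) = Z (- 1) (- 1)"
    unfolding Z_def by (rule nn_integral_cong, subst e) (rule refl)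
  have Zsym: "Z x (- 1) = Z (- 1) x" for x
    unfolding Z_def by (rule nn_integral_cong, subst sym(1)) (rule refl)
  have c1': "(\<integral>\<^sup>+x. Z x (- 1) * indicator {0..} x \<partial>lborel) = Y (- 1)"
    unfolding Y_def by (rule nn_integral_cong, subst Zsym) (rule refl)
  let ?R = "\<lambda>x. ennreal b2 * (ennreal b3 * g x (- 1) (- 1) + Z x (- 1)) + (ennreal b3 * Z x (- 1) + Y x)"
  have 1: "(\<integral>\<^sup>+x. ?R x * indicator {- b1..} x \<partial>lborel)
    = ennreal b1 * ?R (- 1) + (ennreal b2 * (ennreal b3 * Z (- 1) (- 1) + Y (- 1)) + (ennreal b3 * Y (- 1) + (\<integral>\<^sup>+x. Y x * indicator {0..} x \<partial>lborel)))"
  proof -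
    have "(\<integral>\<^sup>+x. ?R x * indicator {- b1..} x \<partial>lborel) = ennreal b1 * ?R (- 1) + (\<integral>\<^sup>+x. ?R x * indicator {0..} x \<partial>lborel)"
      using b by (intro nn_integral_sign_split) (measurable, metis sign Zs Ys)
    also have "(\<integral>\<^sup>+x. ?R x * indicator {0..} x \<partial>lborel)
      = (\<integral>\<^sup>+x. ennreal b2 * (ennreal b3 * (g x (- 1) (- 1) * indicator {0..} x) + Z x (- 1) * indicator {0..} x)
         + (ennreal b3 * (Z x (- 1) * indicator {0..} x) + Y x * indicator {0..} x) \<partial>lborel)"
      by (simp add: distrib_right distrib_left mult.assoc)
    also have "\<dots> = ennreal b2 * (ennreal b3 * Z (- 1) (- 1) + Y (- 1)) + (ennreal b3 * Y (- 1) + (\<integral>\<^sup>+x. Y x * indicator {0..} x \<partial>lborel))"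
      by (simp add: nn_integral_add nn_integral_cmult c1 c1')
    finally show ?thesis .
  qed
  have z: "(\<integral>\<^sup>+z. g x y z * indicator {- b1..} x * indicator {- b2..} y * indicator {- b3..} z \<partial>lborel)
      = (ennreal b3 * g x y (- 1) + Z x y) * indicator {- b2..} y * indicator {- b1..} x" for x y
    by (cases "x \<in> {- b1..}"; cases "y \<in> {- b2..}") (simp_all add: 3)
  have y: "(\<integral>\<^sup>+y. (ennreal b3 * g x y (- 1) + Z x y) * indicator {- b2..} y * indicator {- b1..} x \<partial>lborel)
      = ?R x * indicator {- b1..} x" for x
    by (cases "x \<in> {- b1..}") (simp_all add: 2)
  have "(\<integral>\<^sup>+x. ?R x * indicator {- b1..} x \<partial>lborel) = (\<integral>\<^sup>+x. Y x * indicator {0..} x \<partial>lborel) + ennreal (b1 + b2 + b3) * Y (- 1)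
      + ennreal (b1 * b2 + b1 * b3 + b2 * b3) * Z (- 1) (- 1) + ennreal (b1 * b2 * b3) * g (- 1) (- 1) (- 1)"
    unfolding 1 using b by (simp add: ennreal_plus ennreal_mult algebra_simps)
  moreover have "(\<integral>\<^sup>+z. g x y z * indicator {0..} x * indicator {0..} y * indicator {0..} z \<partial>lborel)
      = Z x y * indicator {0..} y * indicator {0..} x" for x y
    by (cases "x \<in> {0..}"; cases "y \<in> {0..}") (simp_all add: Z_def)
  moreover have "(\<integral>\<^sup>+y. Z x y * indicator {0..} y * indicator {0..} x \<partial>lborel) = Y x * indicator {0..} x" for x
    by (cases "x \<in> {0..}") (simp_all add: Y_def)
  moreover have "(\<integral>\<^sup>+z. g (- 1) y z * indicator {0..} y * indicator {0..} z \<partial>lborel) = Z (- 1) y * indicator {0..} y" for y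
    by (cases "y \<in> {0..}") (simp_all add: Z_def)
  ultimately show ?thesis
    unfolding z y by (simp add: Y_def Z_def)
qed

text \<open>Besides \<open>pp (1 - pp y - pp z)\<close>, only the terms with \<open>y < 0\<close> or
  \<open>z < 0\<close> could survive. If \<open>y < 0\<close>, then \<open>1 < pp z\<close>, so the
  edge next to that indicator is 0 as well.\<close>

lemma kernel_eq_0_of_neg:
  assumes "x < 0" "1 < pp y + pp z"
  shows "kernel n 1 x y z = 0"
proof -
  have 0: "pp (1 - pp y - pp z) = 0" "of_bool (y < 0) * pp (1 - pp x - pp z) = (0 :: real)"
      "of_bool (z < 0) * pp (1 - pp x - pp y) = (0 :: real)"
    using assms by (auto simp: pp_def)
  show ?thesis
    unfolding kernel_def 0 by simp
qed

lemma kernel_eq_0_of_neg':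
  assumes "x < 0 \<or> y < 0 \<or> z < 0" "1 < pp x + pp y + pp z"
  shows "kernel n 1 x y z = 0"
proof -
  consider "x < 0" | "y < 0" | "z < 0"
    using assms by blast
  then show ?thesis
  proof cases
    case 1
    then show ?thesis
      using assms by (intro kernel_eq_0_of_neg) auto
  next
    case 2
    then have "kernel n 1 y x z = 0"
      using assms by (intro kernel_eq_0_of_neg) auto
    then show ?thesis
      by (simp add: kernel_swap(1)[of n 1 x y z])
  next
    case 3
    then have "kernel n 1 z x y = 0"
      using assms by (intro kernel_eq_0_of_neg) auto
    then show ?thesis
      by (metis kernel_swap)
  qed
qed

lemma le_pp_sum: "x + y + z \<le> pp x + pp y + pp z"
  by (simp add: pp_def)

text \<open>Imposing the cut on positive parts makes the function depend on negative coordinates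
  through their signs alone, as the splitting by signs demands.\<close>

definition hull_kernel :: "nat \<Rightarrow> real \<Rightarrow> real \<Rightarrow> real \<Rightarrow> ennreal" where
  "hull_kernel n x y z = ennreal (kernel n 1 x y z) * indicator {..1} (pp x + pp y + pp z)"

text \<open>The two cuts differ only where some coordinate is negative and the positive parts exceed
  1 in sum, and there the kernel is 0.\<close>

lemma kernel_indicator_hull:
  "ennreal (kernel n 1 x y z) * indicator {..1} (x + y + z) = hull_kernel n x y z"
proof (cases "pp x + pp y + pp z \<le> 1")
  case True
  then show ?thesis
    using le_pp_sum[of x y z] by (auto simp: hull_kernel_def)
next
  case False
  show ?thesis
  proof (cases "x < 0 \<or> y < 0 \<or> z < 0")
    case True
    then show ?thesis
      using kernel_eq_0_of_neg'[of x y z n] False by (simp add: hull_kernel_def)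
  next
    case False
    then show ?thesis
      by (simp add: hull_kernel_def)
  qed
qed

definition gap_kernel :: "nat \<Rightarrow> real \<Rightarrow> real \<Rightarrow> real \<Rightarrow> ennreal" where
  "gap_kernel n x y z = ennreal (kernel n 1 x y z) * indicator {1<..} (x + y + z)
     * indicator {0..} x * indicator {0..} y * indicator {0..} z"

text \<open>Beyond the cut the kernel is 0 unless all coordinates are nonnegative, so lower limits
  \<open>b1\<close>, \<open>b2\<close>, \<open>b3\<close> that are at most 0 can be replaced by 0.
  This makes the gap integral independent of the minima up to a power of \<open>t\<close>.\<close>

lemma kernel_indicator_gap:
  assumes "b1 \<le> 0" "b2 \<le> 0" "b3 \<le> 0"
  shows "ennreal (kernel n 1 x y z) * indicator {1<..} (x + y + z)
     * indicator {b1..} x * indicator {b2..} y * indicator {b3..} z = gap_kernel n x y z"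
proof (cases "(x < 0 \<or> y < 0 \<or> z < 0) \<and> 1 < x + y + z")
  case True
  then have "kernel n 1 x y z = 0"
    using le_pp_sum[of x y z] by (intro kernel_eq_0_of_neg') auto
  then show ?thesis
    by (simp add: gap_kernel_def)
next
  case False
  then show ?thesis
    using assms by (auto simp: gap_kernel_def indicator_def)
qed

definition std_simplex :: "real3 set" where
  "std_simplex = {(a, b, c). 0 \<le> a \<and> 0 \<le> b \<and> 0 \<le> c \<and> a + b + c \<le> 1}"

lemma std_simplex_borel [measurable]: "std_simplex \<in> sets borel"
proof -
  have "closed std_simplex"
    unfolding std_simplex_def case_prod_unfold by (intro closed_Collect_conj closed_Collect_le continuous_intros)
  then show ?thesis
    by simp
qed

lemma nn_integral_joint_density_outside:
  assumes "\<not> 0 < 1 - a - b - c"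
  shows "(\<integral>\<^sup>+y. ennreal (joint_density n (a, b, c) y) * Q y \<partial>lborel) = 0"
proof -
  have "joint_density n (a, b, c) y = 0" for y
  proof -
    obtain a' b' c' where y: "y = (a', b', c')"
      by (metis prod_cases3)
    show ?thesis
      using joint_density_eq_kernel[of n a b c "1 - b - c - a'" "1 - a - c - b'" "1 - a - b - c'"] assms
      by (simp add: y kernel_nonpos)
  qed
  then show ?thesis
    by simp
qed

text \<open>In the scaled variables the minima and bounds together sum to
  \<open>2 + t - t * (x + y + z)\<close>, so the cut becomes \<open>x + y + z \<le> 1\<close>; each
  \<open>y\<^sub>i \<le> 1\<close> becomes a lower limit.\<close>

lemma in_hull_range_iff:
  assumes "t = 1 - a - b - c" "0 < t" "0 \<le> a" "0 \<le> b" "0 \<le> c"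
  shows "((a, b, c), (1 - b - c - t * x, 1 - a - c - t * y, 1 - a - b - t * z)) \<in> hull_range \<longleftrightarrow>
     - ((b + c) / t) \<le> x \<and> - ((a + c) / t) \<le> y \<and> - ((a + b) / t) \<le> z \<and> x + y + z \<le> 1"
    and "((a, b, c), (1 - b - c - t * x, 1 - a - c - t * y, 1 - a - b - t * z)) \<in> relax_range \<longleftrightarrow>
     - ((b + c) / t) \<le> x \<and> - ((a + c) / t) \<le> y \<and> - ((a + b) / t) \<le> z"
proof -
  have i: "1 - p - q - t * w \<le> 1 \<longleftrightarrow> - ((p + q) / t) \<le> w" for p q w
    using assms(2) by (simp add: field_simps) linarith
  have "(a + b + c) + ((1 - b - c - t * x) + (1 - a - c - t * y) + (1 - a - b - t * z)) = 2 + t - t * (x + y + z)"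
    using assms(1) by (simp add: algebra_simps)
  then have "2 \<le> (a + b + c) + ((1 - b - c - t * x) + (1 - a - c - t * y) + (1 - a - b - t * z)) \<longleftrightarrow> t * (x + y + z) \<le> t * 1"
    by simp
  then have s: "2 \<le> (a + b + c) + ((1 - b - c - t * x) + (1 - a - c - t * y) + (1 - a - b - t * z)) \<longleftrightarrow> x + y + z \<le> 1"
    using assms(2) by simp
  show "((a, b, c), (1 - b - c - t * x, 1 - a - c - t * y, 1 - a - b - t * z)) \<in> relax_range \<longleftrightarrow>
     - ((b + c) / t) \<le> x \<and> - ((a + c) / t) \<le> y \<and> - ((a + b) / t) \<le> z"
    unfolding relax_range_def using assms(3-5) i[of b c x] i[of a c y] i[of a b z] by simp
  show "((a, b, c), (1 - b - c - t * x, 1 - a - c - t * y, 1 - a - b - t * z)) \<in> hull_range \<longleftrightarrow>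
     - ((b + c) / t) \<le> x \<and> - ((a + c) / t) \<le> y \<and> - ((a + b) / t) \<le> z \<and> x + y + z \<le> 1"
    unfolding hull_range_def using assms(3-5) i[of b c x] i[of a c y] i[of a b z] s by simp
qed

lemma not_in_relax_range: "\<not> (0 \<le> a \<and> 0 \<le> b \<and> 0 \<le> c) \<Longrightarrow> ((a, b, c), y) \<notin> relax_range"
  by (auto simp: relax_range_def)

text \<open>The digit counts negative coordinates. \<open>C0\<close>, \<open>C1\<close>,
  \<open>C2\<close> and the value at three negative coordinates are the four integrals left by the
  splitting.\<close>

definition C0 :: "nat \<Rightarrow> ennreal" where
  "C0 n = (\<integral>\<^sup>+x. \<integral>\<^sup>+y. \<integral>\<^sup>+z. hull_kernel n x y z * indicator {0..} x * indicator {0..} y * indicator {0..} z \<partial>lborel \<partial>lborel \<partial>lborel)"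

definition C1 :: "nat \<Rightarrow> ennreal" where
  "C1 n = (\<integral>\<^sup>+y. \<integral>\<^sup>+z. hull_kernel n (- 1) y z * indicator {0..} y * indicator {0..} z \<partial>lborel \<partial>lborel)"

definition C2 :: "nat \<Rightarrow> ennreal" where
  "C2 n = (\<integral>\<^sup>+z. hull_kernel n (- 1) (- 1) z * indicator {0..} z \<partial>lborel)"

definition Cgap :: "nat \<Rightarrow> ennreal" where
  "Cgap n = (\<integral>\<^sup>+x. \<integral>\<^sup>+y. \<integral>\<^sup>+z. gap_kernel n x y z \<partial>lborel \<partial>lborel \<partial>lborel)"

lemma nn_integral_hull_kernel:
  assumes b: "0 \<le> b1" "0 \<le> b2" "0 \<le> b3"
  shows "(\<integral>\<^sup>+x. \<integral>\<^sup>+y. \<integral>\<^sup>+z. hull_kernel n x y z * indicator {- b1..} x * indicator {- b2..} y * indicator {- b3..} z \<partial>lborel \<partial>lborel \<partial>lborel)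
    = C0 n + ennreal (b1 + b2 + b3) * C1 n + ennreal (b1 * b2 + b1 * b3 + b2 * b3) * C2 n
      + ennreal (b1 * b2 * b3) * hull_kernel n (- 1) (- 1) (- 1)"
  unfolding C0_def C1_def C2_def
proof (rule nn_integral_orthant_split)
  show "(\<lambda>(x, y, z). hull_kernel n x y z) \<in> borel_measurable borel"
    unfolding hull_kernel_def case_prod_unfold by measurable
  show "hull_kernel n x y z = hull_kernel n (- 1) y z" if "x < 0" for x y z
    using that kernel_sign[OF that, of n 1 y z] by (simp add: hull_kernel_def)
  show "hull_kernel n x y z = hull_kernel n y x z" for x y z
    unfolding hull_kernel_def kernel_swap(1)[of n 1 x y z] by (simp add: add.commute)
  show "hull_kernel n x y z = hull_kernel n x z y" for x y z
    unfolding hull_kernel_def kernel_swap(2)[of n 1 x y z] by (simp add: ac_simps)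
qed fact+

text \<open>The polynomials in \<open>a\<close>, \<open>b\<close>, \<open>c\<close> are the
  elementary symmetric polynomials of \<open>b + c\<close>, \<open>a + c\<close>,
  \<open>a + b\<close>; each negative coordinate costs one power of \<open>t\<close> because the
  interval lengths are these sums divided by \<open>t\<close>.\<close>

lemma nn_integral_joint_hull:
  assumes n: "2 \<le> n"
  shows "(\<integral>\<^sup>+y. ennreal (joint_density n (a, b, c) y) * indicator hull_range ((a, b, c), y) \<partial>lborel)
    = (ennreal ((1 - a - b - c) ^ (2 * n)) * C0 n
      + ennreal (2 * (a + b + c) * (1 - a - b - c) ^ (2 * n - 1)) * C1 n
      + ennreal ((a\<^sup>2 + b\<^sup>2 + c\<^sup>2 + 3 * (a * b + a * c + b * c)) * (1 - a - b - c) ^ (2 * n - 2)) * C2 n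
      + ennreal ((b + c) * (a + c) * (a + b) * (1 - a - b - c) ^ (2 * n - 3)) * hull_kernel n (- 1) (- 1) (- 1))
     * indicator std_simplex (a, b, c)" (is "?L = ?R")
proof (cases "0 \<le> a \<and> 0 \<le> b \<and> 0 \<le> c")
  case False
  then have "((a, b, c), y) \<notin> hull_range" for y
    using not_in_relax_range hull_range_subset by blast
  moreover have "(a, b, c) \<notin> std_simplex"
    using False by (auto simp: std_simplex_def)
  ultimately show ?thesis
    by simp
next
  case abc: True
  define t where "t = 1 - a - b - c"
  show ?thesis
  proof (cases "0 < t")
    case False
    \<comment> \<open>On the face \<open>t = 0\<close> all four powers vanish, since even the
      smallest exponent \<open>2 * n - 3\<close> is positive.\<close>
    have "?R = 0"
    proof (cases "(a, b, c) \<in> std_simplex")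
      case True
      then have e: "1 - a - b - c = 0"
        using False by (simp add: std_simplex_def t_def)
      show ?thesis
        unfolding e using n by (simp add: power_0_left)
    qed simp
    then show ?thesis
      using False nn_integral_joint_density_outside[of a b c n] by (simp add: t_def)
  next
    case True
    define b1 b2 b3 where b: "b1 = (b + c) / t" "b2 = (a + c) / t" "b3 = (a + b) / t"
    have b0: "0 \<le> b1" "0 \<le> b2" "0 \<le> b3"
      using True abc by (auto simp: b)
    have "(\<lambda>y. ((a, b, c), y)) \<in> borel_measurable borel"
      by (intro borel_measurable_continuous_onI continuous_intros)
    moreover have "hull_range \<in> sets borel"
      using closed_hull_range by simp
    ultimately have m: "(\<lambda>y. indicator hull_range ((a, b, c), y) :: ennreal) \<in> borel_measurable borel"
      by (rule measurable_compose[OF _ borel_measurable_indicator])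
    have ind: "ennreal (kernel n 1 x y z) *
        indicator hull_range ((a, b, c), (1 - b - c - t * x, 1 - a - c - t * y, 1 - a - b - t * z))
      = hull_kernel n x y z * indicator {- b1..} x * indicator {- b2..} y * indicator {- b3..} z" for x y z
      unfolding kernel_indicator_hull[symmetric]
      using in_hull_range_iff(1)[OF t_def True, of x y z] abc by (auto simp: b indicator_def)
    have "?L = ennreal (t ^ (2 * n)) * (C0 n + ennreal (b1 + b2 + b3) * C1 n + ennreal (b1 * b2 + b1 * b3 + b2 * b3) * C2 n
      + ennreal (b1 * b2 * b3) * hull_kernel n (- 1) (- 1) (- 1))"
      unfolding nn_integral_joint_density[OF n t_def True m] ind nn_integral_hull_kernel[OF b0] ..
    also have "\<dots> = ennreal (t ^ (2 * n)) * C0 n + ennreal (t ^ (2 * n) * (b1 + b2 + b3)) * C1 n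
      + ennreal (t ^ (2 * n) * (b1 * b2 + b1 * b3 + b2 * b3)) * C2 n
      + ennreal (t ^ (2 * n) * (b1 * b2 * b3)) * hull_kernel n (- 1) (- 1) (- 1)"
    proof -
      have "ennreal p * (A + ennreal q1 * B + ennreal q2 * C + ennreal q3 * D)
          = ennreal p * A + ennreal (p * q1) * B + ennreal (p * q2) * C + ennreal (p * q3) * D"
        if "0 \<le> p" "0 \<le> q1" "0 \<le> q2" "0 \<le> q3" for p q1 q2 q3 A B C D
        using that by (simp add: distrib_left ennreal_mult mult.assoc)
      from this[of "t ^ (2 * n)" "b1 + b2 + b3" "b1 * b2 + b1 * b3 + b2 * b3" "b1 * b2 * b3"] show ?thesis
        using True b0 by (simp del: ennreal_plus)
    qed
    also have "t ^ (2 * n) * (b1 + b2 + b3) = 2 * (a + b + c) * t ^ (2 * n - 1)"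
    proof -
      have "t ^ (2 * n) = t ^ (2 * n - 1) * t"
        using n by (simp flip: power_Suc2)
      then show ?thesis
        using True by (simp add: b add_divide_distrib[symmetric])
    qed
    also have "t ^ (2 * n) * (b1 * b2 + b1 * b3 + b2 * b3)
        = (a\<^sup>2 + b\<^sup>2 + c\<^sup>2 + 3 * (a * b + a * c + b * c)) * t ^ (2 * n - 2)"
    proof -
      have "t ^ (2 * n) = t ^ (2 * n - 2) * (t * t)"
      proof -
        have "2 * n - 2 + 2 = 2 * n"
          using n by linarith
        from power_add[of t "2 * n - 2" 2, unfolded this] show ?thesis
          by (simp only: power2_eq_square)
      qed
      moreover have "b1 * b2 + b1 * b3 + b2 * b3 = (a\<^sup>2 + b\<^sup>2 + c\<^sup>2 + 3 * (a * b + a * c + b * c)) / (t * t)"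
        by (simp add: b add_divide_distrib[symmetric]) (simp add: algebra_simps power2_eq_square)
      ultimately show ?thesis
        using True by simp
    qed
    also have "t ^ (2 * n) * (b1 * b2 * b3) = (b + c) * (a + c) * (a + b) * t ^ (2 * n - 3)"
    proof -
      have "t ^ (2 * n) = t ^ (2 * n - 3) * (t * t * t)"
      proof -
        have "2 * n - 3 + 3 = 2 * n"
          using n by linarith
        from power_add[of t "2 * n - 3" 3, unfolded this] show ?thesis
          by (simp only: power3_eq_cube)
      qed
      then show ?thesis
        using True by (simp add: b)
    qed
    finally show ?thesis
      using True abc by (simp add: std_simplex_def t_def)
  qed
qed

lemma nn_integral_joint_gap:
  assumes n: "2 \<le> n"
  shows "(\<integral>\<^sup>+y. ennreal (joint_density n (a, b, c) y) * indicator (relax_range - hull_range) ((a, b, c), y) \<partial>lborel)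
    = ennreal ((1 - a - b - c) ^ (2 * n)) * Cgap n * indicator std_simplex (a, b, c)" (is "?L = ?R")
proof (cases "0 \<le> a \<and> 0 \<le> b \<and> 0 \<le> c")
  case False
  then have "((a, b, c), y) \<notin> relax_range" for y
    using not_in_relax_range by blast
  moreover have "(a, b, c) \<notin> std_simplex"
    using False by (auto simp: std_simplex_def)
  ultimately show ?thesis
    by simp
next
  case abc: True
  define t where "t = 1 - a - b - c"
  show ?thesis
  proof (cases "0 < t")
    case False
    have "?R = 0"
    proof (cases "(a, b, c) \<in> std_simplex")
      case True
      then have e: "1 - a - b - c = 0"
        using False by (simp add: std_simplex_def t_def)
      show ?thesis
        unfolding e using n by (simp add: power_0_left)
    qed simp
    then show ?thesis
      using False nn_integral_joint_density_outside[of a b c n] by (simp add: t_def)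
  next
    case True
    define b1 b2 b3 where b: "b1 = - ((b + c) / t)" "b2 = - ((a + c) / t)" "b3 = - ((a + b) / t)"
    have b0: "b1 \<le> 0" "b2 \<le> 0" "b3 \<le> 0"
      using True abc by (auto simp: b)
    have "(\<lambda>y. ((a, b, c), y)) \<in> borel_measurable borel"
      by (intro borel_measurable_continuous_onI continuous_intros)
    moreover have "relax_range - hull_range \<in> sets borel"
      using closed_hull_range closed_relax_range by simp
    ultimately have m: "(\<lambda>y. indicator (relax_range - hull_range) ((a, b, c), y) :: ennreal) \<in> borel_measurable borel"
      by (rule measurable_compose[OF _ borel_measurable_indicator])
    have ind: "ennreal (kernel n 1 x y z) *
        indicator (relax_range - hull_range) ((a, b, c), (1 - b - c - t * x, 1 - a - c - t * y, 1 - a - b - t * z))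
      = gap_kernel n x y z" for x y z
      unfolding kernel_indicator_gap[OF b0, symmetric]
      using in_hull_range_iff[OF t_def True, of x y z] abc by (auto simp: b indicator_def)
    have "?L = ennreal (t ^ (2 * n)) * Cgap n"
      unfolding nn_integral_joint_density[OF n t_def True m] ind Cgap_def ..
    then show ?thesis
      using True abc by (simp add: std_simplex_def t_def)
  qed
qed

section \<open>Dirichlet integrals\<close>

text \<open>Integration by parts with \<open>x ^ Suc i * (s - x) ^ Suc N\<close>, which is 0 at both
  ends, lowers the first exponent and raises the second; hence \<open>N\<close> is arbitrary in the
  induction.\<close>

lemma has_integral_beta:
  assumes "0 \<le> s"
  shows "((\<lambda>x::real. x ^ i * (s - x) ^ N) has_integral fact i * fact N / fact (i + N + 1) * s ^ (i + N + 1)) {0..s}"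
proof (induction i arbitrary: N)
  case 0
  have "((\<lambda>x. (s - x) ^ N * real (Suc N)) has_integral (- ((s - s) ^ Suc N) - - ((s - 0) ^ Suc N))) {0..s}"
  proof (rule fundamental_theorem_of_calculus)
    fix x assume "x \<in> {0..s}"
    have "((\<lambda>x. - ((s - x) ^ Suc N)) has_real_derivative (s - x) ^ N * real (Suc N)) (at x within {0..s})"
      by (rule DERIV_cong, (rule derivative_intros)+) (simp add: algebra_simps)
    then show "((\<lambda>x. - ((s - x) ^ Suc N)) has_vector_derivative (s - x) ^ N * real (Suc N)) (at x within {0..s})"
      by (simp only: has_real_derivative_iff_has_vector_derivative)
  qed fact
  from has_integral_mult_right[OF this, of "1 / real (Suc N)"]
  have "((\<lambda>x. (s - x) ^ N) has_integral 1 / real (Suc N) * s ^ Suc N) {0..s}"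
    by (simp del: of_nat_Suc)
  moreover have "1 / real (Suc N) * s ^ Suc N = fact 0 * fact N / fact (0 + N + 1) * s ^ (0 + N + 1)"
    by (simp del: of_nat_Suc)
  ultimately show ?case
    by simp
next
  case (Suc i)
  have "((\<lambda>x. x ^ Suc i * (s - x) ^ N * real (Suc N) - real (Suc i) * (x ^ i * (s - x) ^ Suc N)) has_integral
      (- (s ^ Suc i * (s - s) ^ Suc N) - - (0 ^ Suc i * (s - 0) ^ Suc N))) {0..s}"
  proof (rule fundamental_theorem_of_calculus)
    fix x assume "x \<in> {0..s}"
    have "((\<lambda>x. - (x ^ Suc i * (s - x) ^ Suc N)) has_real_derivative
        x ^ Suc i * (s - x) ^ N * real (Suc N) - real (Suc i) * (x ^ i * (s - x) ^ Suc N)) (at x within {0..s})"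
      by (rule DERIV_cong, (rule derivative_intros)+) (simp add: algebra_simps)
    then show "((\<lambda>x. - (x ^ Suc i * (s - x) ^ Suc N)) has_vector_derivative
        x ^ Suc i * (s - x) ^ N * real (Suc N) - real (Suc i) * (x ^ i * (s - x) ^ Suc N)) (at x within {0..s})"
      by (simp only: has_real_derivative_iff_has_vector_derivative)
  qed fact
  from has_integral_add[OF this has_integral_mult_right[OF Suc.IH[of "Suc N"], of "real (Suc i)"]]
  have "((\<lambda>x. x ^ Suc i * (s - x) ^ N * real (Suc N)) has_integral
      real (Suc i) * (fact i * fact (Suc N) / fact (i + Suc N + 1) * s ^ (i + Suc N + 1))) {0..s}"
    by simp
  from has_integral_mult_right[OF this, of "1 / real (Suc N)"]
  have "((\<lambda>x. x ^ Suc i * (s - x) ^ N) has_integral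
      1 / real (Suc N) * (real (Suc i) * (fact i * fact (Suc N) / fact (i + Suc N + 1) * s ^ (i + Suc N + 1)))) {0..s}"
    by (simp del: of_nat_Suc)
  moreover have "1 / real (Suc N) * (real (Suc i) * (fact i * fact (Suc N) / fact (i + Suc N + 1) * s ^ (i + Suc N + 1)))
      = fact (Suc i) * fact N / fact (Suc i + N + 1) * s ^ (Suc i + N + 1)"
    by (simp add: fact_Suc del: of_nat_Suc)
  ultimately show ?case
    by (simp add: mult.assoc)
qed

lemma nn_integral_beta:
  fixes C :: real
  assumes "0 \<le> s" "0 \<le> C"
  shows "(\<integral>\<^sup>+x. ennreal (C * (x ^ i * (s - x) ^ N)) * indicator {0..s} x \<partial>lborel)
    = ennreal (C * (fact i * fact N / fact (i + N + 1) * s ^ (i + N + 1)))"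
proof -
  have "(\<integral>\<^sup>+x. ennreal (indicator {0..s} x * (C * (x ^ i * (s - x) ^ N))) \<partial>lborel)
      = ennreal (C * (fact i * fact N / fact (i + N + 1) * s ^ (i + N + 1)))"
    by (rule nn_integral_has_integral_lebesgue[OF _ has_integral_mult_right[OF has_integral_beta]]) (use assms in auto)
  moreover have "ennreal (C * (x ^ i * (s - x) ^ N)) * indicator {0..s} x = ennreal (indicator {0..s} x * (C * (x ^ i * (s - x) ^ N)))" for x
    by (simp add: indicator_def)
  ultimately show ?thesis
    by simp
qed

text \<open>Integrating out \<open>c\<close>, \<open>b\<close>, \<open>a\<close> in turn yields
  three beta integrals whose intermediate factorials telescope.\<close>

lemma nn_integral_dirichlet:
  "(\<integral>\<^sup>+m. (case m of (a, b, c) \<Rightarrow> ennreal (a ^ i * b ^ j * c ^ k * (1 - a - b - c) ^ N)) * indicator std_simplex m \<partial>lborel)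
    = ennreal (fact i * fact j * fact k * fact N / fact (i + j + k + N + 3))"
proof -
  define bt :: "nat \<Rightarrow> nat \<Rightarrow> real" where "bt p q = fact p * fact q / fact (p + q + 1)" for p q
  have bt0: "0 \<le> bt p q" for p q
    by (simp add: bt_def)
  have ind: "indicator std_simplex (a, b, c) = (indicator {0..1} a * indicator {0..1 - a} b * indicator {0..1 - a - b} c :: ennreal)" for a b c
    by (auto simp: std_simplex_def indicator_def)
  have z: "(\<integral>\<^sup>+c. ennreal (a ^ i * b ^ j * c ^ k * (1 - a - b - c) ^ N) * indicator std_simplex (a, b, c) \<partial>lborel)
     = ennreal ((a ^ i * bt k N) * (b ^ j * (1 - a - b) ^ (k + N + 1))) * indicator {0..1 - a} b * indicator {0..1} a" for a b
  proof (cases "a \<in> {0..1} \<and> b \<in> {0..1 - a}")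
    case True
    then have "(\<integral>\<^sup>+c. ennreal (a ^ i * b ^ j * c ^ k * (1 - a - b - c) ^ N) * indicator std_simplex (a, b, c) \<partial>lborel)
      = (\<integral>\<^sup>+c. ennreal ((a ^ i * b ^ j) * (c ^ k * (1 - a - b - c) ^ N)) * indicator {0..1 - a - b} c \<partial>lborel)"
      by (intro nn_integral_cong) (simp add: ind mult.assoc)
    also have "\<dots> = ennreal ((a ^ i * b ^ j) * (bt k N * (1 - a - b) ^ (k + N + 1)))"
      unfolding bt_def using True by (intro nn_integral_beta) auto
    finally show ?thesis
      using True by (simp add: ac_simps)
  qed (auto simp: ind)
  have y: "(\<integral>\<^sup>+b. ennreal ((a ^ i * bt k N) * (b ^ j * (1 - a - b) ^ (k + N + 1))) * indicator {0..1 - a} b * indicator {0..1} a \<partial>lborel)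
     = ennreal ((bt k N * bt j (k + N + 1)) * (a ^ i * (1 - a) ^ (j + (k + N + 1) + 1))) * indicator {0..1} a" for a
  proof (cases "a \<in> {0..1}")
    case True
    then have "(\<integral>\<^sup>+b. ennreal ((a ^ i * bt k N) * (b ^ j * (1 - a - b) ^ (k + N + 1))) * indicator {0..1 - a} b * indicator {0..1} a \<partial>lborel)
      = ennreal ((a ^ i * bt k N) * (bt j (k + N + 1) * (1 - a) ^ (j + (k + N + 1) + 1)))"
      unfolding bt_def[of j] using bt0 nn_integral_beta[of "1 - a" "a ^ i * bt k N" j "k + N + 1"] by simp
    then show ?thesis
      using True by (simp add: ac_simps)
  qed auto
  have x: "(\<integral>\<^sup>+a. ennreal ((bt k N * bt j (k + N + 1)) * (a ^ i * (1 - a) ^ (j + (k + N + 1) + 1))) * indicator {0..1} a \<partial>lborel)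
      = ennreal (bt k N * bt j (k + N + 1) * bt i (j + (k + N + 1) + 1))"
    unfolding bt_def[of i] using bt0 nn_integral_beta[of 1 "bt k N * bt j (k + N + 1)" i "j + (k + N + 1) + 1"] by simp
  have "(\<lambda>m. (case m of (a, b, c) \<Rightarrow> ennreal (a ^ i * b ^ j * c ^ k * (1 - a - b - c) ^ N)) * indicator std_simplex m) \<in> borel_measurable borel"
    unfolding case_prod_unfold by measurable
  then have "(\<integral>\<^sup>+m. (case m of (a, b, c) \<Rightarrow> ennreal (a ^ i * b ^ j * c ^ k * (1 - a - b - c) ^ N)) * indicator std_simplex m \<partial>lborel)
    = (\<integral>\<^sup>+a. \<integral>\<^sup>+b. \<integral>\<^sup>+c. ennreal (a ^ i * b ^ j * c ^ k * (1 - a - b - c) ^ N) * indicator std_simplex (a, b, c) \<partial>lborel \<partial>lborel \<partial>lborel)"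
    by (subst nn_integral_lborel_triple) simp_all
  also have "\<dots> = ennreal (bt k N * bt j (k + N + 1) * bt i (j + (k + N + 1) + 1))"
    unfolding z y x ..
  also have "bt k N * bt j (k + N + 1) * bt i (j + (k + N + 1) + 1) = fact i * fact j * fact k * fact N / fact (i + j + k + N + 3)"
  proof -
    have e: "j + (k + N + 1) + 1 = j + k + N + 2" "i + (j + k + N + 2) + 1 = i + j + k + N + 3"
      by simp_all
    have c: "(k' * N' / p) * (j' * p / q) * (i' * q / r) = i' * j' * k' * N' / r" if "p \<noteq> 0" "q \<noteq> 0" for k' N' p j' q i' r :: real
      using that by (simp add: field_simps)
    show ?thesis
      unfolding bt_def e by (rule c) simp_all
  qed
  finally show ?thesis .
qed

lemma nn_integral_dirichlet_sum:
  fixes w :: "nat \<times> nat \<times> nat \<Rightarrow> real"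
  assumes "finite L" "\<And>l. l \<in> L \<Longrightarrow> 0 \<le> w l"
    and p: "\<And>a b c. p (a, b, c) = (\<Sum>(i, j, k)\<in>L. w (i, j, k) * (a ^ i * b ^ j * c ^ k * (1 - a - b - c) ^ N))"
  shows "(\<integral>\<^sup>+m. ennreal (p m) * indicator std_simplex m \<partial>lborel)
    = ennreal (\<Sum>(i, j, k)\<in>L. w (i, j, k) * (fact i * fact j * fact k * fact N / fact (i + j + k + N + 3)))"
proof -
  define h where "h = (\<lambda>(i, j, k) (a, b, c). ennreal (a ^ i * b ^ j * c ^ k * (1 - a - b - c) ^ N))"
  have eq: "ennreal (p m) * indicator std_simplex m
     = (\<Sum>l\<in>L. ennreal (w l) * (h l m * indicator std_simplex m))" for m
  proof (cases "m \<in> std_simplex")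
    case True
    obtain a b c where m: "m = (a, b, c)"
      by (metis prod_cases3)
    have pos: "0 \<le> a" "0 \<le> b" "0 \<le> c" "0 \<le> 1 - a - b - c"
      using True by (auto simp: std_simplex_def m)
    have "ennreal (p m) = ennreal (\<Sum>l\<in>L. case l of (i, j, k) \<Rightarrow> w (i, j, k) * (a ^ i * b ^ j * c ^ k * (1 - a - b - c) ^ N))"
      by (simp add: m p)
    also have "\<dots> = (\<Sum>l\<in>L. ennreal (case l of (i, j, k) \<Rightarrow> w (i, j, k) * (a ^ i * b ^ j * c ^ k * (1 - a - b - c) ^ N)))"
      using assms(2) pos by (intro sum_ennreal[symmetric]) (auto intro!: mult_nonneg_nonneg)
    also have "\<dots> = (\<Sum>l\<in>L. ennreal (w l) * h l m)"
      using assms(2) pos by (intro sum.cong refl) (auto simp: m h_def ennreal_mult)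
    finally show ?thesis
      using True by simp
  qed simp
  have [measurable]: "(\<lambda>m. h l m) \<in> borel_measurable borel"
    for l :: "nat \<times> nat \<times> nat"
    unfolding h_def case_prod_unfold by measurable
  have D: "(\<integral>\<^sup>+m. h l m * indicator std_simplex m \<partial>lborel)
     = ennreal (case l of (i, j, k) \<Rightarrow> fact i * fact j * fact k * fact N / fact (i + j + k + N + 3))" for l :: "nat \<times> nat \<times> nat"
    by (cases l) (simp add: h_def nn_integral_dirichlet)
  have "(\<integral>\<^sup>+m. ennreal (p m) * indicator std_simplex m \<partial>lborel)
    = (\<Sum>l\<in>L. ennreal (w l) * ennreal (case l of (i, j, k) \<Rightarrow> fact i * fact j * fact k * fact N / fact (i + j + k + N + 3)))"
    unfolding eq by (subst nn_integral_sum) (simp_all add: nn_integral_cmult D)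
  also have "\<dots> = (\<Sum>l\<in>L. ennreal (case l of (i, j, k) \<Rightarrow> w (i, j, k) * (fact i * fact j * fact k * fact N / fact (i + j + k + N + 3))))"
    using assms(2) by (intro sum.cong refl) (auto simp: ennreal_mult[symmetric])
  also have "\<dots> = ennreal (\<Sum>(i, j, k)\<in>L. w (i, j, k) * (fact i * fact j * fact k * fact N / fact (i + j + k + N + 3)))"
    using assms(2) by (intro sum_ennreal) auto
  finally show ?thesis .
qed

text \<open>Monomials of equal degree share the denominator \<open>fact M\<close>, so a single
  constant \<open>W\<close> carries all coefficients.\<close>

lemma nn_integral_dirichlet_homogeneous:
  fixes w :: "nat \<times> nat \<times> nat \<Rightarrow> real"
  assumes L: "finite L" "\<And>l. l \<in> L \<Longrightarrow> 0 \<le> w l"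
    and p: "\<And>a b c. p (a, b, c) = (\<Sum>(i, j, k)\<in>L. w (i, j, k) * (a ^ i * b ^ j * c ^ k * (1 - a - b - c) ^ N))"
    and d: "\<And>i j k. (i, j, k) \<in> L \<Longrightarrow> i + j + k = d"
    and W: "(\<Sum>(i, j, k)\<in>L. w (i, j, k) * (fact i * fact j * fact k)) = W" and M: "d + N + 3 = M"
  shows "(\<integral>\<^sup>+m. ennreal (p m) * indicator std_simplex m \<partial>lborel) = ennreal (W * (fact N / fact M))"
proof -
  have "(\<Sum>(i, j, k)\<in>L. w (i, j, k) * (fact i * fact j * fact k * fact N / fact (i + j + k + N + 3)))
    = (\<Sum>(i, j, k)\<in>L. w (i, j, k) * (fact i * fact j * fact k) * (fact N / fact M))"
    using d M by (intro sum.cong refl) (clarsimp simp: mult.assoc)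
  also have "\<dots> = W * (fact N / fact M)"
    unfolding W[symmetric] sum_distrib_right by (intro sum.cong refl) (clarsimp)
  finally show ?thesis
    using nn_integral_dirichlet_sum[OF L p] by simp
qed

lemma fact_ratio:
  "(fact (2 * n) :: real) / fact (2 * n + 3) = 1 / ((2 * real n + 1) * (2 * real n + 2) * (2 * real n + 3))"
proof -
  have "(fact (2 * n + 3) :: real) = (2 * real n + 3) * ((2 * real n + 2) * ((2 * real n + 1) * fact (2 * n)))"
    by (simp add: eval_nat_numeral algebra_simps)
  then show ?thesis
    by simp
qed

lemma fact_pred: "1 \<le> m \<Longrightarrow> (fact m :: real) = real m * fact (m - 1)"
  by (cases m) auto

lemma nn_integral_simplex_0:
  "(\<integral>\<^sup>+m. ennreal (case m of (a, b, c) \<Rightarrow> (1 - a - b - c) ^ (2 * n)) * indicator std_simplex m \<partial>lborel)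
    = ennreal (1 / ((2 * real n + 1) * (2 * real n + 2) * (2 * real n + 3)))"
  unfolding fact_ratio[symmetric]
  using nn_integral_dirichlet_homogeneous[where L = "{(0, 0, 0)}" and w = "\<lambda>_. 1" and N = "2 * n" and d = 0
      and M = "2 * n + 3" and p = "\<lambda>(a, b, c). (1 - a - b - c) ^ (2 * n)", OF _ _ _ _ refl] by simp

text \<open>Three monomials of weight 2 give \<open>W = 6\<close>; dividing by the factor
  \<open>2 n\<close> of \<open>fact (2 * n)\<close> leaves 3 over \<open>n\<close>.\<close>

lemma nn_integral_simplex_1:
  assumes "1 \<le> n"
  shows "(\<integral>\<^sup>+m. ennreal (case m of (a, b, c) \<Rightarrow> 2 * (a + b + c) * (1 - a - b - c) ^ (2 * n - 1)) * indicator std_simplex m \<partial>lborel)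
    = ennreal (3 / (real n * ((2 * real n + 1) * (2 * real n + 2) * (2 * real n + 3))))"
proof -
  have f: "(fact (2 * n) :: real) = 2 * real n * fact (2 * n - 1)"
    using fact_pred[of "2 * n"] assms by simp
  have "3 / (real n * ((2 * real n + 1) * (2 * real n + 2) * (2 * real n + 3))) = 6 * (fact (2 * n - 1) / fact (2 * n + 3))"
  proof -
    have "3 / (real n * ((2 * real n + 1) * (2 * real n + 2) * (2 * real n + 3)))
      = (3 / real n) * (1 / ((2 * real n + 1) * (2 * real n + 2) * (2 * real n + 3)))"
      by simp
    also have "\<dots> = 6 * (fact (2 * n - 1) / fact (2 * n + 3))"
      unfolding fact_ratio[symmetric] f using assms by (simp add: divide_simps)
    finally show ?thesis .
  qed
  moreover have "(\<integral>\<^sup>+m. ennreal (case m of (a, b, c) \<Rightarrow> 2 * (a + b + c) * (1 - a - b - c) ^ (2 * n - 1)) * indicator std_simplex m \<partial>lborel)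
    = ennreal (6 * (fact (2 * n - 1) / fact (2 * n + 3)))"
    by (rule nn_integral_dirichlet_homogeneous[where L = "{(1, 0, 0), (0, 1, 0), (0, 0, 1)}"
          and w = "\<lambda>_. 2" and d = 1])
      (use assms in \<open>auto simp: algebra_simps power2_eq_square\<close>)
  ultimately show ?thesis
    by (simp only:)
qed

text \<open>Three squares contribute 2 each and three mixed products 3 each, in total 15.\<close>

lemma nn_integral_simplex_2:
  assumes "1 \<le> n"
  shows "(\<integral>\<^sup>+m. ennreal (case m of (a, b, c) \<Rightarrow> (a\<^sup>2 + b\<^sup>2 + c\<^sup>2 + 3 * (a * b + a * c + b * c)) * (1 - a - b - c) ^ (2 * n - 2))
        * indicator std_simplex m \<partial>lborel)
    = ennreal (15 / ((2 * real n - 1) * (2 * real n) * ((2 * real n + 1) * (2 * real n + 2) * (2 * real n + 3))))"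
proof -
  have f: "(fact (2 * n) :: real) = 2 * real n * ((2 * real n - 1) * fact (2 * n - 2))"
    using fact_pred[of "2 * n"] fact_pred[of "2 * n - 1"] assms by (simp add: of_nat_diff numeral_2_eq_2)
  have "15 / ((2 * real n - 1) * (2 * real n) * ((2 * real n + 1) * (2 * real n + 2) * (2 * real n + 3)))
      = 15 * (fact (2 * n - 2) / fact (2 * n + 3))"
  proof -
    have "15 / ((2 * real n - 1) * (2 * real n) * ((2 * real n + 1) * (2 * real n + 2) * (2 * real n + 3)))
      = (15 / ((2 * real n - 1) * (2 * real n))) * (1 / ((2 * real n + 1) * (2 * real n + 2) * (2 * real n + 3)))"
      by simp
    also have "\<dots> = 15 * (fact (2 * n - 2) / fact (2 * n + 3))"
      unfolding fact_ratio[symmetric] f using assms by (simp add: divide_simps)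
    finally show ?thesis .
  qed
  moreover have "(\<integral>\<^sup>+m. ennreal (case m of (a, b, c) \<Rightarrow> (a\<^sup>2 + b\<^sup>2 + c\<^sup>2 + 3 * (a * b + a * c + b * c)) * (1 - a - b - c) ^ (2 * n - 2)) * indicator std_simplex m \<partial>lborel)
    = ennreal (15 * (fact (2 * n - 2) / fact (2 * n + 3)))"
    by (rule nn_integral_dirichlet_homogeneous[where L = "{(2, 0, 0), (0, 2, 0), (0, 0, 2), (1, 1, 0), (1, 0, 1), (0, 1, 1)}"
          and w = "\<lambda>(i, j, k). if i = 2 \<or> j = 2 \<or> k = 2 then 1 else 3" and d = 2])
      (use assms in \<open>auto simp: algebra_simps power2_eq_square\<close>)
  ultimately show ?thesis
    by (simp only:)
qed

text \<open>The product expands into six monomials of type \<open>a\<^sup>2 b\<close>, contributing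
  2 each, and \<open>2 a b c\<close>, in total 14.\<close>

lemma nn_integral_simplex_3:
  assumes "2 \<le> n"
  shows "(\<integral>\<^sup>+m. ennreal (case m of (a, b, c) \<Rightarrow> (b + c) * (a + c) * (a + b) * (1 - a - b - c) ^ (2 * n - 3))
        * indicator std_simplex m \<partial>lborel)
    = ennreal (14 / ((2 * real n - 2) * (2 * real n - 1) * (2 * real n) * ((2 * real n + 1) * (2 * real n + 2) * (2 * real n + 3))))"
proof -
  have f: "(fact (2 * n) :: real) = 2 * real n * ((2 * real n - 1) * ((2 * real n - 2) * fact (2 * n - 3)))"
    using fact_pred[of "2 * n"] fact_pred[of "2 * n - 1"] fact_pred[of "2 * n - 2"] assms
    by (simp add: of_nat_diff numeral_2_eq_2 numeral_3_eq_3)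
  have "14 / ((2 * real n - 2) * (2 * real n - 1) * (2 * real n) * ((2 * real n + 1) * (2 * real n + 2) * (2 * real n + 3)))
      = 14 * (fact (2 * n - 3) / fact (2 * n + 3))"
  proof -
    have "14 / ((2 * real n - 2) * (2 * real n - 1) * (2 * real n) * ((2 * real n + 1) * (2 * real n + 2) * (2 * real n + 3)))
      = (14 / ((2 * real n - 2) * (2 * real n - 1) * (2 * real n))) * (1 / ((2 * real n + 1) * (2 * real n + 2) * (2 * real n + 3)))"
      by simp
    also have "\<dots> = 14 * (fact (2 * n - 3) / fact (2 * n + 3))"
      unfolding fact_ratio[symmetric] f using assms by (simp add: divide_simps)
    finally show ?thesis .
  qed
  moreover have "(\<integral>\<^sup>+m. ennreal (case m of (a, b, c) \<Rightarrow> (b + c) * (a + c) * (a + b) * (1 - a - b - c) ^ (2 * n - 3)) * indicator std_simplex m \<partial>lborel)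
    = ennreal (14 * (fact (2 * n - 3) / fact (2 * n + 3)))"
    by (rule nn_integral_dirichlet_homogeneous[where L = "{(2, 1, 0), (2, 0, 1), (1, 2, 0), (0, 2, 1), (1, 0, 2), (0, 1, 2), (1, 1, 1)}"
          and w = "\<lambda>(i, j, k). if i = 1 \<and> j = 1 \<and> k = 1 then 2 else 1" and d = 3])
      (use assms in \<open>auto simp: algebra_simps power2_eq_square\<close>)
  ultimately show ?thesis
    by (simp only:)
qed

section \<open>The constants of the volume formula\<close>

lemma compact_corner_simplex: "compact (corner_simplex :: (real ^ 'd) set)"
proof -
  have "closed (corner_simplex :: (real ^ 'd) set)"
    unfolding corner_simplex_def
    by (intro closed_Collect_conj closed_Collect_all closed_Collect_le continuous_intros)
  moreover have "(corner_simplex :: (real ^ 'd) set) \<subseteq> cbox 0 (\<chi> i. 1)"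
  proof
    fix v :: "real ^ 'd" assume v: "v \<in> corner_simplex"
    have "v $ i \<le> (\<Sum>i\<in>UNIV. v $ i)" for i
      using v by (intro member_le_sum) (auto simp: corner_simplex_def)
    then show "v \<in> cbox 0 (\<chi> i. 1)"
      using v by (auto simp: corner_simplex_def mem_box_cart intro: order_trans)
  qed
  ultimately show ?thesis
    by (meson bounded_cbox bounded_subset compact_eq_bounded_closed)
qed

lemma corner_simplex_borel [measurable]: "corner_simplex \<in> sets borel"
  using compact_corner_simplex by (intro borel_closed compact_imp_closed)

text \<open>Bridge from the Bochner integrals over \<open>lebesgue\<close> in the definitions to
  nonnegative integrals over \<open>lborel\<close>, where Tonelli and substitutions are carried
  out.\<close>

lemma set_integral_nonneg_compact:
  fixes f :: "'a::euclidean_space \<Rightarrow> real"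
  assumes S: "compact S" and f: "continuous_on UNIV f" and nonneg: "\<And>v. v \<in> S \<Longrightarrow> 0 \<le> f v"
  shows "ennreal (LINT v:S|lebesgue. f v) = (\<integral>\<^sup>+v. ennreal (f v) * indicator S v \<partial>lborel)"
    and "0 \<le> (LINT v:S|lebesgue. f v)"
proof -
  have [measurable]: "S \<in> sets borel"
    using S by (intro borel_closed compact_imp_closed)
  have [measurable]: "f \<in> borel_measurable borel"
    by (rule borel_measurable_continuous_onI[OF f])
  have int: "integrable lborel (\<lambda>v. indicator S v *\<^sub>R f v)"
    by (rule borel_integrable_compact[OF S continuous_on_subset[OF f]]) simp
  have eq: "(LINT v:S|lebesgue. f v) = (\<integral>v. indicator S v *\<^sub>R f v \<partial>lborel)"
    unfolding set_lebesgue_integral_def by (rule integral_completion) measurable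
  have "(\<integral>\<^sup>+v. ennreal (f v) * indicator S v \<partial>lborel) = (\<integral>\<^sup>+v. ennreal (indicator S v *\<^sub>R f v) \<partial>lborel)"
    by (intro nn_integral_cong) (simp add: indicator_def)
  also have "\<dots> = ennreal (\<integral>v. indicator S v *\<^sub>R f v \<partial>lborel)"
    using nonneg by (intro nn_integral_eq_integral int) (auto simp: indicator_def)
  finally show "ennreal (LINT v:S|lebesgue. f v) = (\<integral>\<^sup>+v. ennreal (f v) * indicator S v \<partial>lborel)"
    by (simp add: eq)
  show "0 \<le> (LINT v:S|lebesgue. f v)"
    unfolding eq using nonneg by (intro Bochner_Integration.integral_nonneg) (auto simp: indicator_def)
qed

lemma norm_vec3: "(norm (v :: real ^ 3))\<^sup>2 = (v $ 1)\<^sup>2 + (v $ 2)\<^sup>2 + (v $ 3)\<^sup>2"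
  by (simp add: norm_vec_def L2_set_def sum_3)

lemma norm_vec2: "(norm (v :: real ^ 2))\<^sup>2 = (v $ 1)\<^sup>2 + (v $ 2)\<^sup>2"
  by (simp add: norm_vec_def L2_set_def sum_2)

lemma sum_squares_le_1:
  fixes x y z :: real
  assumes "0 \<le> x" "0 \<le> y" "0 \<le> z" "x + y + z \<le> 1"
  shows "x\<^sup>2 + y\<^sup>2 + z\<^sup>2 \<le> 1"
proof -
  have "x\<^sup>2 + y\<^sup>2 + z\<^sup>2 \<le> (x + y + z)\<^sup>2"
    using assms by (simp add: power2_eq_square algebra_simps)
  also have "\<dots> \<le> 1"
    using assms by (simp add: power_le_one)
  finally show ?thesis .
qed

lemma corner_simplex_3:
  "vector [x, y, z] \<in> (corner_simplex :: (real ^ 3) set) \<longleftrightarrow> 0 \<le> x \<and> 0 \<le> y \<and> 0 \<le> z \<and> x + y + z \<le> 1"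
  by (simp add: corner_simplex_def forall_3 sum_3)

lemma corner_simplex_2:
  "vector [x, y] \<in> (corner_simplex :: (real ^ 2) set) \<longleftrightarrow> 0 \<le> x \<and> 0 \<le> y \<and> x + y \<le> 1"
  by (simp add: corner_simplex_def forall_2 sum_2)

lemma measurable_indicator_corner_simplex_3 [measurable (raw)]:
  fixes f1 f2 f3 :: "'z \<Rightarrow> real"
  assumes [measurable]: "f1 \<in> borel_measurable M" "f2 \<in> borel_measurable M" "f3 \<in> borel_measurable M"
  shows "(\<lambda>w. indicator (corner_simplex :: (real ^ 3) set) (vector [f1 w, f2 w, f3 w]) :: ennreal) \<in> borel_measurable M"
  unfolding indicator_def corner_simplex_3 by measurable

lemma corner_simplex_3D:
  "v \<in> (corner_simplex :: (real ^ 3) set) \<Longrightarrow> 0 \<le> v $ 1 \<and> 0 \<le> v $ 2 \<and> 0 \<le> v $ 3 \<and> v $ 1 + v $ 2 + v $ 3 \<le> 1"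
  by (simp add: corner_simplex_def sum_3)

lemma corner_simplex_2D:
  "v \<in> (corner_simplex :: (real ^ 2) set) \<Longrightarrow> 0 \<le> v $ 1 \<and> 0 \<le> v $ 2 \<and> v $ 1 + v $ 2 \<le> 1"
  by (simp add: corner_simplex_def sum_2)

lemma corner_integral_3:
  fixes f :: "real ^ 3 \<Rightarrow> real"
  assumes cont: "continuous_on UNIV f" and nonneg: "\<And>v. v \<in> corner_simplex \<Longrightarrow> 0 \<le> f v"
  shows "ennreal (LINT v:corner_simplex|lebesgue. f v) = (\<integral>\<^sup>+x. \<integral>\<^sup>+y. \<integral>\<^sup>+z. ennreal (f (vector [x, y, z]))
      * indicator (corner_simplex :: (real ^ 3) set) (vector [x, y, z]) \<partial>lborel \<partial>lborel \<partial>lborel)"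
    and "0 \<le> (LINT v:corner_simplex|lebesgue. f v)"
proof -
  have "(\<lambda>v. ennreal (f v) * indicator corner_simplex v) \<in> borel_measurable borel"
    using borel_measurable_continuous_onI[OF cont] by measurable
  from nn_integral_vec3[OF this] set_integral_nonneg_compact[OF compact_corner_simplex cont nonneg]
  show "ennreal (LINT v:corner_simplex|lebesgue. f v) = (\<integral>\<^sup>+x. \<integral>\<^sup>+y. \<integral>\<^sup>+z. ennreal (f (vector [x, y, z]))
      * indicator (corner_simplex :: (real ^ 3) set) (vector [x, y, z]) \<partial>lborel \<partial>lborel \<partial>lborel)"
    and "0 \<le> (LINT v:corner_simplex|lebesgue. f v)"
    by simp_all
qed

lemma corner_integral_2:
  fixes f :: "real ^ 2 \<Rightarrow> real"
  assumes cont: "continuous_on UNIV f" and nonneg: "\<And>v. v \<in> corner_simplex \<Longrightarrow> 0 \<le> f v"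
  shows "ennreal (LINT v:corner_simplex|lebesgue. f v) = (\<integral>\<^sup>+x. \<integral>\<^sup>+y. ennreal (f (vector [x, y]))
      * indicator (corner_simplex :: (real ^ 2) set) (vector [x, y]) \<partial>lborel \<partial>lborel)"
    and "0 \<le> (LINT v:corner_simplex|lebesgue. f v)"
proof -
  have "(\<lambda>v. ennreal (f v) * indicator corner_simplex v) \<in> borel_measurable borel"
    using borel_measurable_continuous_onI[OF cont] by measurable
  from nn_integral_vec2[OF this] set_integral_nonneg_compact[OF compact_corner_simplex cont nonneg]
  show "ennreal (LINT v:corner_simplex|lebesgue. f v) = (\<integral>\<^sup>+x. \<integral>\<^sup>+y. ennreal (f (vector [x, y]))
      * indicator (corner_simplex :: (real ^ 2) set) (vector [x, y]) \<partial>lborel \<partial>lborel)"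
    and "0 \<le> (LINT v:corner_simplex|lebesgue. f v)"
    by simp_all
qed

lemma J_int_nn:
  "ennreal (J_int n) = (\<integral>\<^sup>+x. \<integral>\<^sup>+y. \<integral>\<^sup>+z. ennreal ((1 - y - z) * (1 - x - z) * (1 - x - y) * (1 - x\<^sup>2 - y\<^sup>2 - z\<^sup>2) ^ (n - 3))
      * indicator (corner_simplex :: (real ^ 3) set) (vector [x, y, z]) \<partial>lborel \<partial>lborel \<partial>lborel)"
    and J_int_nonneg: "0 \<le> J_int n"
proof -
  let ?f = "\<lambda>v :: real ^ 3. (1 - v $ 2 - v $ 3) * (1 - v $ 1 - v $ 3) * (1 - v $ 1 - v $ 2) * (1 - (v $ 1)\<^sup>2 - (v $ 2)\<^sup>2 - (v $ 3)\<^sup>2) ^ (n - 3)"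
  have P: "(\<Prod>l\<in>UNIV. 1 - (\<Sum>i\<in>UNIV - {l}. v $ i)) = (1 - v $ 2 - v $ 3) * (1 - v $ 1 - v $ 3) * (1 - v $ 1 - v $ 2)" for v :: "real ^ 3"
  proof -
    have "(UNIV - {1 :: 3}) = {2, 3}" "(UNIV - {2 :: 3}) = {1, 3}" "(UNIV - {3 :: 3}) = {1, 2}"
      using exhaust_3 by auto
    then show ?thesis
      by (simp add: prod_UNIV_3 algebra_simps)
  qed
  have J: "J_int n = (LINT v:corner_simplex|lebesgue. ?f v)"
    unfolding J_int_def P norm_vec3 by (simp add: diff_diff_add add.assoc)
  have cont: "continuous_on UNIV ?f"
    by (intro continuous_intros)
  have nonneg: "0 \<le> ?f v" if "v \<in> corner_simplex" for v
    using corner_simplex_3D[OF that] sum_squares_le_1[of "v $ 1" "v $ 2" "v $ 3"]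
    by (intro mult_nonneg_nonneg zero_le_power) auto
  note S = corner_integral_3[OF cont nonneg]
  show "ennreal (J_int n) = (\<integral>\<^sup>+x. \<integral>\<^sup>+y. \<integral>\<^sup>+z. ennreal ((1 - y - z) * (1 - x - z) * (1 - x - y) * (1 - x\<^sup>2 - y\<^sup>2 - z\<^sup>2) ^ (n - 3))
      * indicator (corner_simplex :: (real ^ 3) set) (vector [x, y, z]) \<partial>lborel \<partial>lborel \<partial>lborel)"
    unfolding J by (simp add: S(1))
  show "0 \<le> J_int n"
    unfolding J by (rule S(2))
qed

lemma K_int_nn:
  "ennreal (K_int n) = (\<integral>\<^sup>+y. \<integral>\<^sup>+z. ennreal ((1 - y) * (1 - z) * (1 - y - z) * (1 - y\<^sup>2 - z\<^sup>2) ^ (n - 3))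
      * indicator (corner_simplex :: (real ^ 2) set) (vector [y, z]) \<partial>lborel \<partial>lborel)"
    and K_int_nonneg: "0 \<le> K_int n"
proof -
  let ?f = "\<lambda>v :: real ^ 2. (1 - v $ 1) * (1 - v $ 2) * (1 - v $ 1 - v $ 2) * (1 - (v $ 1)\<^sup>2 - (v $ 2)\<^sup>2) ^ (n - 3)"
  have J: "K_int n = (LINT v:corner_simplex|lebesgue. ?f v)"
    unfolding K_int_def norm_vec2 by (simp add: diff_diff_add)
  have cont: "continuous_on UNIV ?f"
    by (intro continuous_intros)
  have nonneg: "0 \<le> ?f v" if "v \<in> corner_simplex" for v
    using corner_simplex_2D[OF that] sum_squares_le_1[of "v $ 1" "v $ 2" 0]
    by (intro mult_nonneg_nonneg zero_le_power) auto
  note S = corner_integral_2[OF cont nonneg]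
  show "ennreal (K_int n) = (\<integral>\<^sup>+y. \<integral>\<^sup>+z. ennreal ((1 - y) * (1 - z) * (1 - y - z) * (1 - y\<^sup>2 - z\<^sup>2) ^ (n - 3))
      * indicator (corner_simplex :: (real ^ 2) set) (vector [y, z]) \<partial>lborel \<partial>lborel)"
    unfolding J by (simp add: S(1))
  show "0 \<le> K_int n"
    unfolding J by (rule S(2))
qed

lemma K'_int_nn:
  "ennreal (K'_int n) = (\<integral>\<^sup>+y. \<integral>\<^sup>+z. ennreal ((1 - y - z) * (1 - y\<^sup>2 - z\<^sup>2) ^ (n - 2))
      * indicator (corner_simplex :: (real ^ 2) set) (vector [y, z]) \<partial>lborel \<partial>lborel)"
    and K'_int_nonneg: "0 \<le> K'_int n"
proof -
  let ?f = "\<lambda>v :: real ^ 2. (1 - v $ 1 - v $ 2) * (1 - (v $ 1)\<^sup>2 - (v $ 2)\<^sup>2) ^ (n - 2)"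
  have J: "K'_int n = (LINT v:corner_simplex|lebesgue. ?f v)"
    unfolding K'_int_def norm_vec2 by (simp add: diff_diff_add)
  have cont: "continuous_on UNIV ?f"
    by (intro continuous_intros)
  have nonneg: "0 \<le> ?f v" if "v \<in> corner_simplex" for v
    using corner_simplex_2D[OF that] sum_squares_le_1[of "v $ 1" "v $ 2" 0]
    by (intro mult_nonneg_nonneg zero_le_power) auto
  note S = corner_integral_2[OF cont nonneg]
  show "ennreal (K'_int n) = (\<integral>\<^sup>+y. \<integral>\<^sup>+z. ennreal ((1 - y - z) * (1 - y\<^sup>2 - z\<^sup>2) ^ (n - 2))
      * indicator (corner_simplex :: (real ^ 2) set) (vector [y, z]) \<partial>lborel \<partial>lborel)"
    unfolding J by (simp add: S(1))
  show "0 \<le> K'_int n"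
    unfolding J by (rule S(2))
qed

definition phi3 :: "real \<Rightarrow> real \<Rightarrow> real \<Rightarrow> real" where
  "phi3 a b c = 1 - 3 / 4 * (1 - (a + b + c))\<^sup>2 - (1 - (a + b + c)) * (a + b + c) - (a\<^sup>2 + b\<^sup>2 + c\<^sup>2)"

text \<open>Rewritten with \<open>W = a + b + c\<close>, the function is a product of nonnegative
  factors in \<open>1 - W\<close> plus the excess of \<open>W\<^sup>2\<close> over the sum of
  squares.\<close>

lemma phi3_nonneg:
  assumes "0 \<le> a" "0 \<le> b" "0 \<le> c" "a + b + c \<le> 1"
  shows "0 \<le> phi3 a b c"
proof -
  define W where "W = a + b + c"
  have "a\<^sup>2 + b\<^sup>2 + c\<^sup>2 \<le> W\<^sup>2"
    using assms unfolding W_def by (simp add: power2_eq_square algebra_simps)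
  moreover have "phi3 a b c = (1 - W) * (1 - 3 / 4 * (1 - W)) + (W\<^sup>2 - (a\<^sup>2 + b\<^sup>2 + c\<^sup>2))"
    unfolding phi3_def W_def[symmetric] by (simp add: power2_eq_square field_simps)
  moreover have "0 \<le> (1 - W) * (1 - 3 / 4 * (1 - W))"
    using assms unfolding W_def by (intro mult_nonneg_nonneg) auto
  ultimately show ?thesis
    by linarith
qed

lemma G_int_nn:
  "ennreal (G_int n) = (\<integral>\<^sup>+a. \<integral>\<^sup>+b. \<integral>\<^sup>+c. ennreal (a * b * c * phi3 a b c ^ (n - 3))
      * indicator (corner_simplex :: (real ^ 3) set) (vector [a, b, c]) \<partial>lborel \<partial>lborel \<partial>lborel)"
    and G_int_nonneg: "0 \<le> G_int n"
proof -
  let ?f = "\<lambda>w :: real ^ 3. w $ 1 * w $ 2 * w $ 3 * phi3 (w $ 1) (w $ 2) (w $ 3) ^ (n - 3)"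
  have J: "G_int n = (LINT v:corner_simplex|lebesgue. ?f v)"
    unfolding G_int_def phi_def phi3_def norm_vec3 Let_def ..
  have cont: "continuous_on UNIV ?f"
    unfolding phi3_def by (intro continuous_intros)
  have nonneg: "0 \<le> ?f v" if "v \<in> corner_simplex" for v
    using corner_simplex_3D[OF that] phi3_nonneg[of "v $ 1" "v $ 2" "v $ 3"]
    by (intro mult_nonneg_nonneg zero_le_power) auto
  note S = corner_integral_3[OF cont nonneg]
  show "ennreal (G_int n) = (\<integral>\<^sup>+a. \<integral>\<^sup>+b. \<integral>\<^sup>+c. ennreal (a * b * c * phi3 a b c ^ (n - 3))
      * indicator (corner_simplex :: (real ^ 3) set) (vector [a, b, c]) \<partial>lborel \<partial>lborel \<partial>lborel)"
    unfolding J by (simp add: S(1))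
  show "0 \<le> G_int n"
    unfolding J by (rule S(2))
qed

lemma hull_kernel_pos:
  assumes "0 \<le> x" "0 \<le> y" "0 \<le> z" "x + y + z \<le> 1"
  shows "hull_kernel n x y z
    = ennreal (8 * falling3 n) * ennreal ((1 - y - z) * (1 - x - z) * (1 - x - y) * (1 - x\<^sup>2 - y\<^sup>2 - z\<^sup>2) ^ (n - 3))"
proof -
  have "kernel n 1 x y z = 8 * falling3 n * ((1 - y - z) * (1 - x - z) * (1 - x - y) * (1 - x\<^sup>2 - y\<^sup>2 - z\<^sup>2) ^ (n - 3))"
    using assms by (simp add: kernel_def)
  then show ?thesis
    using assms falling3_nonneg sum_squares_le_1[OF assms]
    by (simp add: hull_kernel_def ennreal_mult)
qed

lemma C0_eq: "C0 n = ennreal (8 * falling3 n * J_int n)"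
proof -
  have "hull_kernel n x y z * indicator {0..} x * indicator {0..} y * indicator {0..} z
     = ennreal (8 * falling3 n) * (ennreal ((1 - y - z) * (1 - x - z) * (1 - x - y) * (1 - x\<^sup>2 - y\<^sup>2 - z\<^sup>2) ^ (n - 3))
      * indicator (corner_simplex :: (real ^ 3) set) (vector [x, y, z]))" for x y z
  proof (cases "0 \<le> x \<and> 0 \<le> y \<and> 0 \<le> z \<and> x + y + z \<le> 1")
    case True
    then show ?thesis
      using hull_kernel_pos[of x y z n] by (simp add: corner_simplex_3)
  next
    case False
    then show ?thesis
      by (auto simp: corner_simplex_3 hull_kernel_def indicator_def)
  qed
  then have "C0 n = ennreal (8 * falling3 n) * ennreal (J_int n)"
    unfolding C0_def J_int_nn by (simp add: nn_integral_cmult)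
  then show ?thesis
    using falling3_nonneg J_int_nonneg by (simp add: ennreal_mult)
qed

text \<open>The negative coordinate has positive part 0, so two of the edges become
  \<open>1 - y\<close> and \<open>1 - z\<close>, and exactly one indicator term survives.\<close>

lemma hull_kernel_neg1:
  assumes "0 \<le> y" "0 \<le> z" "y + z \<le> 1" "1 \<le> n"
  shows "hull_kernel n (- 1) y z
    = ennreal (8 * falling3 n) * ennreal ((1 - y) * (1 - z) * (1 - y - z) * (1 - y\<^sup>2 - z\<^sup>2) ^ (n - 3))
      + ennreal (4 * real n * (real n - 1)) * ennreal ((1 - y - z) * (1 - y\<^sup>2 - z\<^sup>2) ^ (n - 2))"
proof -
  have "kernel n 1 (- 1) y z = 8 * falling3 n * ((1 - y) * (1 - z) * (1 - y - z) * (1 - y\<^sup>2 - z\<^sup>2) ^ (n - 3))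
     + 4 * real n * (real n - 1) * ((1 - y - z) * (1 - y\<^sup>2 - z\<^sup>2) ^ (n - 2))"
    using assms by (simp add: kernel_def)
  moreover have "0 \<le> (1 - y) * (1 - z) * (1 - y - z) * (1 - y\<^sup>2 - z\<^sup>2) ^ (n - 3)" "0 \<le> (1 - y - z) * (1 - y\<^sup>2 - z\<^sup>2) ^ (n - 2)"
    using assms sum_squares_le_1[of y z 0] by (auto intro!: mult_nonneg_nonneg zero_le_power)
  ultimately show ?thesis
    using assms falling3_nonneg by (simp add: hull_kernel_def ennreal_mult)
qed

lemma C1_eq:
  assumes "1 \<le> n"
  shows "C1 n = ennreal (8 * falling3 n * K_int n + 4 * real n * (real n - 1) * K'_int n)"
proof -
  have "hull_kernel n (- 1) y z * indicator {0..} y * indicator {0..} z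
     = ennreal (8 * falling3 n) * (ennreal ((1 - y) * (1 - z) * (1 - y - z) * (1 - y\<^sup>2 - z\<^sup>2) ^ (n - 3))
      * indicator (corner_simplex :: (real ^ 2) set) (vector [y, z]))
      + ennreal (4 * real n * (real n - 1)) * (ennreal ((1 - y - z) * (1 - y\<^sup>2 - z\<^sup>2) ^ (n - 2))
      * indicator (corner_simplex :: (real ^ 2) set) (vector [y, z]))" for y z
  proof (cases "0 \<le> y \<and> 0 \<le> z \<and> y + z \<le> 1")
    case True
    then show ?thesis
      using hull_kernel_neg1[of y z n] assms by (simp add: corner_simplex_2)
  next
    case False
    then show ?thesis
      by (auto simp: corner_simplex_2 hull_kernel_def indicator_def)
  qed
  moreover have [measurable (raw)]: "(\<lambda>w. indicator (corner_simplex :: (real ^ 2) set) (vector [f1 w, f2 w]) :: ennreal) \<in> borel_measurable M"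
    if [measurable]: "f1 \<in> borel_measurable M" "f2 \<in> borel_measurable M"
    for M :: "'z measure" and f1 f2 :: "'z \<Rightarrow> real"
    unfolding indicator_def corner_simplex_2 by measurable
  ultimately have "C1 n = ennreal (8 * falling3 n) * ennreal (K_int n) + ennreal (4 * real n * (real n - 1)) * ennreal (K'_int n)"
    unfolding C1_def K_int_nn K'_int_nn by (simp add: nn_integral_cmult nn_integral_add)
  then show ?thesis
    using falling3_nonneg K_int_nonneg K'_int_nonneg assms by (simp add: ennreal_mult)
qed

text \<open>All edges and the base of the powers are 1, which leaves
  \<open>12 n (n - 1) + 8 n (n - 1) (n - 2)\<close>.\<close>

lemma hull_kernel_neg3:
  assumes "2 \<le> n"
  shows "hull_kernel n (- 1) (- 1) (- 1) = ennreal (4 * real n * (real n - 1) * (2 * real n - 1))"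
proof -
  have "kernel n 1 (- 1) (- 1) (- 1) = 4 * real n * (real n - 1) * (2 * real n - 1)"
    by (simp add: kernel_def falling3_def algebra_simps)
  then show ?thesis
    by (simp add: hull_kernel_def)
qed

lemma psi_has_integral: "((\<lambda>t. (1 - t\<^sup>2) ^ n) has_integral psi n) {0..1}"
proof -
  have "continuous_on {0..1} (\<lambda>t::real. (1 - t\<^sup>2) ^ n)"
    by (intro continuous_intros)
  then have "set_integrable lborel {0..1} (\<lambda>t::real. (1 - t\<^sup>2) ^ n)"
    by (intro borel_integrable_atLeastAtMost') auto
  moreover have "psi n = (LINT t:{0..1}|lborel. (1 - t\<^sup>2) ^ n)"
    unfolding psi_def set_lebesgue_integral_def by (rule integral_completion) measurable
  ultimately show ?thesis
    using has_integral_set_lebesgue[of "{0..1}"] set_borel_integral_eq_integral by (metis has_integral_integral)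
qed

text \<open>With two negative coordinates a one-dimensional integral in \<open>z\<close> remains,
  which reduces to \<open>psi n\<close>. The second claim, not evident from the closed form, holds
  because the integrand \<open>?g\<close> is nonnegative.\<close>

lemma C2_eq:
  assumes n: "2 \<le> n"
  shows "C2 n = ennreal (2 * real n * (2 * real n - 1) * ((2 * real n + 1) * psi n - 2))"
    and "0 \<le> 2 * real n * (2 * real n - 1) * ((2 * real n + 1) * psi n - 2)"
proof -
  let ?g = "\<lambda>z::real. 8 * falling3 n * ((1 - z)\<^sup>2 * (1 - z\<^sup>2) ^ (n - 3)) + 8 * real n * (real n - 1) * ((1 - z) * (1 - z\<^sup>2) ^ (n - 2))"
  obtain k where k: "n = Suc (Suc k)"
    using n by (metis Suc_le_D numeral_2_eq_2 Suc_le_mono)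
  \<comment> \<open>With \<open>w = 1 - z\<^sup>2\<close>, the recursion \<open>(2 k + 1) w\<^sup>k = (z w\<^sup>k)' + 2 k w\<^bsup>k-1\<^esup>\<close> reduces \<open>?g\<close> to a
      multiple of \<open>w\<^sup>n\<close> up to the derivative of \<open>P\<close>.\<close>
  define P where "P z = 8 * real n * (real n - 1) * ((1 - z) * (1 - z\<^sup>2) ^ (n - 2)) + 4 * real n * (1 - z\<^sup>2) ^ (n - 1)
     - 2 * real n * (2 * real n - 1) * (z * (1 - z\<^sup>2) ^ n) - 4 * (real n)\<^sup>2 * (z * (1 - z\<^sup>2) ^ (n - 1))" for z :: real
  have D: "(P has_real_derivative ?g z - 2 * real n * (2 * real n - 1) * (2 * real n + 1) * (1 - z\<^sup>2) ^ n) (at z within A)" for z A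
  \<comment> \<open>For \<open>n = 2\<close> the exponent \<open>n - 3\<close> is truncated and its
    coefficient \<open>falling3 n\<close> is 0, so the derivative is computed separately.\<close>
  proof (cases k)
    case 0
    then show ?thesis
      unfolding P_def k falling3_def
      by - (rule DERIV_cong, (rule derivative_intros)+, simp add: algebra_simps power2_eq_square eval_nat_numeral)
  next
    case (Suc j)
    then show ?thesis
      unfolding P_def k falling3_def
      by - (rule DERIV_cong, (rule derivative_intros)+, simp add: algebra_simps power2_eq_square eval_nat_numeral)
  qed
  have "((\<lambda>z. ?g z - 2 * real n * (2 * real n - 1) * (2 * real n + 1) * (1 - z\<^sup>2) ^ n) has_integral (P 1 - P 0)) {0..1}"
    by (rule fundamental_theorem_of_calculus) (use D in \<open>simp_all add: has_real_derivative_iff_has_vector_derivative\<close>)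
  moreover have "P 1 - P 0 = - 4 * real n * (2 * real n - 1)"
    unfolding P_def k by (simp add: algebra_simps power2_eq_square)
  ultimately have "((\<lambda>z. ?g z - 2 * real n * (2 * real n - 1) * (2 * real n + 1) * (1 - z\<^sup>2) ^ n) has_integral
       - 4 * real n * (2 * real n - 1)) {0..1}"
    by simp
  from has_integral_add[OF this has_integral_mult_right[OF psi_has_integral[of n], of "2 * real n * (2 * real n - 1) * (2 * real n + 1)"]]
  have "(?g has_integral (- 4 * real n * (2 * real n - 1) + 2 * real n * (2 * real n - 1) * (2 * real n + 1) * psi n)) {0..1}"
    by simp
  also have "- 4 * real n * (2 * real n - 1) + 2 * real n * (2 * real n - 1) * (2 * real n + 1) * psi n
     = 2 * real n * (2 * real n - 1) * ((2 * real n + 1) * psi n - 2)"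
    by (simp add: algebra_simps)
  finally have int: "(?g has_integral 2 * real n * (2 * real n - 1) * ((2 * real n + 1) * psi n - 2)) {0..1}" .
  have g0: "0 \<le> ?g z" if "z \<in> {0..1}" for z
    using that n falling3_nonneg[of n] sum_squares_le_1[of z 0 0]
    by (intro add_nonneg_nonneg mult_nonneg_nonneg zero_le_power) auto
  show "0 \<le> 2 * real n * (2 * real n - 1) * ((2 * real n + 1) * psi n - 2)"
    using has_integral_nonneg[OF int g0] .
  have "C2 n = (\<integral>\<^sup>+z. ennreal (indicator {0..1} z * ?g z) \<partial>lborel)"
    unfolding C2_def
  proof (rule nn_integral_cong)
    fix z :: real
    have "kernel n 1 (- 1) (- 1) z = ?g z" if "z \<in> {0..1}"
      using that by (simp add: kernel_def power2_eq_square algebra_simps)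
    then show "hull_kernel n (- 1) (- 1) z * indicator {0..} z = ennreal (indicator {0..1} z * ?g z)"
      by (auto simp: hull_kernel_def indicator_def)
  qed
  also have "\<dots> = ennreal (2 * real n * (2 * real n - 1) * ((2 * real n + 1) * psi n - 2))"
    by (rule nn_integral_has_integral_lebesgue[OF g0 int])
  finally show "C2 n = ennreal (2 * real n * (2 * real n - 1) * ((2 * real n + 1) * psi n - 2))" .
qed

lemma nn_integral_reflect:
  fixes f :: "real \<Rightarrow> ennreal"
  assumes "f \<in> borel_measurable borel"
  shows "(\<integral>\<^sup>+x. f x \<partial>lborel) = (\<integral>\<^sup>+x. f (r - x) \<partial>lborel)"
  using nn_integral_lborel_affine[OF assms, of "-1" r] by simp

text \<open>
  The substitution \<open>a = 1 - x - y\<close>, \<open>b = 1 - x - z\<close>, \<open>c = 1 - y - z\<close>, with determinant \<open>2\<close>,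
  maps the gap \<open>1 < x + y + z\<close> to the corner simplex.
\<close>

lemma gap_kernel_change_of_variables:
  assumes "c \<noteq> 1 - a - b"
  shows "gap_kernel n ((1 - a - b) / 2 + c / 2) (1 - ((1 - a - b) / 2 + c / 2) - a) (1 - ((1 - a - b) / 2 + c / 2) - b)
    = ennreal (8 * falling3 n) * (ennreal (a * b * c * phi3 a b c ^ (n - 3))
      * indicator (corner_simplex :: (real ^ 3) set) (vector [a, b, c]))"
proof -
  define x y z where xyz: "x = (1 - a - b) / 2 + c / 2" "y = 1 - x - a" "z = 1 - x - b"
  have s: "1 - y - z = c" "1 - x - z = b" "1 - x - y = a" "x + y + z = (3 - (a + b + c)) / 2"
    by (simp_all add: xyz field_simps)
  have xyz': "x = c + (1 - (a + b + c)) / 2" "y = b + (1 - (a + b + c)) / 2" "z = a + (1 - (a + b + c)) / 2"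
    by (simp_all add: xyz field_simps)
  have B: "1 - x\<^sup>2 - y\<^sup>2 - z\<^sup>2 = phi3 a b c"
    unfolding xyz' phi3_def by (simp add: power2_eq_square field_simps)
  have K: "kernel n 1 x y z = 8 * falling3 n * (pp c * pp b * pp a) * phi3 a b c ^ (n - 3)"
    if "0 \<le> x" "0 \<le> y" "0 \<le> z"
    using that B s unfolding kernel_def by simp
  have "gap_kernel n x y z
    = ennreal (8 * falling3 n) * (ennreal (a * b * c * phi3 a b c ^ (n - 3))
      * indicator (corner_simplex :: (real ^ 3) set) (vector [a, b, c]))"
  proof (cases "a + b + c < 1")
    \<comment> \<open>The hypothesis excludes the plane \<open>a + b + c = 1\<close>, which belongs
      to the closed simplex but not to the open gap.\<close>
    case False
    then have "1 < a + b + c"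
      using assms by linarith
    then have "\<not> 1 < x + y + z"
      unfolding s(4) by simp
    then show ?thesis
      using \<open>1 < a + b + c\<close> by (simp add: gap_kernel_def corner_simplex_3)
  next
    case True
    then have gt: "1 < x + y + z"
      unfolding s(4) by simp
    show ?thesis
    proof (cases "0 \<le> a \<and> 0 \<le> b \<and> 0 \<le> c")
      case pos: True
      then have "0 \<le> x" "0 \<le> y" "0 \<le> z"
        using True by (auto simp: xyz')
      then have "gap_kernel n x y z = ennreal (8 * falling3 n * (a * b * c * phi3 a b c ^ (n - 3)))"
        using K pos gt by (simp add: gap_kernel_def ac_simps)
      then show ?thesis
        using pos True falling3_nonneg[of n] ennreal_mult'[of "8 * falling3 n" "a * b * c * phi3 a b c ^ (n - 3)"]
        by (simp add: corner_simplex_3)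
    next
      case False
      then have "pp c * pp b * pp a = 0"
        by (auto simp: pp_def)
      then have "gap_kernel n x y z = 0"
        using K by (auto simp: gap_kernel_def indicator_def)
      moreover have "(vector [a, b, c] :: real ^ 3) \<notin> corner_simplex"
        using False unfolding corner_simplex_3 by blast
      ultimately show ?thesis
        by simp
    qed
  qed
  then show ?thesis
    by (simp add: xyz)
qed

text \<open>The linear substitution is done one variable at a time: two reflections, then, with
  \<open>x\<close> moved innermost, an affine map of factor one half. This turns the 8 of the kernel
  into 4.\<close>

lemma Cgap_eq: "Cgap n = ennreal (4 * falling3 n * G_int n)"
proof -
  have [measurable (raw)]: "(\<lambda>w. gap_kernel n (f1 w) (f2 w) (f3 w)) \<in> borel_measurable M"
    if [measurable]: "f1 \<in> borel_measurable M" "f2 \<in> borel_measurable M" "f3 \<in> borel_measurable M"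
    for M :: "'z measure" and f1 f2 f3 :: "'z \<Rightarrow> real"
    unfolding gap_kernel_def by measurable
  have [measurable (raw)]: "(\<lambda>w. phi3 (f1 w) (f2 w) (f3 w)) \<in> borel_measurable M"
    if [measurable]: "f1 \<in> borel_measurable M" "f2 \<in> borel_measurable M" "f3 \<in> borel_measurable M"
    for M :: "'z measure" and f1 f2 f3 :: "'z \<Rightarrow> real"
    unfolding phi3_def by measurable
  have z: "(\<integral>\<^sup>+z. gap_kernel n x y z \<partial>lborel) = (\<integral>\<^sup>+b. gap_kernel n x y (1 - x - b) \<partial>lborel)" for x y
    by (rule nn_integral_reflect) measurable
  have y: "(\<integral>\<^sup>+y. \<integral>\<^sup>+b. gap_kernel n x y (1 - x - b) \<partial>lborel \<partial>lborel)
      = (\<integral>\<^sup>+a. \<integral>\<^sup>+b. gap_kernel n x (1 - x - a) (1 - x - b) \<partial>lborel \<partial>lborel)" for x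
    by (rule nn_integral_reflect) measurable
  have x: "(\<integral>\<^sup>+x. gap_kernel n x (1 - x - a) (1 - x - b) \<partial>lborel)
      = ennreal (1 / 2) * (\<integral>\<^sup>+c. gap_kernel n ((1 - a - b) / 2 + c / 2) (1 - ((1 - a - b) / 2 + c / 2) - a)
            (1 - ((1 - a - b) / 2 + c / 2) - b) \<partial>lborel)" for a b
    using nn_integral_lborel_affine[of "\<lambda>x. gap_kernel n x (1 - x - a) (1 - x - b)" "1 / 2" "(1 - a - b) / 2"] by simp
  have c: "(\<integral>\<^sup>+c. gap_kernel n ((1 - a - b) / 2 + c / 2) (1 - ((1 - a - b) / 2 + c / 2) - a)
            (1 - ((1 - a - b) / 2 + c / 2) - b) \<partial>lborel)
     = (\<integral>\<^sup>+c. ennreal (8 * falling3 n) * (ennreal (a * b * c * phi3 a b c ^ (n - 3))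
      * indicator (corner_simplex :: (real ^ 3) set) (vector [a, b, c])) \<partial>lborel)" for a b
    \<comment> \<open>The plane where the two integrands may differ meets each line in a single
      point.\<close>
    using AE_lborel_singleton[of "1 - a - b"]
    by (intro nn_integral_cong_AE) (auto elim!: eventually_mono simp: gap_kernel_change_of_variables)
  have "Cgap n = (\<integral>\<^sup>+x. \<integral>\<^sup>+a. \<integral>\<^sup>+b. gap_kernel n x (1 - x - a) (1 - x - b) \<partial>lborel \<partial>lborel \<partial>lborel)"
    unfolding Cgap_def z y ..
  also have "\<dots> = (\<integral>\<^sup>+a. \<integral>\<^sup>+x. \<integral>\<^sup>+b. gap_kernel n x (1 - x - a) (1 - x - b) \<partial>lborel \<partial>lborel \<partial>lborel)"
    by (rule lborel_pair.Fubini') measurable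
  also have "\<dots> = (\<integral>\<^sup>+a. \<integral>\<^sup>+b. \<integral>\<^sup>+x. gap_kernel n x (1 - x - a) (1 - x - b) \<partial>lborel \<partial>lborel \<partial>lborel)"
    by (intro nn_integral_cong lborel_pair.Fubini') measurable
  also have "\<dots> = ennreal (1 / 2) * (ennreal (8 * falling3 n) * ennreal (G_int n))"
    unfolding x c G_int_nn by (simp add: nn_integral_cmult)
  also have "\<dots> = ennreal (4 * falling3 n * G_int n)"
    using falling3_nonneg G_int_nonneg by (subst ennreal_mult[symmetric], simp, simp)+ simp
  finally show ?thesis .
qed

section \<open>Closed form of \<open>psi\<close>\<close>

lemma psi_0: "psi 0 = 1"
proof (rule has_integral_unique)
  show "((\<lambda>t::real. 1::real) has_integral psi 0) {0..1}"
    using psi_has_integral[of 0] by simp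
  show "((\<lambda>t::real. 1::real) has_integral 1) {0..1}"
    using has_integral_const_real[of "1::real" 0 1] by simp
qed

text \<open>The difference of the two sides is the integral of the derivative of
  \<open>t * (1 - t\<^sup>2) ^ Suc n\<close>, which vanishes at 0 and 1.\<close>

lemma psi_Suc: "(2 * real n + 3) * psi (Suc n) = (2 * real n + 2) * psi n"
proof -
  have "((\<lambda>t::real. (2 * real n + 3) * (1 - t\<^sup>2) ^ Suc n - (2 * real n + 2) * (1 - t\<^sup>2) ^ n) has_integral
     (1 * (1 - 1\<^sup>2) ^ Suc n - 0 * (1 - 0\<^sup>2) ^ Suc n)) {0..1}"
  proof (rule fundamental_theorem_of_calculus)
    fix t :: real
    have "((\<lambda>t. t * (1 - t\<^sup>2) ^ Suc n) has_real_derivative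
        (2 * real n + 3) * (1 - t\<^sup>2) ^ Suc n - (2 * real n + 2) * (1 - t\<^sup>2) ^ n) (at t within {0..1})"
      by (rule DERIV_cong, (rule derivative_intros)+) (simp add: algebra_simps power2_eq_square)
    then show "((\<lambda>t. t * (1 - t\<^sup>2) ^ Suc n) has_vector_derivative
        (2 * real n + 3) * (1 - t\<^sup>2) ^ Suc n - (2 * real n + 2) * (1 - t\<^sup>2) ^ n) (at t within {0..1})"
      by (simp only: has_real_derivative_iff_has_vector_derivative)
  qed simp
  moreover have "((\<lambda>t::real. (2 * real n + 3) * (1 - t\<^sup>2) ^ Suc n - (2 * real n + 2) * (1 - t\<^sup>2) ^ n) has_integral
     ((2 * real n + 3) * psi (Suc n) - (2 * real n + 2) * psi n)) {0..1}"
    by (intro has_integral_diff has_integral_mult_right psi_has_integral)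
  ultimately have "(2 * real n + 3) * psi (Suc n) - (2 * real n + 2) * psi n = (1 * (1 - 1\<^sup>2) ^ Suc n - 0 * (1 - 0\<^sup>2) ^ Suc n)"
    by (rule has_integral_unique[rotated])
  then show ?thesis
    by simp
qed

lemma psi_eq: "psi n = 2 ^ n * fact n / real (odd_double_fact n)"
proof (induction n)
  case 0
  then show ?case
    by (simp add: psi_0 odd_double_fact_def)
next
  case (Suc n)
  have "odd_double_fact (Suc n) = odd_double_fact n * (2 * n + 3)"
    by (simp add: odd_double_fact_def algebra_simps)
  then have o: "real (odd_double_fact (Suc n)) = real (odd_double_fact n) * (2 * real n + 3)"
    by simp
  have "psi (Suc n) = (2 * real n + 2) * psi n / (2 * real n + 3)"
    using psi_Suc[of n] by (simp add: field_simps)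
  also have "\<dots> = 2 ^ Suc n * fact (Suc n) / real (odd_double_fact (Suc n))"
    unfolding Suc o by (simp add: algebra_simps)
  finally show ?case .
qed

section \<open>Assembling the volumes for at least two columns\<close>

lemma min_region_borel_closed: "closed Q \<Longrightarrow> (min_region Q :: ((real ^ 'n ^ 2) \<times> (real ^ 3)) set) \<in> sets borel"
  by (intro min_region_borel borel_closed)

lemma Vol3_hull: "Vol3 (int_hull :: ((real ^ 'n ^ 3) \<times> (real ^ 3)) set)
    = measure lborel (min_region hull_range :: ((real ^ 'n ^ 2) \<times> (real ^ 3)) set)"
  unfolding Vol3_def delete_row3_hull
  by (rule measure_completion) (simp add: min_region_borel_closed closed_hull_range)

lemma Vol3_relax: "Vol3 (lin_relax \<inter> assign_space :: ((real ^ 'n ^ 3) \<times> (real ^ 3)) set)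
    = measure lborel (min_region relax_range :: ((real ^ 'n ^ 2) \<times> (real ^ 3)) set)"
  unfolding Vol3_def delete_row3_relax
  by (rule measure_completion) (simp add: min_region_borel_closed closed_relax_range)

lemma Vol3_diff: "Vol3 (lin_relax \<inter> assign_space :: ((real ^ 'n ^ 3) \<times> (real ^ 3)) set)
    - Vol3 (int_hull :: ((real ^ 'n ^ 3) \<times> (real ^ 3)) set)
    = measure lborel (min_region (relax_range - hull_range) :: ((real ^ 'n ^ 2) \<times> (real ^ 3)) set)"
proof -
  have eq: "(min_region (relax_range - hull_range) :: ((real ^ 'n ^ 2) \<times> (real ^ 3)) set)
      = min_region relax_range - min_region hull_range"
    by (auto simp: min_region_def)
  have sub: "(min_region hull_range :: ((real ^ 'n ^ 2) \<times> (real ^ 3)) set) \<subseteq> min_region relax_range"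
    using hull_range_subset by (auto simp: min_region_def)
  show ?thesis
    unfolding Vol3_hull Vol3_relax eq using emeasure_min_region_relax_finite[where 'n = 'n] sub
    by (intro measure_Diff[symmetric]) (auto simp: min_region_borel_closed closed_relax_range closed_hull_range)
qed

lemma measure_scaled:
  assumes "2 ^ n * emeasure M A = ennreal r" "0 \<le> r"
  shows "2 ^ n * measure M A = r"
proof -
  have "enn2real (2 ^ n * emeasure M A) = 2 ^ n * measure M A"
  proof -
    have "(2 :: ennreal) ^ n = ennreal (2 ^ n)"
      by (simp flip: ennreal_power)
    then show ?thesis
      by (simp add: enn2real_mult measure_def)
  qed
  then show ?thesis
    using assms by simp
qed

lemma nn_integral_lincomb4:
  assumes [measurable]: "f0 \<in> borel_measurable M" "f1 \<in> borel_measurable M" "f2 \<in> borel_measurable M" "f3 \<in> borel_measurable M"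
  shows "(\<integral>\<^sup>+x. c0 * f0 x + c1 * f1 x + c2 * f2 x + c3 * f3 x \<partial>M)
    = c0 * (\<integral>\<^sup>+x. f0 x \<partial>M) + c1 * (\<integral>\<^sup>+x. f1 x \<partial>M) + c2 * (\<integral>\<^sup>+x. f2 x \<partial>M) + c3 * (\<integral>\<^sup>+x. f3 x \<partial>M)"
  by (simp add: nn_integral_add nn_integral_cmult)

text \<open>The four summands correspond to zero, one, two and three negative coordinates: each is a
  Dirichlet integral over the minima times the matching constant.\<close>

lemma hull_volume:
  assumes n: "n = CARD('n::finite)" "2 \<le> n"
  shows "2 ^ n * Vol3 (int_hull :: ((real ^ 'n ^ 3) \<times> (real ^ 3)) set) =
     1 / ((2 * real n + 1) * (2 * real n + 2) * (2 * real n + 3)) * (8 * falling3 n * J_int n)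
     + 3 / (real n * ((2 * real n + 1) * (2 * real n + 2) * (2 * real n + 3)))
         * (8 * falling3 n * K_int n + 4 * real n * (real n - 1) * K'_int n)
     + 15 / ((2 * real n - 1) * (2 * real n) * ((2 * real n + 1) * (2 * real n + 2) * (2 * real n + 3)))
         * (2 * real n * (2 * real n - 1) * ((2 * real n + 1) * psi n - 2))
     + 14 / ((2 * real n - 2) * (2 * real n - 1) * (2 * real n) * ((2 * real n + 1) * (2 * real n + 2) * (2 * real n + 3)))
         * (4 * real n * (real n - 1) * (2 * real n - 1))" (is "_ = ?a + ?b + ?c + ?d")
  unfolding Vol3_hull
proof (rule measure_scaled)
  have n1: "1 \<le> n"
    using n by simp
  have "0 \<le> ?c"
    by (rule mult_nonneg_nonneg[OF _ C2_eq(2)[OF n(2)]]) (use n in auto)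
  moreover have "0 \<le> ?a" "0 \<le> ?b" "0 \<le> ?d"
    using n falling3_nonneg J_int_nonneg K_int_nonneg K'_int_nonneg
    by (auto intro!: mult_nonneg_nonneg divide_nonneg_nonneg add_nonneg_nonneg)
  ultimately have nn: "0 \<le> ?a" "0 \<le> ?b" "0 \<le> ?c" "0 \<le> ?d"
    by blast+
  then show "0 \<le> ?a + ?b + ?c + ?d"
    by simp
  let ?p0 = "\<lambda>m. case m of (a, b, c) \<Rightarrow> (1 - a - b - c :: real) ^ (2 * n)"
  let ?p1 = "\<lambda>m. case m of (a, b, c) \<Rightarrow> 2 * (a + b + c) * (1 - a - b - c :: real) ^ (2 * n - 1)"
  let ?p2 = "\<lambda>m. case m of (a, b, c) \<Rightarrow> (a\<^sup>2 + b\<^sup>2 + c\<^sup>2 + 3 * (a * b + a * c + b * c)) * (1 - a - b - c :: real) ^ (2 * n - 2)"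
  let ?p3 = "\<lambda>m. case m of (a, b, c) \<Rightarrow> (b + c) * (a + c) * (a + b) * (1 - a - b - c :: real) ^ (2 * n - 3)"
  let ?C3 = "hull_kernel n (- 1) (- 1) (- 1)"
  have [measurable]: "?p0 \<in> borel_measurable borel" "?p1 \<in> borel_measurable borel" "?p2 \<in> borel_measurable borel" "?p3 \<in> borel_measurable borel"
    unfolding case_prod_unfold by measurable
  have inner: "(\<integral>\<^sup>+y. ennreal (joint_density n m y) * indicator hull_range (m, y) \<partial>lborel)
      = C0 n * (ennreal (?p0 m) * indicator std_simplex m) + C1 n * (ennreal (?p1 m) * indicator std_simplex m)
        + C2 n * (ennreal (?p2 m) * indicator std_simplex m) + ?C3 * (ennreal (?p3 m) * indicator std_simplex m)" for m
  proof -
    obtain a b c where m: "m = (a, b, c)"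
      by (metis prod_cases3)
    show ?thesis
      unfolding m nn_integral_joint_hull[OF n(2)] prod.case distrib_right by (simp only: ac_simps)
  qed
  have e: "ennreal u * ennreal s = ennreal (s * u)" if "0 \<le> s" for s u :: real
    using that by (simp add: ennreal_mult' mult.commute)
  let ?D = "(2 * real n + 1) * (2 * real n + 2) * (2 * real n + 3)"
  have d0: "0 \<le> 1 / ?D" and d1: "0 \<le> 3 / (real n * ?D)" and d2: "0 \<le> 15 / ((2 * real n - 1) * (2 * real n) * ?D)"
    and d3: "0 \<le> 14 / ((2 * real n - 2) * (2 * real n - 1) * (2 * real n) * ?D)"
    using n by auto
  have "2 ^ n * emeasure lborel (min_region hull_range :: ((real ^ 'n ^ 2) \<times> (real ^ 3)) set)
    = (\<integral>\<^sup>+m. \<integral>\<^sup>+y. ennreal (joint_density n m y) * indicator hull_range (m, y) \<partial>lborel \<partial>lborel)"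
    unfolding n(1) using n closed_hull_range by (intro emeasure_min_region) auto
  also have "\<dots> = C0 n * (\<integral>\<^sup>+m. ennreal (?p0 m) * indicator std_simplex m \<partial>lborel)
      + C1 n * (\<integral>\<^sup>+m. ennreal (?p1 m) * indicator std_simplex m \<partial>lborel)
      + C2 n * (\<integral>\<^sup>+m. ennreal (?p2 m) * indicator std_simplex m \<partial>lborel)
      + ?C3 * (\<integral>\<^sup>+m. ennreal (?p3 m) * indicator std_simplex m \<partial>lborel)"
    unfolding inner by (rule nn_integral_lincomb4) measurable
  also have "\<dots> = ennreal ?a + ennreal ?b + ennreal ?c + ennreal ?d"
    unfolding nn_integral_simplex_0 nn_integral_simplex_1[OF n1] nn_integral_simplex_2[OF n1] nn_integral_simplex_3[OF n(2)]
      C0_eq C1_eq[OF n1] C2_eq(1)[OF n(2)] hull_kernel_neg3[OF n(2)]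
    unfolding e[OF d0] e[OF d1] e[OF d2] e[OF d3] ..
  also have "\<dots> = ennreal (?a + ?b + ?c + ?d)"
    using nn by simp
  finally show "2 ^ n * emeasure lborel (min_region hull_range :: ((real ^ 'n ^ 2) \<times> (real ^ 3)) set) = ennreal (?a + ?b + ?c + ?d)" .
qed

lemma gap_volume:
  assumes n: "n = CARD('n::finite)" "2 \<le> n"
  shows "2 ^ n * (Vol3 (lin_relax \<inter> assign_space :: ((real ^ 'n ^ 3) \<times> (real ^ 3)) set)
                  - Vol3 (int_hull :: ((real ^ 'n ^ 3) \<times> (real ^ 3)) set)) =
     1 / ((2 * real n + 1) * (2 * real n + 2) * (2 * real n + 3)) * (4 * falling3 n * G_int n)" (is "_ = ?a")
  unfolding Vol3_diff
proof (rule measure_scaled)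
  show "0 \<le> ?a"
    using falling3_nonneg G_int_nonneg by simp
  let ?p0 = "\<lambda>m. case m of (a, b, c) \<Rightarrow> (1 - a - b - c :: real) ^ (2 * n)"
  have [measurable]: "?p0 \<in> borel_measurable borel"
    unfolding case_prod_unfold by measurable
  have inner: "(\<integral>\<^sup>+y. ennreal (joint_density n m y) * indicator (relax_range - hull_range) (m, y) \<partial>lborel)
      = Cgap n * (ennreal (?p0 m) * indicator std_simplex m)" for m
  proof -
    obtain a b c where m: "m = (a, b, c)"
      by (metis prod_cases3)
    show ?thesis
      unfolding m nn_integral_joint_gap[OF n(2)] by (simp add: ac_simps)
  qed
  have "2 ^ n * emeasure lborel (min_region (relax_range - hull_range) :: ((real ^ 'n ^ 2) \<times> (real ^ 3)) set)
    = (\<integral>\<^sup>+m. \<integral>\<^sup>+y. ennreal (joint_density n m y) * indicator (relax_range - hull_range) (m, y) \<partial>lborel \<partial>lborel)"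
    unfolding n(1) using n closed_hull_range closed_relax_range by (intro emeasure_min_region) auto
  also have "\<dots> = Cgap n * (\<integral>\<^sup>+m. ennreal (?p0 m) * indicator std_simplex m \<partial>lborel)"
    unfolding inner by (rule nn_integral_cmult) measurable
  also have "\<dots> = ennreal ?a"
    unfolding nn_integral_simplex_0 Cgap_eq using falling3_nonneg G_int_nonneg
    by (subst ennreal_mult[symmetric]) (simp_all add: ac_simps)
  finally show "2 ^ n * emeasure lborel (min_region (relax_range - hull_range) :: ((real ^ 'n ^ 2) \<times> (real ^ 3)) set) = ennreal ?a" .
qed

section \<open>A single column\<close>

text \<open>The minima of a single column are its entries, so they sum to 1, and the bounds above
  them sum to at least 1.\<close>

lemma min_region_hull_eq_relax:
  assumes "CARD('n::finite) = 1"
  shows "(min_region hull_range :: ((real ^ 'n ^ 2) \<times> (real ^ 3)) set) = min_region relax_range"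
proof -
  obtain j0 :: 'n where U: "(UNIV :: 'n set) = {j0}"
    using assms card_1_singletonE by blast
  have "2 \<le> coord_sum (col_min z) + coord_sum (triple y)" if "z \<in> below (triple y)" for z :: "real ^ 'n ^ 2" and y
  proof -
    have "coord_sum (col_min z) = 1"
      unfolding col_min_def U by simp
    moreover have "coord_sum (col_min z) \<le> coord_sum (triple y)"
      using col_min_le[OF that] unfolding coord_sum_eq less_eq_prod_def by linarith
    ultimately show ?thesis
      by simp
  qed
  then show ?thesis
    by (auto simp: min_region_def hull_range_def relax_range_def)
qed

text \<open>For a fixed column each \<open>y\<^sub>i\<close> ranges freely between its entry and 1,
  so the volume is a product of three lengths.\<close>

lemma nn_integral_region_range:
  "(\<integral>\<^sup>+y. indicator {y. (p, q) \<in> region (0, 0, 0) y \<and> y \<le> (1, 1, 1)} y \<partial>lborel)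
    = ennreal ((1 - p) * (1 - q) * (p + q)) * indicator {0..1 - p} q * indicator {0..1} p"
proof -
  let ?Y = "{y. (p, q) \<in> region (0, 0, 0) y \<and> y \<le> (1, 1, 1)}"
  show ?thesis
  proof (cases "0 \<le> p \<and> 0 \<le> q \<and> p + q \<le> 1")
    case True
    then have "?Y = {p..1} \<times> {q..1} \<times> {1 - p - q..1}"
      by (auto simp: region_def)
    moreover have "emeasure lborel ({p..1} \<times> {q..1} \<times> {1 - p - q..1}) = ennreal (1 - p) * (ennreal (1 - q) * ennreal (p + q))"
      using True by (simp add: emeasure_lborel_Times borel_closed closed_Times del: ennreal_plus)
    moreover have "(\<integral>\<^sup>+y. indicator ({p..1} \<times> {q..1} \<times> {1 - p - q..1}) y \<partial>lborel)
        = emeasure lborel ({p..1} \<times> {q..1} \<times> {1 - p - q..1})"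
      by (rule nn_integral_indicator) (simp add: borel_closed closed_Times)
    moreover have "ennreal (1 - p) * (ennreal (1 - q) * ennreal (p + q)) = ennreal ((1 - p) * (1 - q) * (p + q))"
      using True by (simp add: ennreal_mult mult.assoc del: ennreal_plus)
    ultimately show ?thesis
      using True by (simp del: ennreal_plus)
  next
    case False
    then have empty: "?Y = {}"
      by (auto simp: region_def)
    have "ennreal ((1 - p) * (1 - q) * (p + q)) * indicator {0..1 - p} q * indicator {0..1} p = 0"
      using False by (auto simp: indicator_def)
    then show ?thesis
      unfolding empty by simp
  qed
qed

text \<open>The bounds are integrated out first. The remaining integral in \<open>s = 1 - p\<close>
  is that of \<open>s\<^sup>2 - s\<^sup>3 + s\<^sup>4 / 6\<close> over the unit interval, that is
  \<open>1/3 - 1/4 + 1/30\<close>.\<close>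

lemma emeasure_min_region_relax_1:
  assumes n: "CARD('n::finite) = 1"
  shows "emeasure lborel (min_region relax_range :: ((real ^ 'n ^ 2) \<times> (real ^ 3)) set) = ennreal (7 / 60)"
proof -
  let ?V = "min_region relax_range :: ((real ^ 'n ^ 2) \<times> (real ^ 3)) set"
  let ?A = "{(y, p). p \<in> region (0, 0, 0) y \<and> y \<le> (1, 1, 1)}"
  have V [measurable]: "?V \<in> sets borel"
    by (simp add: min_region_borel_closed closed_relax_range)
  have "closed ?A"
    unfolding region_def case_prod_unfold less_eq_prod_def mem_Collect_eq
    by (intro closed_Collect_conj closed_Collect_le continuous_intros)
  then have A [measurable]: "?A \<in> sets borel"
    by simp
  then have A': "(\<lambda>(y, p). indicator ?A (y, p) :: ennreal) \<in> borel_measurable (lborel \<Otimes>\<^sub>M lborel)"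
    by (simp add: lborel_prod case_prod_unfold)
  have z: "(\<integral>\<^sup>+z. indicator ?V (z, y) \<partial>lborel) = (\<integral>\<^sup>+p. indicator ?A (triple y, p) \<partial>lborel)" for y
  proof (cases "triple y \<le> (1, 1, 1)")
    case True
    then have "(\<integral>\<^sup>+z. indicator ?V (z, y) \<partial>lborel)
      = (\<integral>\<^sup>+z. indicator {z :: real ^ 'n ^ 2. \<forall>j. (z $ 1 $ j, z $ 2 $ j) \<in> region (0, 0, 0) (triple y)} z \<partial>lborel)"
      by (intro nn_integral_cong) (auto simp: indicator_def min_region_def relax_range_def simp flip: col_min_ge_iff)
    also have "\<dots> = emeasure lborel {z :: real ^ 'n ^ 2. \<forall>j. (z $ 1 $ j, z $ 2 $ j) \<in> region (0, 0, 0) (triple y)}"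
      by (intro nn_integral_indicator) (simp, measurable)
    also have "\<dots> = emeasure lborel (region (0, 0, 0) (triple y))"
      using n by (simp add: emeasure_columns)
    also have "\<dots> = (\<integral>\<^sup>+p. indicator (region (0, 0, 0) (triple y)) p \<partial>lborel)"
      by simp
    also have "\<dots> = (\<integral>\<^sup>+p. indicator ?A (triple y, p) \<partial>lborel)"
      using True by (intro nn_integral_cong) (auto simp: indicator_def)
    finally show ?thesis .
  next
    case False
    then have "indicator ?V (z, y) = (0 :: ennreal)" "indicator ?A (triple y, p) = (0 :: ennreal)" for z p
      by (auto simp: min_region_def relax_range_def)
    then show ?thesis
      by simp
  qed
  have "emeasure lborel ?V = (\<integral>\<^sup>+p. indicator ?V p \<partial>(lborel \<Otimes>\<^sub>M lborel))"
    by (simp add: lborel_prod)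
  also have "\<dots> = (\<integral>\<^sup>+y. \<integral>\<^sup>+z. indicator ?V (z, y) \<partial>lborel \<partial>lborel)"
    by (rule lborel_pair.nn_integral_snd[symmetric]) (simp add: lborel_prod)
  also have "\<dots> = (\<integral>\<^sup>+y. \<integral>\<^sup>+p. indicator ?A (y, p) \<partial>lborel \<partial>lborel)"
    unfolding z by (rule nn_integral_triple) (use A' in measurable)
  also have "\<dots> = (\<integral>\<^sup>+p. \<integral>\<^sup>+y. indicator ?A (y, p) \<partial>lborel \<partial>lborel)"
    by (rule lborel_pair.Fubini'[OF A', symmetric])
  also have "\<dots> = (\<integral>\<^sup>+p. \<integral>\<^sup>+q. \<integral>\<^sup>+y. indicator ?A (y, (p, q)) \<partial>lborel \<partial>lborel \<partial>lborel)"
  proof (rule nn_integral_lborel_pair)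
    have "(\<lambda>p. \<integral>\<^sup>+y. indicator ?A (y, p) \<partial>lborel) \<in> borel_measurable lborel"
      using A' by measurable
    then show "(\<lambda>p. \<integral>\<^sup>+y. indicator ?A (y, p) \<partial>lborel) \<in> borel_measurable borel"
      by simp
  qed
  also have "\<dots> = (\<integral>\<^sup>+p. \<integral>\<^sup>+q. ennreal ((1 - p) * (1 - q) * (p + q)) * indicator {0..1 - p} q * indicator {0..1} p \<partial>lborel \<partial>lborel)"
  proof (intro nn_integral_cong)
    fix p q :: real
    have "indicator ?A (y, (p, q)) = (indicator {y. (p, q) \<in> region (0, 0, 0) y \<and> y \<le> (1, 1, 1)} y :: ennreal)" for y
      by (simp add: indicator_def)
    then show "(\<integral>\<^sup>+y. indicator ?A (y, (p, q)) \<partial>lborel)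
      = ennreal ((1 - p) * (1 - q) * (p + q)) * indicator {0..1 - p} q * indicator {0..1} p"
      unfolding nn_integral_region_range[symmetric] by simp
  qed
  also have "\<dots> = (\<integral>\<^sup>+p. ennreal (indicator {0..1} p * ((1 - p)\<^sup>2 - (1 - p) ^ 3 + (1 - p) ^ 4 / 6)) \<partial>lborel)"
  proof (intro nn_integral_cong)
    fix p :: real
    show "(\<integral>\<^sup>+q. ennreal ((1 - p) * (1 - q) * (p + q)) * indicator {0..1 - p} q * indicator {0..1} p \<partial>lborel)
      = ennreal (indicator {0..1} p * ((1 - p)\<^sup>2 - (1 - p) ^ 3 + (1 - p) ^ 4 / 6))"
    proof (cases "p \<in> {0..1}")
      case True
      let ?F = "\<lambda>q. (1 - p) * (p * q + q\<^sup>2 / 2 - p * q\<^sup>2 / 2 - q ^ 3 / 3)"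
      have "((\<lambda>q. (1 - p) * (1 - q) * (p + q)) has_integral (?F (1 - p) - ?F 0)) {0..1 - p}"
      proof (rule fundamental_theorem_of_calculus)
        fix q :: real
        have "(?F has_real_derivative (1 - p) * (1 - q) * (p + q)) (at q within {0..1 - p})"
          by (rule DERIV_cong, (rule derivative_intros | simp)+) (simp add: field_simps power2_eq_square)
        then show "(?F has_vector_derivative (1 - p) * (1 - q) * (p + q)) (at q within {0..1 - p})"
          by (simp only: has_real_derivative_iff_has_vector_derivative)
      qed (use True in simp)
      moreover have "?F (1 - p) - ?F 0 = (1 - p)\<^sup>2 - (1 - p) ^ 3 + (1 - p) ^ 4 / 6"
        by (simp add: field_simps power2_eq_square power3_eq_cube power4_eq_xxxx)
      ultimately have "((\<lambda>q. (1 - p) * (1 - q) * (p + q)) has_integral ((1 - p)\<^sup>2 - (1 - p) ^ 3 + (1 - p) ^ 4 / 6)) {0..1 - p}"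
        by simp
      then have "(\<integral>\<^sup>+q. ennreal (indicator {0..1 - p} q * ((1 - p) * (1 - q) * (p + q))) \<partial>lborel)
          = ennreal ((1 - p)\<^sup>2 - (1 - p) ^ 3 + (1 - p) ^ 4 / 6)"
        using True by (intro nn_integral_has_integral_lebesgue) auto
      moreover have "ennreal ((1 - p) * (1 - q) * (p + q)) * indicator {0..1 - p} q * indicator {0..1} p
          = ennreal (indicator {0..1 - p} q * ((1 - p) * (1 - q) * (p + q)))" for q
        using True by (simp add: indicator_def)
      ultimately show ?thesis
        using True by simp
    qed simp
  qed
  also have "\<dots> = ennreal (7 / 60)"
  proof (rule nn_integral_has_integral_lebesgue)
    show "0 \<le> (1 - p)\<^sup>2 - (1 - p) ^ 3 + (1 - p) ^ 4 / 6" if "p \<in> {0..1}" for p :: real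
    proof -
      have "(1 - p) ^ 3 \<le> (1 - p)\<^sup>2"
        using that by (intro power_decreasing) auto
      then show ?thesis
        using that by (simp add: zero_le_even_power add_nonneg_nonneg)
    qed
    let ?F = "\<lambda>p::real. - ((1 - p) ^ 3 / 3) + (1 - p) ^ 4 / 4 - (1 - p) ^ 5 / 30"
    have "((\<lambda>p::real. (1 - p)\<^sup>2 - (1 - p) ^ 3 + (1 - p) ^ 4 / 6) has_integral (?F 1 - ?F 0)) {0..1}"
    proof (rule fundamental_theorem_of_calculus)
      fix p :: real
      have "(?F has_real_derivative (1 - p)\<^sup>2 - (1 - p) ^ 3 + (1 - p) ^ 4 / 6) (at p within {0..1})"
        by (rule DERIV_cong, (rule derivative_intros | simp)+)
      then show "(?F has_vector_derivative (1 - p)\<^sup>2 - (1 - p) ^ 3 + (1 - p) ^ 4 / 6) (at p within {0..1})"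
        by (simp only: has_real_derivative_iff_has_vector_derivative)
    qed simp
    then show "((\<lambda>p::real. (1 - p)\<^sup>2 - (1 - p) ^ 3 + (1 - p) ^ 4 / 6) has_integral 7 / 60) {0..1}"
      by simp
  qed
  finally show ?thesis .
qed

theorem theorem19:
  fixes n :: nat
  assumes "n = CARD('n::finite)"
  shows "psi n = 2 ^ n * fact n / real (odd_double_fact n) \<and>
      2 ^ n * Vol3 (int_hull :: ((real ^ 'n ^ 3) \<times> (real ^ 3)) set) =
        - 8 / ((real n + 1) * (2 * real n + 1) * (2 * real n + 3))
        + 15 * psi n / (2 * (real n + 1) * (2 * real n + 3))
        + 8 * falling3 n * J_int n / ((2 * real n + 1) * (2 * real n + 2) * (2 * real n + 3))
        + (24 * falling3 n * K_int n + 12 * real n * (real n - 1) * K'_int n)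
          / (real n * (2 * real n + 1) * (2 * real n + 2) * (2 * real n + 3)) \<and>
      2 ^ n * (Vol3 (lin_relax \<inter> assign_space :: ((real ^ 'n ^ 3) \<times> (real ^ 3)) set)
                  - Vol3 (int_hull :: ((real ^ 'n ^ 3) \<times> (real ^ 3)) set)) =
        4 * falling3 n * G_int n / ((2 * real n + 1) * (2 * real n + 2) * (2 * real n + 3))"
proof (cases "n = 1")
  case True
  then have n1: "CARD('n) = 1"
    using assms by simp
  have "psi 1 = 2 / 3"
    using psi_Suc[of 0] by (simp add: psi_0)
  moreover have "falling3 1 = 0"
    by (simp add: falling3_def)
  moreover have "Vol3 (int_hull :: ((real ^ 'n ^ 3) \<times> (real ^ 3)) set) = 7 / 60"
    unfolding Vol3_hull min_region_hull_eq_relax[OF n1] measure_def emeasure_min_region_relax_1[OF n1] by simp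
  moreover have "Vol3 (lin_relax \<inter> assign_space :: ((real ^ 'n ^ 3) \<times> (real ^ 3)) set) = 7 / 60"
    unfolding Vol3_relax measure_def emeasure_min_region_relax_1[OF n1] by simp
  ultimately show ?thesis
    unfolding True psi_eq[symmetric] by simp
next
  case False
  then have n2: "2 \<le> n"
    using assms zero_less_card_finite[where 'a = 'n] by linarith
  define r where "r = real n"
  have r: "2 \<le> r"
    using n2 by (simp add: r_def)
  let ?D = "(2 * r + 1) * (2 * r + 2) * (2 * r + 3)"
  have c: "15 / ((2 * r - 1) * (2 * r) * ?D) * (2 * r * (2 * r - 1) * ((2 * r + 1) * psi n - 2))
      = 15 * psi n / (2 * (r + 1) * (2 * r + 3)) - 30 / ?D"
  proof -
    have "15 / ((2 * r - 1) * (2 * r) * ?D) * (2 * r * (2 * r - 1) * ((2 * r + 1) * psi n - 2))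
        = 15 * ((2 * r + 1) * psi n - 2) / ?D"
    proof -
      have *: "15 / (u * v * d) * (v * u * w) = 15 * w / d" if "u \<noteq> 0" "v \<noteq> 0" "d \<noteq> 0" for u v w d :: real
        using that by (simp add: field_simps)
      show ?thesis
        by (rule *) (use r in auto)
    qed
    also have "\<dots> = 15 * psi n / (2 * (r + 1) * (2 * r + 3)) - 30 / ?D"
      using r by (simp add: divide_simps)
    finally show ?thesis .
  qed
  have d: "14 / ((2 * r - 2) * (2 * r - 1) * (2 * r) * ?D) * (4 * r * (r - 1) * (2 * r - 1)) = 14 / ?D"
    using r by (simp add: divide_simps)
  \<comment> \<open>The two constant parts, -30 from the \<open>psi\<close> term and 14 from three
    negative coordinates, add up to this.\<close>
  have e: "- 8 / ((r + 1) * (2 * r + 1) * (2 * r + 3)) = - 16 / ?D"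
    using r by (simp add: divide_simps)
  have b: "3 / (r * ?D) * (8 * falling3 n * K_int n + 4 * r * (r - 1) * K'_int n)
      = (24 * falling3 n * K_int n + 12 * r * (r - 1) * K'_int n) / (r * (2 * r + 1) * (2 * r + 2) * (2 * r + 3))"
    by (simp add: algebra_simps)
  have "2 ^ n * Vol3 (int_hull :: ((real ^ 'n ^ 3) \<times> (real ^ 3)) set) =
        - 8 / ((r + 1) * (2 * r + 1) * (2 * r + 3))
        + 15 * psi n / (2 * (r + 1) * (2 * r + 3))
        + 8 * falling3 n * J_int n / ?D
        + (24 * falling3 n * K_int n + 12 * r * (r - 1) * K'_int n)
          / (r * (2 * r + 1) * (2 * r + 2) * (2 * r + 3))"
    unfolding hull_volume[OF assms n2, folded r_def] b c d e by simp
  then show ?thesis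
    using gap_volume[OF assms n2] psi_eq[of n] unfolding r_def by simp
qed

end
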